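(* Let $d\ge 1$, $p>\max\{2,d/2\}$, and let $H_{\mathrm{per}}=-\Delta+V_{\mathrm{per}}$ and $H_\omega=H_{\mathrm{per}}+W_\omega$ be the periodic and the random Schrödinger operator with the random breather potential $W_\omega(x)=\sum_{k\in\mathbb Z^d}u_k\bigl(\frac{x-k}{\lambda_k(\omega)}\bigr)$ described in the context. Set $E_0:=\inf\sigma(H_{\mathrm{per}})$. Assume that for all $\kappa>0$ and all $k\in\mathbb Z^d$ we have $$\mathbb P\Bigl\{\Bigl\|u_k\Bigl(\frac{\cdot}{\lambda_k}\Bigr)\Bigr\|_{L^p(\mathbb R^d)}\le\kappa\Bigr\}>0.$$ Then for all $\varepsilon>0$ $$\mathbb P\{\omega\in\Omega:\inf\sigma(H_\omega)\le E_0+\varepsilon\}>0.$$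
   Context: Setting. $C_+>0$; for each $k\in\mathbb Z^d$, $u_k\in L^\infty(\mathbb R^d)$ is a non-negative, non-vanishing (measurable) function with support in the ball of radius $C_+$ around the origin; $\lambda_k:\Omega\to[0,C_+]$, $k\in\mathbb Z^d$, are independent random variables on a probability space $(\Omega,\mathcal A,\mathbb P)$. The random breather potential is $W_\omega(x):=\sum_{k\in\mathbb Z^d}u_k\bigl(\frac{x-k}{\lambda_k(\omega)}\bigr)$, where $u_k(y/\lambda):=0$ for $\lambda=0$. $V_{\mathrm{per}}\in L^\infty(\mathbb R^d,\mathbb R)$ is $\mathbb Z^d$-periodic, $H_{\mathrm{per}}:=-\Delta+V_{\mathrm{per}}$ and $H_\omega:=H_{\mathrm{per}}+W_\omega$ on $L^2(\mathbb R^d)$. Standing assumptions: (1) with $\mathcal D=(-\tfrac12,\tfrac12)^d$, $\sup_{\omega\in\Omega}\sup_{x\in\mathbb R^d}\|W_\omega\mathbf 1_{\mathcal D+x}\|_{L^p}<\infty$, so that $H_{\mathrm{per}}$ and $H_\omega$ are self-adjoint on the domain of $\Delta$; (2) there exists $\mu>0$ such that, with $|\cdot|$ denoting Lebesgue measure, $$\inf_{k\in\mathbb Z^d}\mathbb P\Bigl\{\Bigl|\bigl\{x\in[-\tfrac12,\tfrac12]^d: u_k\bigl(\tfrac{x-k}{\lambda_k}\bigr)\ge\mu\bigr\}\Bigr|\ge\mu\Bigr\}\ge\mu,$$ where the function $x\mapsto u_k(\frac{x-k}{\lambda_k})$ is to be understood as centred in the unit cell, i.e. the condition is imposed on $u_k(\frac{x}{\lambda_k})$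 for $x\in[-\tfrac12,\tfrac12]^d$ (so that $u_k$ has some support near the origin). *)

theory Defs
  imports "HOL-Analysis.Analysis" "HOL-Probability.Probability"
begin

text \<open>
  Elements of Lebesgue spaces are represented by Lebesgue measurable functions, and all
  notions below respect equality almost everywhere. Unbounded operators on the space of
  square integrable functions are represented by their graphs, which are closed under
  changing either component on a null set.
\<close>

definition L2 :: "(real^'d \<Rightarrow> complex) set" where
  "L2 = {f. f \<in> borel_measurable lebesgue \<and> integrable lebesgue (\<lambda>x. (norm (f x))\<^sup>2)}"

definition L2_norm :: "(real^'d \<Rightarrow> complex) \<Rightarrow> real" where
  "L2_norm f = sqrt (\<integral>x. (norm (f x))\<^sup>2 \<partial>lebesgue)"

definition Linf :: "(real^'d \<Rightarrow> real) set" where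
  "Linf = {f. f \<in> borel_measurable lebesgue \<and> (\<exists>B. AE x in lebesgue. \<bar>f x\<bar> \<le> B)}"

text \<open>The value is infinite if \<open>f\<close> is not p-integrable; only \<open>0 < p < \<infinity>\<close> is meant.\<close>

definition Lp_norm :: "real \<Rightarrow> (real^'d \<Rightarrow> real) \<Rightarrow> ennreal" where
  "Lp_norm p f =
     (let I = (\<integral>\<^sup>+x. ennreal (\<bar>f x\<bar> powr p) \<partial>lebesgue)
      in if I = \<infinity> then \<infinity> else ennreal (enn2real I powr (1 / p)))"

definition partial :: "'d \<Rightarrow> (real^'d \<Rightarrow> complex) \<Rightarrow> real^'d \<Rightarrow> complex" where
  "partial i f x = frechet_derivative f (at x) (axis i 1)"

primrec Ck :: "nat \<Rightarrow> (real^'d \<Rightarrow> complex) \<Rightarrow> bool" where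
  "Ck 0 f \<longleftrightarrow> continuous_on UNIV f"
| "Ck (Suc n) f \<longleftrightarrow> (\<forall>x. f differentiable (at x)) \<and> (\<forall>i. Ck n (partial i f))"

definition test_functions :: "(real^'d \<Rightarrow> complex) set" where
  "test_functions = {\<phi>. (\<forall>n. Ck n \<phi>) \<and> compact (closure {x. \<phi> x \<noteq> 0})}"

text \<open>
  The graph of the self-adjoint Laplacian: its domain consists of all square integrable
  functions whose distributional Laplacian is square integrable, i.e. it is the Sobolev
  space of order two.
\<close>

definition laplacian :: "((real^'d \<Rightarrow> complex) \<times> (real^'d \<Rightarrow> complex)) set" where
  "laplacian = {(f, h). f \<in> L2 \<and> h \<in> L2 \<and>
     (\<forall>\<phi>\<in>test_functions.
        (\<integral>x. f x * (\<Sum>i\<in>UNIV. partial i (partial i \<phi>) x) \<partial>lebesgue)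
        = (\<integral>x. h x * \<phi> x \<partial>lebesgue))}"

text \<open>
  The operator \<open>- \<Delta> + V\<close>. The product \<open>V f\<close> is required to be square integrable (being
  almost everywhere equal to \<open>g + h\<close>), so the domain is the domain of the Laplacian as soon
  as \<open>V\<close> maps the latter into the square integrable functions.
\<close>

definition schroedinger ::
    "(real^'d \<Rightarrow> real) \<Rightarrow> ((real^'d \<Rightarrow> complex) \<times> (real^'d \<Rightarrow> complex)) set" where
  "schroedinger V = {(f, g). f \<in> L2 \<and> g \<in> L2 \<and>
     (\<exists>h. (f, h) \<in> laplacian \<and>
          (AE x in lebesgue. g x = - h x + complex_of_real (V x) * f x))}"

text \<open>
  \<open>z\<close> is in the resolvent set of \<open>A\<close> if \<open>A - z\<close> is injective and onto with bounded inverse.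
\<close>

definition resolvent_set ::
    "((real^'d \<Rightarrow> complex) \<times> (real^'d \<Rightarrow> complex)) set \<Rightarrow> complex set" where
  "resolvent_set A = {z.
     (\<forall>(f, g)\<in>A. (AE x in lebesgue. g x - z * f x = 0) \<longrightarrow> (AE x in lebesgue. f x = 0)) \<and>
     (\<forall>h\<in>L2. \<exists>(f, g)\<in>A. AE x in lebesgue. g x - z * f x = h x) \<and>
     (\<exists>C. \<forall>(f, g)\<in>A. L2_norm f \<le> C * L2_norm (\<lambda>x. g x - z * f x))}"

definition spectrum ::
    "((real^'d \<Rightarrow> complex) \<times> (real^'d \<Rightarrow> complex)) set \<Rightarrow> complex set" where
  "spectrum A = - resolvent_set A"

text \<open>
  Only meant for self-adjoint operators, whose spectrum is real. The infimum is taken in the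
  extended reals, so that no arbitrary value arises for an empty or unbounded set.
\<close>

definition inf_spectrum :: "((real^'d \<Rightarrow> complex) \<times> (real^'d \<Rightarrow> complex)) set \<Rightarrow> ereal" where
  "inf_spectrum A = (INF E \<in> {E::real. complex_of_real E \<in> spectrum A}. ereal E)"

definition lattice_pt :: "int^'d \<Rightarrow> real^'d" where
  "lattice_pt k = (\<chi> i. real_of_int (k $ i))"

definition open_cell :: "(real^'d) set" where
  "open_cell = box (\<chi> i. - 1/2) (\<chi> i. 1/2)"

definition closed_cell :: "(real^'d) set" where
  "closed_cell = cbox (\<chi> i. - 1/2) (\<chi> i. 1/2)"

definition dilate :: "(real^'d \<Rightarrow> real) \<Rightarrow> real \<Rightarrow> real^'d \<Rightarrow> real" where
  "dilate u l y = (if l = 0 then 0 else u (y /\<^sub>R l))"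

text \<open>
  For profiles supported in a common ball and dilations from a bounded range, all but finitely
  many summands vanish for almost every \<open>x\<close>.
\<close>

definition breather ::
    "(int^'d \<Rightarrow> real^'d \<Rightarrow> real) \<Rightarrow> (int^'d \<Rightarrow> 'w \<Rightarrow> real) \<Rightarrow> 'w \<Rightarrow> real^'d \<Rightarrow> real" where
  "breather u lam \<omega> x = (\<Sum>\<^sub>\<infinity>k. dilate (u k) (lam k \<omega>) (x - lattice_pt k))"

end

theory Submission
  imports Defs "HOL-Real_Asymp.Real_Asymp"
begin

text \<open>
  The heat semigroup represents \<open>(c - \<Delta>)\<^sup>-\<^sup>1 f\<close> as the average of \<open>f (x + s z)\<close> over a standard
  Gaussian \<open>z\<close> and a weighted \<open>s\<close>. Hence the Laplacian of the statement is exactly \<open>c\<close> minus the inverse of a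
  bounded symmetric operator; moreover a potential \<open>V\<close> that is uniformly in \<open>L\<^sup>p\<close> on unit cells satisfies
  \<open>\<parallel>V (c - \<Delta>)\<^sup>-\<^sup>1\<parallel> \<le> 1/2\<close> for large \<open>c\<close>. So all operators have the same domain, the range of one fixed
  resolvent, \<open>- \<Delta> + V + c'\<close> is surjective for large \<open>c'\<close>, and the infimum of the spectrum is the infimum of the
  Rayleigh quotients. The latter can be taken over a countable dense set, which makes the event measurable.

  For the probability, choose a function in the domain whose Rayleigh quotient for the periodic operator is at most
  \<open>E\<^sub>0 + \<epsilon>/2\<close>. Its energy in the breather potential is small as soon as finitely many of the \<open>\<lambda>\<^sub>k\<close> are
  small, since far away only the uniform bound on the potential matters. Each \<open>\<lambda>\<^sub>k\<close> is small with positive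
  probability because the profiles do not vanish, and by independence so are finitely many at once.
\<close>

section \<open>Symmetric semibounded operators\<close>

text \<open>The spectral theorem is avoided. Symmetry, a lower bound and surjectivity of large
  positive shifts suffice: below the infimum of the Rayleigh quotients a Neumann series inverts the
  operator, and at the infimum a bounded inverse would let a nearly minimising vector be pushed past
  it. The Hilbert space may be taken real, since only real spectral parameters are compared.

  The obstacle is that the profiles are bounded one by one, not uniformly in k. All uniformity comes
  from the local norms, through a Gaussian average at scale s that costs s^(-d/p); against s ds this
  is integrable near zero because d/p < 2. The local bound is the same for all \<omega>, hence so
  are the constants, and one vector A gives the trial function f = (c - \<Delta>)^(-1) A for every
  realisation at once.

  The smallness hypothesis is used through scaling: dilation by \<lambda> multiplies the p-th power
  of the norm by \<lambda>^d, so a small norm of a profile that does not vanish forces a small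
  \<lambda>.\<close>

lemma neumann_surj:
  fixes T :: "'h::{real_normed_vector,complete_space} \<Rightarrow> 'h"
  assumes lin: "linear T" and bd: "\<And>x. norm (T x) \<le> q * norm x" and q: "0 \<le> q" "q < 1"
  shows "\<exists>b. b + T b = h"
proof -
  have "\<exists>!x. h - T x = x"
  proof (rule banach_fix_type[OF q], intro allI)
    fix x y
    have "dist (h - T x) (h - T y) = norm (T (x - y))"
      using linear_diff[OF lin, of x y] by (simp add: dist_norm norm_minus_commute)
    then show "dist (h - T x) (h - T y) \<le> q * dist x y"
      using bd[of "x - y"] by (simp add: dist_norm)
  qed
  then show ?thesis by (metis diff_add_cancel)
qed

text \<open>A graph instead of an operator, as in the encoding of the statement. \<open>surj\<close>
  for all large \<open>c\<close> plays the part of self-adjointness: it excludes symmetric operators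
  with too small a domain, for which \<open>A - E\<close> need not be onto for any \<open>E\<close>
  below \<open>m\<close>.\<close>

locale semibounded =
  fixes A :: "('h::{real_inner,complete_space} \<times> 'h) set" and m c0 :: real
  assumes sub: "subspace A"
    and sym: "\<And>f g f' g'. (f, g) \<in> A \<Longrightarrow> (f', g') \<in> A \<Longrightarrow> f \<bullet> g' = g \<bullet> f'"
    and lower: "\<And>f g. (f, g) \<in> A \<Longrightarrow> m * (norm f)\<^sup>2 \<le> f \<bullet> g"
    and surj: "\<And>c h. c \<ge> c0 \<Longrightarrow> \<exists>f g. (f, g) \<in> A \<and> g + c *\<^sub>R f = h"
begin

lemma bounded_below:
  assumes "(f, g) \<in> A"
  shows "(m - E) * norm f \<le> norm (g - E *\<^sub>R f)"
proof (cases "f = 0")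
  case False
  have "(m - E) * (norm f)\<^sup>2 \<le> f \<bullet> (g - E *\<^sub>R f)"
    using lower[OF assms] by (simp add: inner_diff_right power2_norm_eq_inner algebra_simps)
  also have "\<dots> \<le> norm f * norm (g - E *\<^sub>R f)" by (rule norm_cauchy_schwarz)
  finally have "norm f * ((m - E) * norm f) \<le> norm f * norm (g - E *\<^sub>R f)"
    by (simp add: power2_eq_square algebra_simps)
  then show ?thesis using False by simp
qed simp

text \<open>With R the inverse of A + c, of norm at most 1/(m + c), the operator A - E factors as (1
  - (E + c) R)(A + c). The first factor is onto by the Neumann series once |E + c| < m + c, which
  large c achieves because E < m.\<close>

lemma surj_below:
  assumes E: "E < m"
  shows "\<exists>f g. (f, g) \<in> A \<and> g - E *\<^sub>R f = h"
proof -
  \<comment> \<open>The second bound makes \<open>m + c\<close> positive and the third makes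
    \<open>- (E + c)\<close> smaller than \<open>m + c\<close>; that \<open>E + c\<close> is smaller
    as well is \<open>E < m\<close>.\<close>
  define c where "c = Max {c0, 1 - m, 1 - (E + m) / 2}"
  have c: "c \<ge> c0" "c \<ge> 1 - m" "c \<ge> 1 - (E + m) / 2" unfolding c_def by auto
  have "\<forall>h. \<exists>f. (f, h - c *\<^sub>R f) \<in> A"
  proof
    fix h obtain f g where "(f, g) \<in> A" "g + c *\<^sub>R f = h" using surj[OF c(1)] by blast
    then show "\<exists>f. (f, h - c *\<^sub>R f) \<in> A" by (metis add_diff_cancel_right')
  qed
  then obtain R where R: "\<And>h. (R h, h - c *\<^sub>R R h) \<in> A" by metis
  have bd: "(m + c) * norm f \<le> norm h" if "(f, h - c *\<^sub>R f) \<in> A" for f h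
    using bounded_below[OF that, of "- c"] by simp
  have uniq: "f = R h" if "(f, h - c *\<^sub>R f) \<in> A" for f h
  proof -
    have "(f, h - c *\<^sub>R f) - (R h, h - c *\<^sub>R R h) \<in> A"
      using that R sub by (blast intro: subspace_diff)
    then have "(f - R h, 0 - c *\<^sub>R (f - R h)) \<in> A" by (simp add: algebra_simps)
    from bd[OF this] c(2) have "norm (f - R h) \<le> 0" by (simp add: mult_le_0_iff)
    then show ?thesis by simp
  qed
  have lin: "linear R"
  proof (rule linearI)
    fix x y
    have "(R x, x - c *\<^sub>R R x) + (R y, y - c *\<^sub>R R y) \<in> A" using R sub by (blast intro: subspace_add)
    then show "R (x + y) = R x + R y" by (intro uniq[symmetric]) (simp add: algebra_simps)
  next
    fix r x
    have "r *\<^sub>R (R x, x - c *\<^sub>R R x) \<in> A" using R sub by (blast intro: subspace_scale)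
    then show "R (r *\<^sub>R x) = r *\<^sub>R R x" by (intro uniq[symmetric]) (simp add: algebra_simps)
  qed
  define q where "q = \<bar>E + c\<bar> / (m + c)"
  have q: "0 \<le> q" "q < 1" using c(2,3) E by (auto simp: q_def field_simps)
  have "\<exists>b. b + - (E + c) *\<^sub>R R b = h"
  proof (rule neumann_surj[OF _ _ q])
    show "linear (\<lambda>b. - (E + c) *\<^sub>R R b)" by (intro linear_compose_scale_right lin)
    fix x
    have "\<bar>E + c\<bar> * ((m + c) * norm (R x)) \<le> \<bar>E + c\<bar> * norm x"
      by (intro mult_left_mono bd R) auto
    moreover have "norm (- (E + c) *\<^sub>R R x) = \<bar>E + c\<bar> * norm (R x)"
      by (simp only: norm_scaleR abs_minus_cancel)
    ultimately show "norm (- (E + c) *\<^sub>R R x) \<le> q * norm x"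
      using c(2) by (simp only:) (simp add: q_def field_simps)
  qed
  then obtain b where b: "b - (E + c) *\<^sub>R R b = h"
    by (metis add.commute diff_conv_add_uminus scaleR_minus_left)
  have "b - c *\<^sub>R R b - E *\<^sub>R R b = h" using b by (simp add: algebra_simps)
  then show ?thesis using R by blast
qed

text \<open>Suppose A - m is onto with inverse bounded by C, and solve (A - m) k = f for a nearly
  minimising f. Passing from f to f - t k changes the quadratic form of A - m by -2 t <f, f> + t^2
  <k, f>. For small t the first term wins and makes a nonnegative form negative.\<close>

lemma bottom_not_regular:
  assumes approx: "\<And>\<delta>. \<delta> > 0 \<Longrightarrow> \<exists>f g. (f, g) \<in> A \<and> f \<noteq> 0 \<and> f \<bullet> g < (m + \<delta>) * (norm f)\<^sup>2"
    and onto: "\<And>h. \<exists>f g. (f, g) \<in> A \<and> g - m *\<^sub>R f = h"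
  shows "\<exists>f g. (f, g) \<in> A \<and> norm f > C * norm (g - m *\<^sub>R f)"
proof (rule ccontr)
  assume "\<not> ?thesis"
  then have C: "norm f \<le> C * norm (g - m *\<^sub>R f)" if "(f, g) \<in> A" for f g using that by force
  define K where "K = \<bar>C\<bar> + 1"
  have K: "K > 0" and KC: "C \<le> K" by (auto simp: K_def)
  obtain f g where fg: "(f, g) \<in> A" "f \<noteq> 0" "f \<bullet> g < (m + 1 / K) * (norm f)\<^sup>2"
    using approx[of "1 / K"] K by auto
  obtain k l where kl: "(k, l) \<in> A" and l: "l - m *\<^sub>R k = f" using onto by blast
  have nk: "norm k \<le> K * norm f"
    using C[OF kl] mult_right_mono[OF KC, of "norm f"] by (simp add: l)
  have kf: "k \<bullet> f \<le> K * (f \<bullet> f)"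
  proof -
    have "k \<bullet> f \<le> norm k * norm f" by (rule norm_cauchy_schwarz)
    also have "\<dots> \<le> K * norm f * norm f" using nk by (intro mult_right_mono) auto
    finally show ?thesis by (simp add: power2_norm_eq_inner[symmetric] power2_eq_square)
  qed
  \<comment> \<open>The minimiser of \<open>- 2 * t + K * t * t\<close>, with minimum
    \<open>- 1 / K\<close>; the accuracy demanded of \<open>f\<close> is the same
    \<open>1 / K\<close>.\<close>
  define t where "t = 1 / K"
  have "(f, g) - t *\<^sub>R (k, l) \<in> A" using fg kl sub by (blast intro: subspace_diff subspace_scale)
  then have "m * (norm (f - t *\<^sub>R k))\<^sup>2 \<le> (f - t *\<^sub>R k) \<bullet> (g - t *\<^sub>R l)"
    by (intro lower) simp
  then have "0 \<le> (f - t *\<^sub>R k) \<bullet> ((g - m *\<^sub>R f) - t *\<^sub>R (l - m *\<^sub>R k))"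
    by (simp add: power2_norm_eq_inner algebra_simps)
  also have "\<dots> = (f - t *\<^sub>R k) \<bullet> ((g - m *\<^sub>R f) - t *\<^sub>R f)" by (simp add: l)
  also have "\<dots> = (f \<bullet> g - m * (f \<bullet> f)) - t * (f \<bullet> f) - t * (k \<bullet> g - m * (k \<bullet> f)) + t * t * (k \<bullet> f)"
    by (simp add: algebra_simps)
  also have "k \<bullet> g - m * (k \<bullet> f) = f \<bullet> f"
  proof -
    have "k \<bullet> g = f \<bullet> l" using sym[OF fg(1) kl] by (simp add: inner_commute)
    moreover have "f \<bullet> f = f \<bullet> l - m * (f \<bullet> k)" using arg_cong[OF l, of "inner f"] by (simp add: inner_diff_right)
    ultimately show ?thesis by (simp add: inner_commute)
  qed
  also have "(f \<bullet> g - m * (f \<bullet> f)) - t * (f \<bullet> f) - t * (f \<bullet> f) + t * t * (k \<bullet> f)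
     \<le> (f \<bullet> g - m * (f \<bullet> f)) - t * (f \<bullet> f) - t * (f \<bullet> f) + t * t * (K * (f \<bullet> f))"
    using kf by (intro add_left_mono mult_left_mono) auto
  also have "\<dots> = f \<bullet> g - (m + 1 / K) * (norm f)\<^sup>2"
    using K by (simp add: t_def power2_norm_eq_inner field_simps)
  finally show False using fg(3) by simp
qed

end

section \<open>Square integrable functions\<close>

text \<open>The projection theorem in minimal form. Points of the span whose distances to x approach
  the infimum form a Cauchy sequence by the parallelogram law. At their limit z the residual x - z
  is orthogonal to S, hence zero.\<close>

lemma total_imp_closure_span:
  fixes S :: "'h::{real_inner,complete_space} set"
  assumes tot: "\<And>x. (\<And>s. s \<in> S \<Longrightarrow> x \<bullet> s = 0) \<Longrightarrow> x = 0"
  shows "closure (span S) = UNIV"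
proof -
  define Y where "Y = span S"
  have Ysub: "subspace Y" by (simp add: Y_def)
  have "x \<in> closure Y" for x
  proof -
    define d where "d = infdist x Y"
    have Y0: "Y \<noteq> {}" using Ysub subspace_0 by blast
    have dle: "d \<le> norm (x - y)" if "y \<in> Y" for y
      using infdist_le[OF that, of x] by (simp add: d_def dist_norm)
    have "\<exists>y\<in>Y. norm (x - y) < d + e" if "e > 0" for e
    proof -
      have "infdist x Y < d + e" using that by (simp add: d_def)
      then have "\<exists>y\<in>Y. dist x y < d + e"
        using Y0 by (simp add: infdist_notempty cINF_less_iff)
      then show ?thesis by (simp add: dist_norm)
    qed
    then have "\<forall>n::nat. \<exists>y\<in>Y. norm (x - y) < d + 1 / Suc n" by simp
    then obtain y where yY: "\<And>n::nat. y n \<in> Y" and yd: "\<And>n. norm (x - y n) < d + 1 / Suc n" by metis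
    have d0: "0 \<le> d" by (simp add: d_def infdist_nonneg)
    have par: "(norm (y i - y j))\<^sup>2 \<le> 2 * (norm (x - y i))\<^sup>2 + 2 * (norm (x - y j))\<^sup>2 - 4 * d\<^sup>2" for i j
    proof -
      have "(1/2) *\<^sub>R (y i + y j) \<in> Y" using yY Ysub by (blast intro: subspace_add subspace_scale)
      then have "d\<^sup>2 \<le> (norm (x - (1/2) *\<^sub>R (y i + y j)))\<^sup>2" using dle d0 by (intro power_mono) auto
      then show ?thesis by (simp add: power2_norm_eq_inner algebra_simps inner_commute)
    qed
    have "Cauchy y"
    proof (rule metric_CauchyI)
      fix e :: real assume e: "e > 0"
      have "(\<lambda>n. 4 * ((d + 1 / real (Suc n))\<^sup>2 - d\<^sup>2)) \<longlonglongrightarrow> 4 * ((d + 0)\<^sup>2 - d\<^sup>2)"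
        by (intro tendsto_intros LIMSEQ_Suc[OF lim_1_over_n])
      then have "eventually (\<lambda>n. 4 * ((d + 1 / real (Suc n))\<^sup>2 - d\<^sup>2) < e\<^sup>2) sequentially"
        using e by (intro order_tendstoD(2)) auto
      then obtain N where N: "\<And>n. n \<ge> N \<Longrightarrow> 4 * ((d + 1 / real (Suc n))\<^sup>2 - d\<^sup>2) < e\<^sup>2"
        unfolding eventually_sequentially by blast
      have "dist (y i) (y j) < e" if "i \<ge> N" "j \<ge> N" for i j
      proof -
        have *: "(norm (x - y k))\<^sup>2 < d\<^sup>2 + e\<^sup>2 / 4" if "k \<ge> N" for k
        proof -
          have "(norm (x - y k))\<^sup>2 \<le> (d + 1 / Suc k)\<^sup>2" using yd[of k] by (intro power_mono) auto
          then show ?thesis using N[OF that] by simp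
        qed
        have "(norm (y i - y j))\<^sup>2 < e\<^sup>2" using par[of i j] *[OF that(1)] *[OF that(2)] by linarith
        then show ?thesis using e by (simp add: dist_norm power2_less_imp_less)
      qed
      then show "\<exists>N. \<forall>m\<ge>N. \<forall>n\<ge>N. dist (y m) (y n) < e" by blast
    qed
    then obtain z where z: "y \<longlonglongrightarrow> z" using Cauchy_convergent convergent_def by blast
    have zY: "z \<in> closure Y" using z yY closure_sequential by blast
    have "(\<lambda>n. norm (x - y n)) \<longlonglongrightarrow> norm (x - z)" using z by (intro tendsto_intros)
    moreover have "(\<lambda>n. d + 1 / Suc n) \<longlonglongrightarrow> d + 0" by (intro tendsto_intros LIMSEQ_Suc[OF lim_1_over_n])
    ultimately have zd: "norm (x - z) \<le> d"
      using LIMSEQ_le[of "\<lambda>n. norm (x - y n)" _ "\<lambda>n. d + 1 / Suc n"] yd by (metis add_0_right less_imp_le)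
    have dcl: "d \<le> norm (x - w)" if "w \<in> closure Y" for w
    proof -
      have "closed {w. d \<le> norm (x - w)}" by (intro closed_Collect_le continuous_intros)
      then have "closure Y \<subseteq> {w. d \<le> norm (x - w)}" using dle by (intro closure_minimal) auto
      then show ?thesis using that by blast
    qed
    have csub: "subspace (closure Y)" 
    proof (rule subspaceI)
      show "0 \<in> closure Y" using Ysub subspace_0 closure_subset by blast
    next
      fix u v assume "u \<in> closure Y" "v \<in> closure Y"
      then obtain U V where "\<And>n::nat. U n \<in> Y" "U \<longlonglongrightarrow> u" "\<And>n::nat. V n \<in> Y" "V \<longlonglongrightarrow> v"
        unfolding closure_sequential by blast
      then have "(\<lambda>n. U n + V n) \<longlonglongrightarrow> u + v" "\<And>n. U n + V n \<in> Y"
        using Ysub by (auto intro: tendsto_add subspace_add)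
      then show "u + v \<in> closure Y"
        unfolding closure_sequential by (intro exI[of _ "\<lambda>n. U n + V n"]) simp
    next
      fix r u assume "u \<in> closure Y"
      then obtain U where "\<And>n::nat. U n \<in> Y" "U \<longlonglongrightarrow> u" unfolding closure_sequential by blast
      then have "(\<lambda>n. r *\<^sub>R U n) \<longlonglongrightarrow> r *\<^sub>R u" "\<And>n. r *\<^sub>R U n \<in> Y"
        using Ysub by (auto intro: tendsto_intros subspace_scale)
      then show "r *\<^sub>R u \<in> closure Y"
        unfolding closure_sequential by (intro exI[of _ "\<lambda>n. r *\<^sub>R U n"]) simp
    qed
    have "(x - z) \<bullet> s = 0" if s: "s \<in> S" for s
    proof (cases "s = 0")
      case False
      have sY: "s \<in> closure Y" using s closure_subset span_superset unfolding Y_def by blast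
      \<comment> \<open>The coefficient of the projection of the residual onto \<open>s\<close>:
        moving \<open>z\<close> by \<open>t *\<^sub>R s\<close> would lower the squared distance by
        \<open>((x - z) \<bullet> s)\<^sup>2 / (s \<bullet> s)\<close>.\<close>
      define t where "t = ((x - z) \<bullet> s) / (s \<bullet> s)"
      have "z + t *\<^sub>R s \<in> closure Y" using zY sY csub by (blast intro: subspace_add subspace_scale)
      from dcl[OF this] zd have "norm (x - z) \<le> norm (x - z - t *\<^sub>R s)" by (simp add: algebra_simps)
      then have "(norm (x - z))\<^sup>2 \<le> (norm (x - z - t *\<^sub>R s))\<^sup>2" by (simp add: power_mono)
      also have "\<dots> = (norm (x - z))\<^sup>2 - 2 * t * ((x - z) \<bullet> s) + t * t * (s \<bullet> s)"
        unfolding power2_norm_eq_inner inner_diff_left[of "x - z" "t *\<^sub>R s"] inner_diff_right[of _ "x - z" "t *\<^sub>R s"]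
        by (simp add: inner_commute[of s "x - z"])
      also have "t * t * (s \<bullet> s) = t * ((x - z) \<bullet> s)" using False by (simp add: t_def)
      finally have "t * ((x - z) \<bullet> s) \<le> 0" by simp
      then have "((x - z) \<bullet> s)\<^sup>2 / (s \<bullet> s) \<le> 0" by (simp add: t_def power2_eq_square)
      moreover have "s \<bullet> s > 0" using False by simp
      ultimately show ?thesis by (simp add: divide_le_0_iff)
    qed simp
    then have "x - z = 0" using tot by blast
    then show ?thesis using zY by simp
  qed
  then show ?thesis unfolding Y_def by auto
qed

text \<open>Countability is read off from an encoding by finite lists of pairs of a rational and an
  element of \<open>S\<close>; concatenation of lists is addition.\<close>

lemma rational_combinations_dense:
  fixes S :: "'h::real_normed_vector set"
  assumes S: "countable S"
  shows "\<exists>D. countable D \<and> span S \<subseteq> closure D"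
proof -
  define D where "D = (\<lambda>xs. \<Sum>(q, s)\<leftarrow>xs. real_of_rat q *\<^sub>R s) ` lists (UNIV \<times> S)"
  have cD: "countable D"
    unfolding D_def by (intro countable_image countable_lists countable_SIGMA) (auto simp: S)
  have add: "x + y \<in> D" if "x \<in> D" "y \<in> D" for x y
  proof -
    obtain xs ys where "x = (\<Sum>(q, s)\<leftarrow>xs. real_of_rat q *\<^sub>R s)" "xs \<in> lists (UNIV \<times> S)"
      "y = (\<Sum>(q, s)\<leftarrow>ys. real_of_rat q *\<^sub>R s)" "ys \<in> lists (UNIV \<times> S)"
      using \<open>x \<in> D\<close> \<open>y \<in> D\<close> unfolding D_def by blast
    then show ?thesis unfolding D_def by (intro image_eqI[of _ _ "xs @ ys"]) auto
  qed
  have "span S \<subseteq> closure D"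
  proof
    fix x assume "x \<in> span S"
    then show "x \<in> closure D"
    proof (induction rule: span_induct_alt)
      case base
      have "0 \<in> D" unfolding D_def by (intro image_eqI[of _ _ "[]"]) auto
      then show ?case using closure_subset by blast
    next
      case (step c s y)
      obtain yy where yy: "\<And>n. yy n \<in> D" "yy \<longlonglongrightarrow> y" using step.IH unfolding closure_sequential by blast
      have "\<exists>q. dist (real_of_rat q) c < 1 / Suc n" for n :: nat
      proof -
        obtain q where "c < real_of_rat q" "real_of_rat q < c + 1 / Suc n"
            using of_rat_dense[of c "c + 1 / Suc n"] by auto
        then show ?thesis by (intro exI[of _ q]) (simp add: dist_real_def)
      qed
      then obtain q where q: "\<And>n. dist (real_of_rat (q n)) c < 1 / Suc n" by metis
      have "(\<lambda>n. real_of_rat (q n)) \<longlonglongrightarrow> c"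
      proof (rule metric_tendsto_imp_tendsto[OF LIMSEQ_Suc[OF lim_1_over_n]], intro always_eventually allI)
        fix n show "dist (real_of_rat (q n)) c \<le> dist (1 / of_nat (Suc n)) (0 :: real)"
          using q[of n] by simp
      qed
      then have "(\<lambda>n. real_of_rat (q n) *\<^sub>R s + yy n) \<longlonglongrightarrow> c *\<^sub>R s + y" by (intro tendsto_intros yy)
      moreover have "real_of_rat (q n) *\<^sub>R s + yy n \<in> D" for n
        by (intro add yy) (use step.hyps in \<open>auto simp: D_def intro!: image_eqI[of _ _ "[(q n, s)]"]\<close>)
      ultimately show ?case
        unfolding closure_sequential by (intro exI[of _ "\<lambda>n. real_of_rat (q n) *\<^sub>R s + yy n"]) simp
    qed
  qed
  with cD show ?thesis by blast
qed

lemma total_imp_separable: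
  fixes S :: "'h::{real_inner,complete_space} set"
  assumes "countable S" and "\<And>x. (\<And>s. s \<in> S \<Longrightarrow> x \<bullet> s = 0) \<Longrightarrow> x = 0"
  shows "\<exists>D. countable D \<and> closure D = (UNIV :: 'h set)"
proof -
  obtain D where D: "countable D" "span S \<subseteq> closure D" using rational_combinations_dense assms(1) by blast
  have "closure (span S) \<subseteq> closure D" using D(2) closure_minimal by blast
  then show ?thesis using total_imp_closure_span[OF assms(2)] D(1) by auto
qed

section \<open>Square integrable functions as a vector space of functions\<close>

lemma L2_measurable: "f \<in> L2 \<Longrightarrow> f \<in> borel_measurable lebesgue"
  by (simp add: L2_def)

lemma L2_iff_nn:
  "f \<in> L2 \<longleftrightarrow> f \<in> borel_measurable lebesgue \<and> (\<integral>\<^sup>+x. ennreal ((norm (f x))\<^sup>2) \<partial>lebesgue) < \<infinity>"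
  by (auto simp: L2_def integrable_iff_bounded)

lemma L2_norm_nn:
  assumes "f \<in> L2"
  shows "(\<integral>\<^sup>+x. ennreal ((norm (f x))\<^sup>2) \<partial>lebesgue) = ennreal ((L2_norm f)\<^sup>2)"
  using assms by (simp add: L2_def L2_norm_def nn_integral_eq_integral)

lemma integrable_norm_mult_L2:
  fixes f g :: "real^'d \<Rightarrow> complex"
  assumes f: "f \<in> L2" and g: "g \<in> L2"
  shows "integrable lebesgue (\<lambda>x. norm (f x) * norm (g x))"
proof (rule Bochner_Integration.integrable_bound)
  show "integrable lebesgue (\<lambda>x. (norm (f x))\<^sup>2 + (norm (g x))\<^sup>2)" using f g by (simp add: L2_def)
  show "(\<lambda>x. norm (f x) * norm (g x)) \<in> borel_measurable lebesgue"
    using L2_measurable[OF f] L2_measurable[OF g] by measurable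
  show "AE x in lebesgue. norm (norm (f x) * norm (g x)) \<le> norm ((norm (f x))\<^sup>2 + (norm (g x))\<^sup>2)"
  proof (intro AE_I2)
    fix x
    have "2 * norm (f x) * norm (g x) \<le> (norm (f x))\<^sup>2 + (norm (g x))\<^sup>2"
      by (rule sum_squares_bound)
    moreover have nn: "0 \<le> norm (f x) * norm (g x)" by simp
    ultimately have "norm (f x) * norm (g x) \<le> (norm (f x))\<^sup>2 + (norm (g x))\<^sup>2"
      by linarith
    then show "norm (norm (f x) * norm (g x)) \<le> norm ((norm (f x))\<^sup>2 + (norm (g x))\<^sup>2)"
      by (simp only: real_norm_def abs_of_nonneg[OF nn] abs_of_nonneg[OF sum_power2_ge_zero])
  qed
qed

lemma integrable_mult_L2:
  assumes f: "f \<in> L2" and g: "g \<in> L2"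
  shows "integrable lebesgue (\<lambda>x. f x * g x)"
proof (rule Bochner_Integration.integrable_bound[OF integrable_norm_mult_L2[OF f g]])
  show "(\<lambda>x. f x * g x) \<in> borel_measurable lebesgue"
    using L2_measurable[OF f] L2_measurable[OF g] by measurable
qed (simp add: norm_mult)

lemma integrable_inner_L2:
  fixes f g :: "real^'d \<Rightarrow> complex"
  assumes f: "f \<in> L2" and g: "g \<in> L2"
  shows "integrable lebesgue (\<lambda>x. f x \<bullet> g x)"
proof (rule Bochner_Integration.integrable_bound[OF integrable_norm_mult_L2[OF f g]])
  show "(\<lambda>x. f x \<bullet> g x) \<in> borel_measurable lebesgue"
    using L2_measurable[OF f] L2_measurable[OF g] by measurable
qed (simp add: Cauchy_Schwarz_ineq2)

lemma L2_zero [simp]: "(\<lambda>x. 0) \<in> L2"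
  by (simp add: L2_def)

lemma L2_add [simp]:
  assumes f: "f \<in> L2" and g: "g \<in> L2"
  shows "(\<lambda>x. f x + g x) \<in> L2"
  unfolding L2_def
proof (intro CollectI conjI)
  show m: "(\<lambda>x. f x + g x) \<in> borel_measurable lebesgue"
    using L2_measurable[OF f] L2_measurable[OF g] by measurable
  have "(\<lambda>x. (norm (f x + g x))\<^sup>2) = (\<lambda>x. (norm (f x))\<^sup>2 + 2 * (f x \<bullet> g x) + (norm (g x))\<^sup>2)"
    by (simp add: power2_norm_eq_inner algebra_simps inner_commute)
  then show "integrable lebesgue (\<lambda>x. (norm (f x + g x))\<^sup>2)"
    using f g integrable_inner_L2[OF f g] by (simp add: L2_def)
qed

lemma L2_cmult [simp]:
  fixes c :: complex
  assumes f: "f \<in> L2"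
  shows "(\<lambda>x. c * f x) \<in> L2"
  using assms unfolding L2_def by (auto simp: norm_mult power_mult_distrib)

lemma L2_scaleR [simp]: "f \<in> L2 \<Longrightarrow> (\<lambda>x. r *\<^sub>R f x) \<in> L2"
  using L2_cmult[of f "complex_of_real r"] by (simp add: scaleR_conv_of_real)

lemma L2_uminus [simp]: "f \<in> L2 \<Longrightarrow> (\<lambda>x. - f x) \<in> L2"
  using L2_scaleR[of f "- 1"] by simp

lemma L2_diff [simp]: "f \<in> L2 \<Longrightarrow> g \<in> L2 \<Longrightarrow> (\<lambda>x. f x - g x) \<in> L2"
  using L2_add[of f "\<lambda>x. - g x"] by simp

lemma L2_norm_abs [simp]: "f \<in> L2 \<Longrightarrow> (\<lambda>x. complex_of_real (norm (f x))) \<in> L2"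
  unfolding L2_def by auto

lemma L2_cong_AE:
  assumes f: "f \<in> L2" and g: "AE x in lebesgue. g x = f x"
  shows "g \<in> L2"
proof -
  have "g \<in> borel_measurable lebesgue"
    by (rule borel_measurable_AE[OF L2_measurable[OF f]]) (use g in auto)
  moreover have "(\<integral>\<^sup>+x. ennreal ((norm (g x))\<^sup>2) \<partial>lebesgue) = (\<integral>\<^sup>+x. ennreal ((norm (f x))\<^sup>2) \<partial>lebesgue)"
    by (rule nn_integral_cong_AE) (use g in auto)
  ultimately show ?thesis using f by (simp add: L2_iff_nn)
qed

text \<open>Composing a merely Lebesgue measurable function with \<open>x + \<xi> n\<close> need not
  give a function measurable for the product sigma-algebra. Averages of translates and Fubini are
  therefore carried out on Borel representatives.\<close>

lemma lebesgue_borel_version: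
  fixes f :: "real^'d \<Rightarrow> complex"
  assumes "f \<in> borel_measurable lebesgue"
  shows "\<exists>g\<in>borel_measurable borel. AE x in lebesgue. f x = g x"
proof -
  have "(\<lambda>x. Re (f x)) \<in> borel_measurable lebesgue" "(\<lambda>x. Im (f x)) \<in> borel_measurable lebesgue"
    using assms by auto
  from this[THEN completion_ex_borel_measurable_real]
  obtain u v where [measurable]: "u \<in> borel_measurable lborel" "v \<in> borel_measurable lborel"
    and uv: "AE x in lborel. Re (f x) = u x" "AE x in lborel. Im (f x) = v x"
    by blast
  show ?thesis
  proof (intro bexI)
    show "(\<lambda>x. Complex (u x) (v x)) \<in> borel_measurable borel"
      unfolding Complex_eq measurable_lborel1[symmetric] by measurable
    have "AE x in lborel. f x = Complex (u x) (v x)" using uv by eventually_elim (simp add: complex_eq_iff)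
    then show "AE x in lebesgue. f x = Complex (u x) (v x)" by (rule AE_completion)
  qed
qed

section \<open>The Hilbert space of classes of square integrable functions\<close>

definition l2_eq :: "(real^'d \<Rightarrow> complex) \<Rightarrow> (real^'d \<Rightarrow> complex) \<Rightarrow> bool" where
  "l2_eq f g \<longleftrightarrow> f \<in> L2 \<and> g \<in> L2 \<and> (AE x in lebesgue. f x = g x)"

\<comment> \<open>The relation is partial: functions outside \<open>L2\<close> are related to
  nothing, so the type consists exactly of the classes of square integrable functions.\<close>
quotient_type 'd l2 = "(real^('d::finite)) \<Rightarrow> complex" / partial: l2_eq
  morphisms rep_l2 mk_l2
proof (rule part_equivpI)
  show "\<exists>f :: real^'d \<Rightarrow> complex. l2_eq f f" by (rule exI[of _ "\<lambda>x. 0"]) (simp add: l2_eq_def)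
  show "symp (l2_eq :: (real^'d \<Rightarrow> complex) \<Rightarrow> _)" by (auto simp: symp_def l2_eq_def)
  show "transp (l2_eq :: (real^'d \<Rightarrow> complex) \<Rightarrow> _)"
  proof (rule transpI)
    fix f g h :: "real^'d \<Rightarrow> complex"
    assume a: "l2_eq f g" "l2_eq g h"
    then have "AE x in lebesgue. f x = g x" "AE x in lebesgue. g x = h x" by (simp_all add: l2_eq_def)
    then have "AE x in lebesgue. f x = h x" by eventually_elim simp
    with a show "l2_eq f h" by (simp add: l2_eq_def)
  qed
qed

text \<open>The inner product is the real part of the usual complex one, complex values being read
  as vectors of the plane. The norm is the same, and shifts by real \<open>E\<close> are all that
  the spectral argument involves.\<close>

instantiation l2 :: (finite) real_inner
begin

lift_definition zero_l2 :: "'a l2" is "\<lambda>x. 0" by (simp add: l2_eq_def)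
lift_definition plus_l2 :: "'a l2 \<Rightarrow> 'a l2 \<Rightarrow> 'a l2" is "\<lambda>f g x. f x + g x" by (auto simp: l2_eq_def)
lift_definition minus_l2 :: "'a l2 \<Rightarrow> 'a l2 \<Rightarrow> 'a l2" is "\<lambda>f g x. f x - g x" by (auto simp: l2_eq_def)
lift_definition uminus_l2 :: "'a l2 \<Rightarrow> 'a l2" is "\<lambda>f x. - f x" by (auto simp: l2_eq_def)
lift_definition scaleR_l2 :: "real \<Rightarrow> 'a l2 \<Rightarrow> 'a l2" is "\<lambda>r f x. r *\<^sub>R f x" by (auto simp: l2_eq_def)
lift_definition inner_l2 :: "'a l2 \<Rightarrow> 'a l2 \<Rightarrow> real" is "\<lambda>f g. \<integral>x. f x \<bullet> g x \<partial>lebesgue"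
  by (intro Bochner_Integration.integral_cong_AE)
    (auto simp: l2_eq_def intro!: borel_measurable_inner L2_measurable)

definition norm_l2 :: "'a l2 \<Rightarrow> real" where "norm_l2 f = sqrt (f \<bullet> f)"
definition dist_l2 :: "'a l2 \<Rightarrow> 'a l2 \<Rightarrow> real" where "dist_l2 f g = norm (f - g)"
definition sgn_l2 :: "'a l2 \<Rightarrow> 'a l2" where "sgn_l2 f = inverse (norm f) *\<^sub>R f"
definition uniformity_l2 :: "('a l2 \<times> 'a l2) filter" where
  "uniformity_l2 = (INF e\<in>{0 <..}. principal {(x, y). dist x y < e})"
definition open_l2 :: "'a l2 set \<Rightarrow> bool" where
  "open_l2 U \<longleftrightarrow> (\<forall>x\<in>U. \<forall>\<^sub>F (x', y) in uniformity. x' = x \<longrightarrow> y \<in> U)"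

instance
proof
  fix a b c :: "'a l2" and r s :: real
  show "a + b + c = a + (b + c)" by transfer (simp add: l2_eq_def add.assoc)
  show "a + b = b + a" by transfer (simp add: l2_eq_def add.commute)
  show "0 + a = a" by transfer (simp add: l2_eq_def)
  show "- a + a = 0" by transfer (simp add: l2_eq_def)
  show "a - b = a + - b" by transfer (simp add: l2_eq_def)
  show "r *\<^sub>R (a + b) = r *\<^sub>R a + r *\<^sub>R b" by transfer (simp add: l2_eq_def scaleR_right_distrib)
  show "(r + s) *\<^sub>R a = r *\<^sub>R a + s *\<^sub>R a" by transfer (simp add: l2_eq_def scaleR_left_distrib)
  show "r *\<^sub>R s *\<^sub>R a = (r * s) *\<^sub>R a" by transfer (simp add: l2_eq_def)
  show "1 *\<^sub>R a = a" by transfer (simp add: l2_eq_def)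
  show "a \<bullet> b = b \<bullet> a" by transfer (simp add: inner_commute)
  show "(a + b) \<bullet> c = a \<bullet> c + b \<bullet> c"
    by transfer (simp add: l2_eq_def inner_add_left integrable_inner_L2)
  show "(r *\<^sub>R a) \<bullet> b = r * (a \<bullet> b)" by transfer simp
  show "0 \<le> a \<bullet> a" by transfer simp
  show "(a \<bullet> a = 0) = (a = 0)"
  proof transfer
    fix f :: "real^'a \<Rightarrow> complex" assume "l2_eq f f"
    then have f: "f \<in> L2" by (simp add: l2_eq_def)
    have "(\<integral>x. f x \<bullet> f x \<partial>lebesgue) = 0 \<longleftrightarrow> (AE x in lebesgue. f x \<bullet> f x = 0)"
      by (intro integral_nonneg_eq_0_iff_AE integrable_inner_L2 f) simp
    then show "((\<integral>x. f x \<bullet> f x \<partial>lebesgue) = 0) = l2_eq f (\<lambda>x. 0)" using f by (simp add: l2_eq_def)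
  qed
qed (simp_all add: norm_l2_def dist_l2_def sgn_l2_def uniformity_l2_def open_l2_def)

end

lemma mk_l2_eq_iff: "f \<in> L2 \<Longrightarrow> g \<in> L2 \<Longrightarrow> mk_l2 f = mk_l2 g \<longleftrightarrow> (AE x in lebesgue. f x = g x)"
  using Quotient_rel[OF Quotient_l2, of f g] by (simp add: l2_eq_def)

lemma mk_l2_exhaust:
  obtains f where "f \<in> L2" "f \<in> borel_measurable borel" "F = mk_l2 f"
proof -
  have "l2_eq (rep_l2 F) (rep_l2 F)" by (rule Quotient_rep_reflp[OF Quotient_l2])
  then have g: "rep_l2 F \<in> L2" by (simp add: l2_eq_def)
  have F: "F = mk_l2 (rep_l2 F)" by (rule Quotient_abs_rep[OF Quotient_l2, symmetric])
  then obtain f where f: "f \<in> borel_measurable borel" "AE x in lebesgue. rep_l2 F x = f x"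
    using lebesgue_borel_version[OF L2_measurable[OF g]] by blast
  have f2: "f \<in> L2" by (rule L2_cong_AE[OF g]) (use f in auto)
  have "F = mk_l2 f" using F mk_l2_eq_iff[OF g f2] f(2) by simp
  then show ?thesis using f2 f(1) by (intro that)
qed

lemma l2_eq_refl: "f \<in> L2 \<Longrightarrow> l2_eq f f" by (simp add: l2_eq_def)

lemma mk_l2_zero: "mk_l2 (\<lambda>x. 0) = 0"
  by (rule zero_l2.abs_eq[symmetric])

lemma mk_l2_add: "f \<in> L2 \<Longrightarrow> g \<in> L2 \<Longrightarrow> mk_l2 f + mk_l2 g = mk_l2 (\<lambda>x. f x + g x)"
  by (intro plus_l2.abs_eq l2_eq_refl)

lemma mk_l2_diff: "f \<in> L2 \<Longrightarrow> g \<in> L2 \<Longrightarrow> mk_l2 f - mk_l2 g = mk_l2 (\<lambda>x. f x - g x)"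
  by (intro minus_l2.abs_eq l2_eq_refl)

lemma mk_l2_scaleR: "f \<in> L2 \<Longrightarrow> r *\<^sub>R mk_l2 f = mk_l2 (\<lambda>x. r *\<^sub>R f x)"
  by (intro scaleR_l2.abs_eq l2_eq_refl)

lemma inner_mk_l2: "f \<in> L2 \<Longrightarrow> g \<in> L2 \<Longrightarrow> mk_l2 f \<bullet> mk_l2 g = (\<integral>x. f x \<bullet> g x \<partial>lebesgue)"
  by (intro inner_l2.abs_eq l2_eq_refl)

lemma norm_mk_l2: "f \<in> L2 \<Longrightarrow> norm (mk_l2 f) = L2_norm f"
  by (simp add: norm_l2_def inner_mk_l2 L2_norm_def power2_norm_eq_inner)

lemma nn_norm_mk_l2:
  "f \<in> L2 \<Longrightarrow> ennreal ((norm (mk_l2 f))\<^sup>2) = (\<integral>\<^sup>+x. ennreal ((norm (f x))\<^sup>2) \<partial>lebesgue)"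
  by (simp add: L2_norm_nn norm_mk_l2)

lemma integral_norm_mult_le:
  assumes f: "f \<in> L2" and g: "g \<in> L2"
  shows "(\<integral>x. norm (f x) * norm (g x) \<partial>lebesgue) \<le> L2_norm f * L2_norm g"
proof -
  let ?f = "\<lambda>x. complex_of_real (norm (f x))" and ?g = "\<lambda>x. complex_of_real (norm (g x))"
  have "(\<integral>x. norm (f x) * norm (g x) \<partial>lebesgue) = mk_l2 ?f \<bullet> mk_l2 ?g"
    using f g by (simp add: inner_mk_l2 inner_complex_def)
  also have "\<dots> \<le> norm (mk_l2 ?f) * norm (mk_l2 ?g)" by (rule norm_cauchy_schwarz)
  also have "\<dots> = L2_norm f * L2_norm g" using f g by (simp add: norm_mk_l2 L2_norm_def)
  finally show ?thesis .
qed

text \<open>Riesz-Fischer. A subsequence that converges almost everywhere provides the limit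
  \<open>g\<close>, and Fatou's lemma along it turns the Cauchy estimate into convergence in norm of
  the whole sequence.\<close>

instance l2 :: (finite) complete_space
proof
  fix X :: "nat \<Rightarrow> 'a l2"
  assume X: "Cauchy X"
  have "\<exists>f. f \<in> L2 \<and> X n = mk_l2 f" for n
    by (rule mk_l2_exhaust[of "X n"]) blast
  then obtain f where f: "\<And>n. f n \<in> L2" and Xf: "\<And>n. X n = mk_l2 (f n)" by metis
  have [measurable]: "f n \<in> borel_measurable lebesgue" for n using f L2_measurable by blast
  obtain h :: "real^'a \<Rightarrow> ennreal" where hb: "h \<in> borel_measurable lborel"
    and hi: "(\<integral>\<^sup>+x. h x \<partial>lborel) \<noteq> \<infinity>" and h: "\<And>x. 0 < h x \<and> h x < \<infinity>"
    using sigma_finite_measure.Ex_finite_integrable_function[OF sigma_finite_lborel] by auto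
  have hm[measurable]: "h \<in> borel_measurable lebesgue" using hb by (rule measurable_completion)
  \<comment> \<open>The root of a positive integrable function is square integrable and nowhere
    zero, so it can be divided out again after a pointwise limit has been found.\<close>
  define \<eta> where "\<eta> x = sqrt (enn2real (h x))" for x
  have \<eta>m[measurable]: "\<eta> \<in> borel_measurable lebesgue" unfolding \<eta>_def by measurable
  have \<eta>0: "\<eta> x > 0" for x using h[of x] by (simp add: \<eta>_def enn2real_positive_iff)
  have \<eta>2: "(\<lambda>x. complex_of_real (\<eta> x)) \<in> L2"
  proof -
    have "ennreal ((norm (complex_of_real (\<eta> x)))\<^sup>2) = h x" for x
      using h[of x] by (simp add: \<eta>_def)
    then show ?thesis unfolding L2_iff_nn using hi by (simp add: nn_integral_completion less_top)
  qed
  have sint: "integrable lebesgue (\<lambda>x. \<eta> x *\<^sub>R f n x)" for n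
    using integrable_mult_L2[OF \<eta>2 f[of n]] by (simp add: scaleR_conv_of_real)
  (* the square integrable weight makes the sequence Cauchy in L1, which yields a pointwise convergent subsequence *)
  have L1: "\<exists>N. \<forall>i\<ge>N. \<forall>j\<ge>N. (\<integral>x. norm (\<eta> x *\<^sub>R f i x - \<eta> x *\<^sub>R f j x) \<partial>lebesgue) < e"
    if e: "e > 0" for e :: real
  proof -
    define K where "K = L2_norm (\<lambda>x. complex_of_real (\<eta> x)) + 1"
    have K: "K > 0" "L2_norm (\<lambda>x. complex_of_real (\<eta> x)) \<le> K"
      by (simp_all add: K_def L2_norm_def add_nonneg_pos)
    obtain N where N: "\<And>i j. i \<ge> N \<Longrightarrow> j \<ge> N \<Longrightarrow> dist (X i) (X j) < e / K"
      using metric_CauchyD[OF X, of "e / K"] e K by auto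
    have "(\<integral>x. norm (\<eta> x *\<^sub>R f i x - \<eta> x *\<^sub>R f j x) \<partial>lebesgue) < e" if "i \<ge> N" "j \<ge> N" for i j
    proof -
      have "(\<integral>x. norm (\<eta> x *\<^sub>R f i x - \<eta> x *\<^sub>R f j x) \<partial>lebesgue)
        = (\<integral>x. norm (complex_of_real (\<eta> x)) * norm (f i x - f j x) \<partial>lebesgue)"
        by (simp add: scaleR_diff_right[symmetric])
      also have "\<dots> \<le> L2_norm (\<lambda>x. complex_of_real (\<eta> x)) * L2_norm (\<lambda>x. f i x - f j x)"
        by (intro integral_norm_mult_le \<eta>2) (simp add: f)
      also have "\<dots> = L2_norm (\<lambda>x. complex_of_real (\<eta> x)) * dist (X i) (X j)"
        by (simp add: Xf dist_norm mk_l2_diff norm_mk_l2 f)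
      also have "\<dots> \<le> K * dist (X i) (X j)" by (intro mult_right_mono K) simp
      also have "\<dots> < e" using N[OF that] K by (simp add: field_simps)
      finally show ?thesis .
    qed
    then show ?thesis by blast
  qed
  obtain r where r: "strict_mono r" and AEC: "AE x in lebesgue. Cauchy (\<lambda>i. \<eta> x *\<^sub>R f (r i) x)"
    by (rule cauchy_L1_AE_cauchy_subseq[OF sint L1])
  define g where "g x = lim (\<lambda>i. f (r i) x)" for x
  have gm[measurable]: "g \<in> borel_measurable lebesgue" unfolding g_def by (intro borel_measurable_lim_metric) measurable
  have AEl: "AE x in lebesgue. (\<lambda>i. f (r i) x) \<longlonglongrightarrow> g x"
    using AEC
  proof eventually_elim
    case (elim x)
    then obtain l where "(\<lambda>i. \<eta> x *\<^sub>R f (r i) x) \<longlonglongrightarrow> l"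
      using Cauchy_convergent convergent_def by blast
    then have "(\<lambda>i. inverse (\<eta> x) *\<^sub>R (\<eta> x *\<^sub>R f (r i) x)) \<longlonglongrightarrow> inverse (\<eta> x) *\<^sub>R l"
      by (intro tendsto_intros)
    then have "(\<lambda>i. f (r i) x) \<longlonglongrightarrow> inverse (\<eta> x) *\<^sub>R l" using \<eta>0[of x] by simp
    then show ?case by (simp add: g_def limI)
  qed
  have key: "\<exists>N. \<forall>n\<ge>N. (\<integral>\<^sup>+x. ennreal ((norm (f n x - g x))\<^sup>2) \<partial>lebesgue) \<le> ennreal (e\<^sup>2)" if e: "e > 0" for e :: real
  proof -
    obtain N where N: "\<And>i j. i \<ge> N \<Longrightarrow> j \<ge> N \<Longrightarrow> dist (X i) (X j) < e"
      using metric_CauchyD[OF X e] by auto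
    have "(\<integral>\<^sup>+x. ennreal ((norm (f n x - g x))\<^sup>2) \<partial>lebesgue) \<le> ennreal (e\<^sup>2)" if n: "n \<ge> N" for n
    proof -
      have "(\<integral>\<^sup>+x. ennreal ((norm (f n x - g x))\<^sup>2) \<partial>lebesgue)
        = (\<integral>\<^sup>+x. liminf (\<lambda>i. ennreal ((norm (f n x - f (r i) x))\<^sup>2)) \<partial>lebesgue)"
      proof (rule nn_integral_cong_AE, use AEl in eventually_elim)
        case (elim x)
        then have "(\<lambda>i. ennreal ((norm (f n x - f (r i) x))\<^sup>2)) \<longlonglongrightarrow> ennreal ((norm (f n x - g x))\<^sup>2)"
          by (intro tendsto_ennrealI tendsto_intros)
        then show ?case by (intro lim_imp_Liminf[symmetric] trivial_limit_sequentially)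
      qed
      also have "\<dots> \<le> liminf (\<lambda>i. \<integral>\<^sup>+x. ennreal ((norm (f n x - f (r i) x))\<^sup>2) \<partial>lebesgue)"
        by (intro nn_integral_liminf) measurable
      also have "\<dots> \<le> liminf (\<lambda>i. ennreal (e\<^sup>2))"
      proof (intro Liminf_mono, unfold eventually_sequentially, intro exI allI impI)
        fix i assume "i \<ge> N"
        then have "r i \<ge> N" using seq_suble[OF r, of i] by linarith
        then have "(dist (X n) (X (r i)))\<^sup>2 \<le> e\<^sup>2" using N[OF n, of "r i"] by (intro power_mono) auto
        then show "(\<integral>\<^sup>+x. ennreal ((norm (f n x - f (r i) x))\<^sup>2) \<partial>lebesgue) \<le> ennreal (e\<^sup>2)"
          by (simp add: L2_norm_nn f Xf dist_norm mk_l2_diff norm_mk_l2 ennreal_leI)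
      qed
      also have "\<dots> = ennreal (e\<^sup>2)" by (simp add: Liminf_const)
      finally show ?thesis .
    qed
    then show ?thesis by blast
  qed
  obtain N1 where "(\<integral>\<^sup>+x. ennreal ((norm (f N1 x - g x))\<^sup>2) \<partial>lebesgue) \<le> ennreal (1\<^sup>2)" using key[of 1] by auto
  then have "(\<integral>\<^sup>+x. ennreal ((norm (f N1 x - g x))\<^sup>2) \<partial>lebesgue) < \<infinity>"
    by (rule le_less_trans) simp
  then have d1: "(\<lambda>x. f N1 x - g x) \<in> L2" unfolding L2_iff_nn by simp
  have g: "g \<in> L2" using L2_diff[OF f[of N1] d1] by simp
  have "X \<longlonglongrightarrow> mk_l2 g"
  proof (rule metric_LIMSEQ_I)
    fix e :: real assume e: "e > 0"
    obtain N where N: "\<And>n. n \<ge> N \<Longrightarrow> (\<integral>\<^sup>+x. ennreal ((norm (f n x - g x))\<^sup>2) \<partial>lebesgue) \<le> ennreal ((e/2)\<^sup>2)"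
      using key[of "e/2"] e by auto
    have "dist (X n) (mk_l2 g) < e" if "n \<ge> N" for n
    proof -
      have "(L2_norm (\<lambda>x. f n x - g x))\<^sup>2 \<le> (e/2)\<^sup>2" using N[OF that] by (simp add: L2_norm_nn f g)
      then have "L2_norm (\<lambda>x. f n x - g x) \<le> e / 2" by (rule power2_le_imp_le) (use e in simp)
      moreover have "dist (X n) (mk_l2 g) = L2_norm (\<lambda>x. f n x - g x)"
        by (simp add: Xf dist_norm mk_l2_diff norm_mk_l2 f g)
      ultimately show ?thesis using e by linarith
    qed
    then show "\<exists>N. \<forall>n\<ge>N. dist (X n) (mk_l2 g) < e" by blast
  qed
  then show "convergent X" by (auto simp: convergent_def)
qed

section \<open>Averages of translates\<close>

lemma nn_integral_lborel_translate:
  fixes f :: "'a::euclidean_space \<Rightarrow> ennreal"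
  assumes [measurable]: "f \<in> borel_measurable borel"
  shows "(\<integral>\<^sup>+x. f (x + t) \<partial>lborel) = (\<integral>\<^sup>+x. f x \<partial>lborel)"
proof -
  have "(\<integral>\<^sup>+x. f x \<partial>lborel) = (\<integral>\<^sup>+x. f x \<partial>distr lborel borel ((+) t))" by (simp add: lborel_distr_plus)
  also have "\<dots> = (\<integral>\<^sup>+x. f (t + x) \<partial>lborel)" by (intro nn_integral_distr) auto
  finally show ?thesis by (simp add: add.commute)
qed

lemma integral_lborel_translate:
  fixes f :: "'a::euclidean_space \<Rightarrow> 'b::{banach, second_countable_topology}"
  assumes [measurable]: "f \<in> borel_measurable borel"
  shows "(\<integral>x. f (x + t) \<partial>lborel) = (\<integral>x. f x \<partial>lborel)"
proof -
  have "(\<integral>x. f x \<partial>lborel) = (\<integral>x. f x \<partial>distr lborel borel ((+) t))" by (simp add: lborel_distr_plus)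
  also have "\<dots> = (\<integral>x. f (t + x) \<partial>lborel)" by (intro integral_distr) auto
  finally show ?thesis by (simp add: add.commute)
qed

lemma integrable_lborel_translate:
  fixes f :: "'a::euclidean_space \<Rightarrow> 'b::{banach, second_countable_topology}"
  assumes "integrable lborel f"
  shows "integrable lborel (\<lambda>x. f (x + t))"
  using assms by (auto simp: integrable_iff_bounded nn_integral_lborel_translate[where f = "\<lambda>x. ennreal (norm (f x))"])

lemma ennreal_square_finite: "(x::ennreal)\<^sup>2 < \<infinity> \<Longrightarrow> x < \<infinity>"
  by (cases x) (auto simp: power2_eq_square ennreal_top_mult)

text \<open>An abstract form of convolution with a finite even measure, the law of
  \<open>\<xi>\<close> under \<open>N\<close>. Finiteness gives boundedness on the square integrable
  functions, evenness gives symmetry.\<close>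

locale averaging = finite_measure N
  for N :: "'n measure" +
  fixes \<xi> :: "'n \<Rightarrow> real^'d"
  assumes \<xi> [measurable]: "\<xi> \<in> borel_measurable N"
    and \<xi>_even: "distr N borel (\<lambda>n. - \<xi> n) = distr N borel \<xi>"
begin

text \<open>Where the integrand is not integrable the value is the default zero; for square
  integrable Borel \<open>a\<close> this concerns only a null set of \<open>x\<close>, by
  \<open>AE_integrable_translates\<close>.\<close>

definition avg :: "(real^'d \<Rightarrow> complex) \<Rightarrow> real^'d \<Rightarrow> complex" where
  "avg a x = (\<integral>n. a (x + \<xi> n) \<partial>N)"

sublocale LN: pair_sigma_finite lborel N ..

lemma avg_measurable [measurable]:
  assumes [measurable]: "a \<in> borel_measurable borel"
  shows "avg a \<in> borel_measurable borel"
  unfolding avg_def by measurable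

text \<open>A Schur test. Cauchy-Schwarz in \<open>n\<close> with the weights \<open>w\<close> and
  \<open>1 / w\<close> bounds the squared average; after Fubini a translation moves the shift from
  \<open>a\<close> to \<open>q\<close>, where \<kappa> takes over. The case of interest has the
  square of a potential as \<open>q\<close> and a power of the time variable in
  \<open>w\<close>.\<close>

lemma weighted_bound:
  fixes q :: "real^'d \<Rightarrow> ennreal" and w :: "'n \<Rightarrow> real"
  assumes a [measurable]: "a \<in> borel_measurable borel"
    and q [measurable]: "q \<in> borel_measurable borel"
    and w [measurable]: "w \<in> borel_measurable N"
    and w0: "\<And>n. w n > 0"
    and \<kappa>: "\<And>y. (\<integral>\<^sup>+n. ennreal (1 / w n) * q (y - \<xi> n) \<partial>N) \<le> \<kappa>"
  shows "(\<integral>\<^sup>+x. q x * (\<integral>\<^sup>+n. ennreal (norm (a (x + \<xi> n))) \<partial>N)\<^sup>2 \<partial>lborel)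
    \<le> (\<integral>\<^sup>+n. ennreal (w n) \<partial>N) * \<kappa> * (\<integral>\<^sup>+y. ennreal ((norm (a y))\<^sup>2) \<partial>lborel)"
proof -
  have CS: "(\<integral>\<^sup>+n. ennreal (norm (a (x + \<xi> n))) \<partial>N)\<^sup>2
    \<le> (\<integral>\<^sup>+n. ennreal (w n) \<partial>N) * (\<integral>\<^sup>+n. ennreal (1 / w n) * ennreal ((norm (a (x + \<xi> n)))\<^sup>2) \<partial>N)" for x
  proof -
    have "(\<integral>\<^sup>+n. ennreal (norm (a (x + \<xi> n))) \<partial>N)
      = (\<integral>\<^sup>+n. ennreal (sqrt (w n)) * ennreal (norm (a (x + \<xi> n)) / sqrt (w n)) \<partial>N)"
    proof (intro nn_integral_cong)
      fix n
      show "ennreal (norm (a (x + \<xi> n))) = ennreal (sqrt (w n)) * ennreal (norm (a (x + \<xi> n)) / sqrt (w n))"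
        using w0[of n] by (subst ennreal_mult[symmetric]) auto
    qed
    then have "(\<integral>\<^sup>+n. ennreal (norm (a (x + \<xi> n))) \<partial>N)\<^sup>2
      \<le> (\<integral>\<^sup>+n. (ennreal (sqrt (w n)))\<^sup>2 \<partial>N) * (\<integral>\<^sup>+n. (ennreal (norm (a (x + \<xi> n)) / sqrt (w n)))\<^sup>2 \<partial>N)"
      by (simp only:) (rule Cauchy_Schwarz_nn_integral; measurable)
    moreover have "(ennreal (sqrt (w n)))\<^sup>2 = ennreal (w n)" for n
      using w0[of n] by (simp add: ennreal_power)
    moreover have "(ennreal (norm (a (x + \<xi> n)) / sqrt (w n)))\<^sup>2
       = ennreal (1 / w n) * ennreal ((norm (a (x + \<xi> n)))\<^sup>2)" for n
      using w0[of n] by (simp add: ennreal_power ennreal_mult[symmetric] power_divide)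
    ultimately show ?thesis by simp
  qed
  let ?W = "\<integral>\<^sup>+n. ennreal (w n) \<partial>N"
  let ?X = "\<integral>\<^sup>+x. (\<integral>\<^sup>+n. q x * (ennreal (1 / w n) * ennreal ((norm (a (x + \<xi> n)))\<^sup>2)) \<partial>N) \<partial>lborel"
  have "(\<integral>\<^sup>+x. q x * (\<integral>\<^sup>+n. ennreal (norm (a (x + \<xi> n))) \<partial>N)\<^sup>2 \<partial>lborel)
    \<le> (\<integral>\<^sup>+x. ?W * (\<integral>\<^sup>+n. q x * (ennreal (1 / w n) * ennreal ((norm (a (x + \<xi> n)))\<^sup>2)) \<partial>N) \<partial>lborel)"
  proof (intro nn_integral_mono)
    fix x
    have "q x * (\<integral>\<^sup>+n. ennreal (norm (a (x + \<xi> n))) \<partial>N)\<^sup>2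
      \<le> q x * (?W * (\<integral>\<^sup>+n. ennreal (1 / w n) * ennreal ((norm (a (x + \<xi> n)))\<^sup>2) \<partial>N))"
      by (intro mult_left_mono CS) simp
    also have "\<dots> = ?W * (\<integral>\<^sup>+n. q x * (ennreal (1 / w n) * ennreal ((norm (a (x + \<xi> n)))\<^sup>2)) \<partial>N)"
      by (subst nn_integral_cmult) (auto simp: ac_simps)
    finally show "q x * (\<integral>\<^sup>+n. ennreal (norm (a (x + \<xi> n))) \<partial>N)\<^sup>2
      \<le> ?W * (\<integral>\<^sup>+n. q x * (ennreal (1 / w n) * ennreal ((norm (a (x + \<xi> n)))\<^sup>2)) \<partial>N)" .
  qed
  also have "\<dots> = ?W * ?X"
    by (intro nn_integral_cmult) measurable
  finally have le: "(\<integral>\<^sup>+x. q x * (\<integral>\<^sup>+n. ennreal (norm (a (x + \<xi> n))) \<partial>N)\<^sup>2 \<partial>lborel) \<le> ?W * ?X" .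
  have "(\<integral>\<^sup>+x. (\<integral>\<^sup>+n. q x * (ennreal (1 / w n) * ennreal ((norm (a (x + \<xi> n)))\<^sup>2)) \<partial>N) \<partial>lborel)
    = (\<integral>\<^sup>+n. (\<integral>\<^sup>+x. q x * (ennreal (1 / w n) * ennreal ((norm (a (x + \<xi> n)))\<^sup>2)) \<partial>lborel) \<partial>N)"
    by (rule LN.Fubini'[symmetric]) measurable
  also have "\<dots> = (\<integral>\<^sup>+n. (\<integral>\<^sup>+y. q (y - \<xi> n) * (ennreal (1 / w n) * ennreal ((norm (a y))\<^sup>2)) \<partial>lborel) \<partial>N)"
  proof (rule nn_integral_cong)
    fix n
    show "(\<integral>\<^sup>+x. q x * (ennreal (1 / w n) * ennreal ((norm (a (x + \<xi> n)))\<^sup>2)) \<partial>lborel)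
      = (\<integral>\<^sup>+y. q (y - \<xi> n) * (ennreal (1 / w n) * ennreal ((norm (a y))\<^sup>2)) \<partial>lborel)"
      using nn_integral_lborel_translate[of "\<lambda>y. q (y - \<xi> n) * (ennreal (1 / w n) * ennreal ((norm (a y))\<^sup>2))" "\<xi> n"]
      by simp
  qed
  also have "\<dots> = (\<integral>\<^sup>+y. (\<integral>\<^sup>+n. q (y - \<xi> n) * (ennreal (1 / w n) * ennreal ((norm (a y))\<^sup>2)) \<partial>N) \<partial>lborel)"
    by (rule LN.Fubini') measurable
  also have "\<dots> = (\<integral>\<^sup>+y. ennreal ((norm (a y))\<^sup>2) * (\<integral>\<^sup>+n. ennreal (1 / w n) * q (y - \<xi> n) \<partial>N) \<partial>lborel)"
    by (intro nn_integral_cong, subst nn_integral_cmult[symmetric]) (auto simp: ac_simps)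
  also have "\<dots> \<le> (\<integral>\<^sup>+y. ennreal ((norm (a y))\<^sup>2) * \<kappa> \<partial>lborel)"
    by (intro nn_integral_mono mult_left_mono \<kappa>) simp
  also have "\<dots> = (\<integral>\<^sup>+y. ennreal ((norm (a y))\<^sup>2) \<partial>lborel) * \<kappa>"
    by (intro nn_integral_multc) measurable
  finally have "?X \<le> \<kappa> * (\<integral>\<^sup>+y. ennreal ((norm (a y))\<^sup>2) \<partial>lborel)" by (simp add: mult.commute)
  from order_trans[OF le mult_left_mono[OF this]] show ?thesis by (simp add: mult.assoc)
qed

lemma mean_bound:
  assumes [measurable]: "a \<in> borel_measurable borel"
  shows "(\<integral>\<^sup>+x. (\<integral>\<^sup>+n. ennreal (norm (a (x + \<xi> n))) \<partial>N)\<^sup>2 \<partial>lborel)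
    \<le> (emeasure N (space N))\<^sup>2 * (\<integral>\<^sup>+y. ennreal ((norm (a y))\<^sup>2) \<partial>lborel)"
  using weighted_bound[of a "\<lambda>x. 1" "\<lambda>n. 1" "emeasure N (space N)"]
  by (simp add: power2_eq_square)

lemma norm_avg_le: "ennreal (norm (avg a x)) \<le> (\<integral>\<^sup>+n. ennreal (norm (a (x + \<xi> n))) \<partial>N)"
proof (cases "integrable N (\<lambda>n. a (x + \<xi> n))")
  case True
  then show ?thesis unfolding avg_def by (rule integral_norm_bound_ennreal)
qed (simp add: avg_def not_integrable_integral_eq)

lemma norm_avg_sq_le:
  "ennreal ((norm (avg a x))\<^sup>2) \<le> (\<integral>\<^sup>+n. ennreal (norm (a (x + \<xi> n))) \<partial>N)\<^sup>2"
  using power_mono[OF norm_avg_le[of a x], of 2] by (simp add: ennreal_power)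

lemma borel_L2_nn:
  fixes a :: "real^'d \<Rightarrow> complex"
  assumes "a \<in> borel_measurable borel"
  shows "a \<in> L2 \<longleftrightarrow> (\<integral>\<^sup>+x. ennreal ((norm (a x))\<^sup>2) \<partial>lborel) < \<infinity>"
  using assms by (auto simp: L2_iff_nn nn_integral_completion intro: measurable_completion)

lemma avg_L2:
  assumes a [measurable]: "a \<in> borel_measurable borel" and a2: "a \<in> L2"
  shows "avg a \<in> L2" and "L2_norm (avg a) \<le> measure N (space N) * L2_norm a"
proof -
  have fin: "(\<integral>\<^sup>+y. ennreal ((norm (a y))\<^sup>2) \<partial>lborel) = ennreal ((L2_norm a)\<^sup>2)"
    using L2_norm_nn[OF a2] by (simp add: nn_integral_completion)
  have le: "(\<integral>\<^sup>+x. ennreal ((norm (avg a x))\<^sup>2) \<partial>lborel) \<le> ennreal ((measure N (space N) * L2_norm a)\<^sup>2)"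
  proof -
    have "(\<integral>\<^sup>+x. ennreal ((norm (avg a x))\<^sup>2) \<partial>lborel)
      \<le> (\<integral>\<^sup>+x. (\<integral>\<^sup>+n. ennreal (norm (a (x + \<xi> n))) \<partial>N)\<^sup>2 \<partial>lborel)"
      by (intro nn_integral_mono norm_avg_sq_le)
    also have "\<dots> \<le> (emeasure N (space N))\<^sup>2 * ennreal ((L2_norm a)\<^sup>2)"
      using mean_bound[OF a] by (simp add: fin)
    also have "\<dots> = ennreal ((measure N (space N) * L2_norm a)\<^sup>2)"
      by (simp add: emeasure_eq_measure ennreal_power ennreal_mult[symmetric] power_mult_distrib)
    finally show ?thesis .
  qed
  show L2: "avg a \<in> L2" using le by (subst borel_L2_nn) (auto intro: le_less_trans)
  have "ennreal ((L2_norm (avg a))\<^sup>2) \<le> ennreal ((measure N (space N) * L2_norm a)\<^sup>2)"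
    using le L2_norm_nn[OF L2] by (simp add: nn_integral_completion)
  then have "(L2_norm (avg a))\<^sup>2 \<le> (measure N (space N) * L2_norm a)\<^sup>2" by simp
  then show "L2_norm (avg a) \<le> measure N (space N) * L2_norm a"
    by (rule power2_le_imp_le) (simp add: L2_norm_def)
qed

lemma AE_integrable_translates:
  assumes a [measurable]: "a \<in> borel_measurable borel" and a2: "a \<in> L2"
  shows "AE x in lborel. integrable N (\<lambda>n. a (x + \<xi> n))"
proof -
  have "(\<integral>\<^sup>+x. (\<integral>\<^sup>+n. ennreal (norm (a (x + \<xi> n))) \<partial>N)\<^sup>2 \<partial>lborel) < \<infinity>"
    using a2 unfolding borel_L2_nn[OF a]
    by (intro le_less_trans[OF mean_bound[OF a]]) (simp add: emeasure_eq_measure ennreal_mult_less_top ennreal_power)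
  then have "(\<integral>\<^sup>+x. (\<integral>\<^sup>+n. ennreal (norm (a (x + \<xi> n))) \<partial>N)\<^sup>2 \<partial>lborel) \<noteq> \<infinity>" by simp
  then have "AE x in lborel. (\<integral>\<^sup>+n. ennreal (norm (a (x + \<xi> n))) \<partial>N)\<^sup>2 \<noteq> \<infinity>"
    by (intro nn_integral_PInf_AE) measurable
  then show ?thesis
  proof eventually_elim
    case (elim x)
    then have "(\<integral>\<^sup>+n. ennreal (norm (a (x + \<xi> n))) \<partial>N)\<^sup>2 < \<infinity>" by (simp add: less_top)
    then have "(\<integral>\<^sup>+n. ennreal (norm (a (x + \<xi> n))) \<partial>N) < \<infinity>" by (rule ennreal_square_finite)
    then show ?case by (subst integrable_iff_bounded) simp
  qed
qed

text \<open>For a given x the translates might hit the exceptional null set for many n. By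
  \<open>mean_bound\<close>, applied to the difference, for almost every x they do so only on a null
  set of n.\<close>

lemma avg_cong_AE:
  assumes a [measurable]: "a \<in> borel_measurable borel" and b [measurable]: "b \<in> borel_measurable borel"
    and ab: "AE x in lebesgue. a x = b x"
  shows "AE x in lebesgue. avg a x = avg b x"
proof -
  let ?c = "\<lambda>x. a x - b x"
  have ab': "AE x in lborel. a x = b x" using ab by (simp add: AE_completion_iff)
  have "(\<integral>\<^sup>+x. ennreal ((norm (?c x))\<^sup>2) \<partial>lborel) = 0"
    by (subst nn_integral_0_iff_AE) (use ab' in auto)
  then have "(\<integral>\<^sup>+x. (\<integral>\<^sup>+n. ennreal (norm (?c (x + \<xi> n))) \<partial>N)\<^sup>2 \<partial>lborel) = 0"
    using mean_bound[of ?c] by simp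
  then have "AE x in lborel. (\<integral>\<^sup>+n. ennreal (norm (?c (x + \<xi> n))) \<partial>N)\<^sup>2 = 0"
    by (subst (asm) nn_integral_0_iff_AE) measurable
  then have "AE x in lborel. avg a x = avg b x"
  proof eventually_elim
    case (elim x)
    then have "AE n in N. ennreal (norm (?c (x + \<xi> n))) = 0"
      by (simp add: nn_integral_0_iff_AE)
    then show ?case unfolding avg_def by (intro integral_cong_AE) auto
  qed
  then show ?thesis by (rule AE_completion)
qed

lemma avg_add_AE:
  assumes a [measurable]: "a \<in> borel_measurable borel" and b [measurable]: "b \<in> borel_measurable borel"
    and a2: "a \<in> L2" and b2: "b \<in> L2"
  shows "AE x in lebesgue. avg (\<lambda>x. a x + b x) x = avg a x + avg b x"
proof (rule AE_completion)
  show "AE x in lborel. avg (\<lambda>x. a x + b x) x = avg a x + avg b x"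
    using AE_integrable_translates[OF a a2] AE_integrable_translates[OF b b2]
    by eventually_elim (simp add: avg_def)
qed

lemma avg_scaleR: "avg (\<lambda>x. r *\<^sub>R a x) = (\<lambda>x. r *\<^sub>R avg a x)"
  by (simp add: avg_def fun_eq_iff)

lemma avg_cnj: "avg (\<lambda>x. cnj (a x)) = (\<lambda>x. cnj (avg a x))"
  by (simp add: avg_def fun_eq_iff)

lemma avg_minus:
  assumes [measurable]: "b \<in> borel_measurable borel"
  shows "(\<integral>n. b (x - \<xi> n) \<partial>N) = avg b x"
proof -
  have "(\<integral>n. b (x - \<xi> n) \<partial>N) = (\<integral>y. b (x + y) \<partial>distr N borel (\<lambda>n. - \<xi> n))"
    by (subst integral_distr) auto
  also have "\<dots> = (\<integral>y. b (x + y) \<partial>distr N borel \<xi>)" by (simp only: \<xi>_even)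
  also have "\<dots> = avg b x" unfolding avg_def by (subst integral_distr) auto
  finally show ?thesis .
qed

text \<open>Fubini, licensed by Cauchy-Schwarz together with \<open>mean_bound\<close>; a
  translation and the evenness of the shift then carry the average to the other factor. The second
  form, with the average outermost, allows an identity known for every single translate to be
  averaged.\<close>

lemma integral_avg_mult:
  assumes a [measurable]: "a \<in> borel_measurable borel" and b [measurable]: "b \<in> borel_measurable borel"
    and a2: "a \<in> L2" and b2: "b \<in> L2"
  shows "(\<integral>x. avg a x * b x \<partial>lebesgue) = (\<integral>x. a x * avg b x \<partial>lebesgue)"
    and "(\<integral>n. (\<integral>x. a (x + \<xi> n) * b x \<partial>lebesgue) \<partial>N) = (\<integral>x. avg a x * b x \<partial>lebesgue)"
proof -
  have abs: "(\<integral>\<^sup>+x. ennreal (norm (b x)) * (\<integral>\<^sup>+n. ennreal (norm (a (x + \<xi> n))) \<partial>N) \<partial>lborel) < \<infinity>"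
  proof -
    have "(\<integral>\<^sup>+x. ennreal (norm (b x)) * (\<integral>\<^sup>+n. ennreal (norm (a (x + \<xi> n))) \<partial>N) \<partial>lborel)\<^sup>2
      \<le> (\<integral>\<^sup>+x. (ennreal (norm (b x)))\<^sup>2 \<partial>lborel)
        * (\<integral>\<^sup>+x. (\<integral>\<^sup>+n. ennreal (norm (a (x + \<xi> n))) \<partial>N)\<^sup>2 \<partial>lborel)"
      by (rule Cauchy_Schwarz_nn_integral) measurable
    also have "\<dots> \<le> (\<integral>\<^sup>+x. ennreal ((norm (b x))\<^sup>2) \<partial>lborel)
        * ((emeasure N (space N))\<^sup>2 * (\<integral>\<^sup>+y. ennreal ((norm (a y))\<^sup>2) \<partial>lborel))"
      by (intro mult_mono mean_bound) (auto simp: ennreal_power)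
    also have "\<dots> < \<infinity>"
      using a2 b2 unfolding borel_L2_nn[OF a] borel_L2_nn[OF b]
      by (simp add: emeasure_eq_measure ennreal_mult_less_top ennreal_power)
    finally show ?thesis by (rule ennreal_square_finite)
  qed
  have int: "integrable (lborel \<Otimes>\<^sub>M N) (\<lambda>(x, n). a (x + \<xi> n) * b x)"
  proof (subst integrable_iff_bounded, intro conjI)
    have "(\<integral>\<^sup>+z. ennreal (norm (case z of (x, n) \<Rightarrow> a (x + \<xi> n) * b x)) \<partial>(lborel \<Otimes>\<^sub>M N))
      = (\<integral>\<^sup>+x. (\<integral>\<^sup>+n. ennreal (norm (b x)) * ennreal (norm (a (x + \<xi> n))) \<partial>N) \<partial>lborel)"
      by (subst nn_integral_fst[symmetric]) (auto simp: norm_mult ennreal_mult mult.commute)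
    also have "\<dots> = (\<integral>\<^sup>+x. ennreal (norm (b x)) * (\<integral>\<^sup>+n. ennreal (norm (a (x + \<xi> n))) \<partial>N) \<partial>lborel)"
      by (intro nn_integral_cong nn_integral_cmult) measurable
    finally show "(\<integral>\<^sup>+z. ennreal (norm (case z of (x, n) \<Rightarrow> a (x + \<xi> n) * b x)) \<partial>(lborel \<Otimes>\<^sub>M N)) < \<infinity>"
      using abs by simp
  qed measurable
  have F: "(\<integral>n. (\<integral>x. a (x + \<xi> n) * b x \<partial>lborel) \<partial>N) = (\<integral>x. avg a x * b x \<partial>lborel)"
    using LN.Fubini_integral[OF int] by (simp add: avg_def)
  then show "(\<integral>n. (\<integral>x. a (x + \<xi> n) * b x \<partial>lebesgue) \<partial>N) = (\<integral>x. avg a x * b x \<partial>lebesgue)"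
    by (simp add: integral_completion)
  have int2: "integrable (lborel \<Otimes>\<^sub>M N) (\<lambda>(x, n). a x * b (x - \<xi> n))"
  proof (subst integrable_iff_bounded, intro conjI)
    have "(\<integral>\<^sup>+z. ennreal (norm (case z of (x, n) \<Rightarrow> a x * b (x - \<xi> n))) \<partial>(lborel \<Otimes>\<^sub>M N))
      = (\<integral>\<^sup>+n. (\<integral>\<^sup>+x. ennreal (norm (a x * b (x - \<xi> n))) \<partial>lborel) \<partial>N)"
      by (subst LN.nn_integral_snd[symmetric]) auto
    also have "\<dots> = (\<integral>\<^sup>+n. (\<integral>\<^sup>+x. ennreal (norm (a (x + \<xi> n) * b x)) \<partial>lborel) \<partial>N)"
    proof (rule nn_integral_cong)
      fix n
      show "(\<integral>\<^sup>+x. ennreal (norm (a x * b (x - \<xi> n))) \<partial>lborel) = (\<integral>\<^sup>+x. ennreal (norm (a (x + \<xi> n) * b x)) \<partial>lborel)"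
        using nn_integral_lborel_translate[of "\<lambda>x. ennreal (norm (a x * b (x - \<xi> n)))" "\<xi> n"] by simp
    qed
    also have "\<dots> = (\<integral>\<^sup>+z. ennreal (norm (case z of (x, n) \<Rightarrow> a (x + \<xi> n) * b x)) \<partial>(lborel \<Otimes>\<^sub>M N))"
      by (subst LN.nn_integral_snd[symmetric]) auto
    also have "\<dots> < \<infinity>" using int by (simp add: integrable_iff_bounded)
    finally show "(\<integral>\<^sup>+z. ennreal (norm (case z of (x, n) \<Rightarrow> a x * b (x - \<xi> n))) \<partial>(lborel \<Otimes>\<^sub>M N)) < \<infinity>" .
  qed measurable
  have "(\<integral>x. avg a x * b x \<partial>lborel) = (\<integral>n. (\<integral>x. a (x + \<xi> n) * b x \<partial>lborel) \<partial>N)" by (simp add: F)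
  also have "\<dots> = (\<integral>n. (\<integral>x. a x * b (x - \<xi> n) \<partial>lborel) \<partial>N)"
  proof (rule Bochner_Integration.integral_cong[OF refl])
    fix n
    show "(\<integral>x. a (x + \<xi> n) * b x \<partial>lborel) = (\<integral>x. a x * b (x - \<xi> n) \<partial>lborel)"
      using integral_lborel_translate[of "\<lambda>x. a x * b (x - \<xi> n)" "\<xi> n"] by simp
  qed
  also have "\<dots> = (\<integral>x. (\<integral>n. a x * b (x - \<xi> n) \<partial>N) \<partial>lborel)"
    using LN.Fubini_integral[OF int2] by simp
  also have "\<dots> = (\<integral>x. a x * avg b x \<partial>lborel)"
    by (simp add: avg_minus[OF b])
  finally show "(\<integral>x. avg a x * b x \<partial>lebesgue) = (\<integral>x. a x * avg b x \<partial>lebesgue)"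
    by (simp add: integral_completion)
qed

end

section \<open>The Gaussian resolvent and locally uniform potentials\<close>

definition gauss_density :: "real^'d \<Rightarrow> real" where
  "gauss_density z = (\<Prod>b\<in>Basis. std_normal_density (z \<bullet> b))"

text \<open>For positive \<open>c\<close> the density of a Rayleigh distribution divided by
  \<open>c\<close>. Its total mass \<open>1 / c\<close> becomes the norm bound of the
  resolvent.\<close>

definition rayleigh :: "real \<Rightarrow> real \<Rightarrow> real" where
  "rayleigh c s = indicator {0<..} s * (s * exp (- c * s\<^sup>2 / 2))"

definition gauss_measure :: "(real^'d) measure" where
  "gauss_measure = density lborel gauss_density"

text \<open>Time is \<open>t = s\<^sup>2 / 2\<close>, so that the heat kernel at time \<open>t\<close> has variance \<open>2 t = s\<^sup>2\<close> and \<open>exp (- c t) dt\<close> becomes \<open>rayleigh c s ds\<close>.\<close>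

definition time_measure :: "real \<Rightarrow> real measure" where
  "time_measure c = density lborel (rayleigh c)"

definition heat_measure :: "real \<Rightarrow> (real \<times> (real^'d)) measure" where
  "heat_measure c = time_measure c \<Otimes>\<^sub>M gauss_measure"

definition shift :: "real \<times> (real^'d) \<Rightarrow> real^'d" where
  "shift n = fst n *\<^sub>R snd n"

section \<open>The law of a Gaussian shift with a random scale\<close>

lemma gauss_density_nonneg [simp]: "0 \<le> gauss_density z"
  unfolding gauss_density_def by (intro prod_nonneg) simp

lemma gauss_density_measurable [measurable]: "gauss_density \<in> borel_measurable borel"
  unfolding gauss_density_def by measurable

lemma rayleigh_nonneg [simp]: "0 \<le> rayleigh c s"
  by (auto simp: rayleigh_def indicator_def)

lemma rayleigh_measurable [measurable]: "rayleigh c \<in> borel_measurable borel"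
  unfolding rayleigh_def by measurable

lemma sets_gauss_measure [measurable_cong, simp]: "sets gauss_measure = sets borel"
  by (simp add: gauss_measure_def)

lemma sets_time_measure [measurable_cong, simp]: "sets (time_measure c) = sets borel"
  by (simp add: time_measure_def)

lemma sets_heat_measure [measurable_cong]: "sets (heat_measure c) = sets (borel \<Otimes>\<^sub>M borel)"
  unfolding heat_measure_def by (intro sets_pair_measure_cong) simp_all

lemma shift_measurable [measurable]: "shift \<in> borel_measurable (borel \<Otimes>\<^sub>M borel)"
  unfolding shift_def by measurable

lemma gauss_density_uminus [simp]: "gauss_density (- z) = gauss_density z"
  by (simp add: gauss_density_def std_normal_density_def)

lemma nn_integral_lborel_uminus:
  fixes f :: "'a::euclidean_space \<Rightarrow> ennreal"
  assumes [measurable]: "f \<in> borel_measurable borel"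
  shows "(\<integral>\<^sup>+x. f (- x) \<partial>lborel) = (\<integral>\<^sup>+x. f x \<partial>lborel)"
proof -
  have "(\<integral>\<^sup>+x. f x \<partial>lborel) = (\<integral>\<^sup>+x. f x \<partial>density (distr lborel borel (\<lambda>x. 0 + (-1) *\<^sub>R x)) (\<lambda>_. \<bar>-1::real\<bar> ^ DIM('a)))"
    by (subst lborel_affine[of "-1" 0, symmetric]) auto
  also have "\<dots> = (\<integral>\<^sup>+x. f (- x) \<partial>lborel)"
    by (subst nn_integral_density) (auto simp: nn_integral_distr)
  finally show ?thesis by simp
qed

lemma nn_integral_lborel_scale:
  fixes f :: "'a::euclidean_space \<Rightarrow> ennreal"
  assumes [measurable]: "f \<in> borel_measurable borel" and c: "c \<noteq> 0"
  shows "(\<integral>\<^sup>+x. f x \<partial>lborel) = ennreal (\<bar>c\<bar> ^ DIM('a)) * (\<integral>\<^sup>+x. f (t + c *\<^sub>R x) \<partial>lborel)"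
proof -
  have "(\<integral>\<^sup>+x. f x \<partial>lborel) = (\<integral>\<^sup>+x. f x \<partial>density (distr lborel borel (\<lambda>x. t + c *\<^sub>R x)) (\<lambda>_. \<bar>c\<bar> ^ DIM('a)))"
    by (subst lborel_affine[OF c, of t, symmetric]) auto
  also have "\<dots> = ennreal (\<bar>c\<bar> ^ DIM('a)) * (\<integral>\<^sup>+x. f (t + c *\<^sub>R x) \<partial>lborel)"
    by (subst nn_integral_density) (auto simp: nn_integral_distr nn_integral_cmult)
  finally show ?thesis .
qed

lemma distr_gauss_uminus: "distr gauss_measure borel uminus = (gauss_measure :: (real^'d) measure)"
proof (rule measure_eqI)
  fix A :: "(real^'d) set" assume "A \<in> sets (distr gauss_measure borel uminus)"
  then have A [measurable]: "A \<in> sets borel" by simp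
  have "emeasure (distr gauss_measure borel uminus) A
    = (\<integral>\<^sup>+x. ennreal (gauss_density x) * indicator A (- x) \<partial>lborel)"
    unfolding gauss_measure_def
    by (subst nn_integral_indicator[symmetric], simp, subst nn_integral_distr, simp, simp,
      subst nn_integral_density) auto
  also have "\<dots> = (\<integral>\<^sup>+x. ennreal (gauss_density x) * indicator A x \<partial>lborel)"
    using nn_integral_lborel_uminus[of "\<lambda>x. ennreal (gauss_density x) * indicator A x"] by simp
  finally show "emeasure (distr gauss_measure borel uminus) A = emeasure (gauss_measure :: (real^'d) measure) A"
    by (simp add: gauss_measure_def emeasure_density)
qed simp

lemma prob_space_gauss: "prob_space (gauss_measure :: (real^'d) measure)"
proof
  have "(\<integral>\<^sup>+x. ennreal (gauss_density x) \<partial>(lborel :: (real^'d) measure))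
    = (\<integral>\<^sup>+x. (\<Prod>b\<in>Basis. ennreal (std_normal_density (x \<bullet> b))) \<partial>(lborel :: (real^'d) measure))"
    by (simp add: gauss_density_def prod_ennreal)
  also have "\<dots> = (\<Prod>b\<in>(Basis :: (real^'d) set). \<integral>\<^sup>+t. ennreal (std_normal_density t) \<partial>lborel)"
    by (rule nn_integral_lborel_prod) auto
  also have "(\<integral>\<^sup>+t. ennreal (std_normal_density t) \<partial>lborel) = 1"
    using prob_space.emeasure_space_1[OF prob_space_normal_density[of 1 0]] by (simp add: emeasure_density)
  finally show "emeasure (gauss_measure :: (real^'d) measure) (space gauss_measure) = 1"
    by (simp add: gauss_measure_def emeasure_density)
qed

lemma emeasure_time:
  assumes c: "c > 0"
  shows "emeasure (time_measure c) (space (time_measure c)) = ennreal (1 / c)"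
proof -
  have "emeasure (time_measure c) (space (time_measure c)) = (\<integral>\<^sup>+s. ennreal (rayleigh c s) \<partial>lborel)"
    by (simp add: time_measure_def emeasure_density)
  also have "\<dots> = (\<integral>\<^sup>+s. ennreal (s * exp (- c * s\<^sup>2 / 2)) * indicator {0..} s \<partial>lborel)"
    by (intro nn_integral_cong) (auto simp: rayleigh_def indicator_def)
  also have "\<dots> = ennreal (0 - (- exp (- c * 0\<^sup>2 / 2) / c))"
  proof (rule nn_integral_FTC_atLeast)
    fix s :: real
    show "((\<lambda>s. - exp (- c * s\<^sup>2 / 2) / c) has_real_derivative s * exp (- c * s\<^sup>2 / 2)) (at s)"
      using c by (auto intro!: derivative_eq_intros)
    show "((\<lambda>s. - exp (- c * s\<^sup>2 / 2) / c) \<longlongrightarrow> 0) at_top" using c by real_asymp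
  qed auto
  finally show ?thesis by simp
qed

lemma finite_measure_time: "c > 0 \<Longrightarrow> finite_measure (time_measure c)"
  by (rule finite_measureI) (simp add: emeasure_time)

text \<open>Reflecting the Gaussian factor while keeping the scale preserves the product measure and
  changes the sign of the shift; this is the evenness.\<close>

lemma averaging_heat:
  assumes c: "c > 0"
  shows "averaging (heat_measure c) (shift :: _ \<Rightarrow> real^'d)"
proof -
  interpret T: finite_measure "time_measure c" by (rule finite_measure_time[OF c])
  interpret G: prob_space "gauss_measure :: (real^'d) measure" by (rule prob_space_gauss)
  interpret TG: pair_sigma_finite "time_measure c" "gauss_measure :: (real^'d) measure" ..
  interpret H: finite_measure "heat_measure c :: (real \<times> (real^'d)) measure"
    unfolding heat_measure_def by (intro finite_measure_pair_measure finite_measure_time c G.finite_measure_axioms)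
  show ?thesis
  proof
    show "(shift :: _ \<Rightarrow> real^'d) \<in> borel_measurable (heat_measure c)" by measurable
    let ?f = "\<lambda>(s, z). (s, - z) :: real \<times> (real^'d)"
    have "heat_measure c = distr (time_measure c) borel (\<lambda>s. s) \<Otimes>\<^sub>M distr gauss_measure borel (uminus :: real^'d \<Rightarrow> _)"
      unfolding distr_gauss_uminus heat_measure_def
      by (subst distr_id2) (auto simp: time_measure_def)
    also have "\<dots> = distr (time_measure c \<Otimes>\<^sub>M gauss_measure) (borel \<Otimes>\<^sub>M borel) ?f"
      by (rule pair_measure_distr) (auto simp: distr_gauss_uminus G.sigma_finite_measure_axioms)
    finally have e: "heat_measure c = distr (heat_measure c) (borel \<Otimes>\<^sub>M borel) ?f"
      by (simp add: heat_measure_def)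
    have "distr (heat_measure c) borel (shift :: _ \<Rightarrow> real^'d) = distr (distr (heat_measure c) (borel \<Otimes>\<^sub>M borel) ?f) borel shift"
      by (subst e) simp
    also have "\<dots> = distr (heat_measure c) borel (shift \<circ> ?f)" by (intro distr_distr) measurable
    also have "shift \<circ> ?f = (\<lambda>n. - shift n)" by (auto simp: shift_def)
    finally show "distr (heat_measure c) borel (\<lambda>n. - shift n) = distr (heat_measure c) borel (shift :: _ \<Rightarrow> real^'d)"
      by simp
  qed
qed

lemma measure_heat:
  assumes c: "c > 0"
  shows "measure (heat_measure c :: (real \<times> (real^'d)) measure) (space (heat_measure c)) = 1 / c"
proof -
  interpret G: prob_space "gauss_measure :: (real^'d) measure" by (rule prob_space_gauss)
  have "emeasure (heat_measure c :: (real \<times> (real^'d)) measure) (space (heat_measure c))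
     = emeasure (time_measure c) (space (time_measure c)) * emeasure gauss_measure (space (gauss_measure :: (real^'d) measure))"
    unfolding heat_measure_def space_pair_measure by (intro G.emeasure_pair_measure_Times sets.top)
  also have "\<dots> = ennreal (1 / c)" using c by (simp add: emeasure_time G.emeasure_space_1)
  finally show ?thesis using c by (simp add: measure_def)
qed

lemma nn_integral_heat:
  fixes f :: "real \<times> (real^'d) \<Rightarrow> ennreal"
  assumes [measurable]: "f \<in> borel_measurable (borel \<Otimes>\<^sub>M borel)"
  shows "(\<integral>\<^sup>+n. f n \<partial>heat_measure c)
    = (\<integral>\<^sup>+s. ennreal (rayleigh c s) * (\<integral>\<^sup>+z. f (s, z) \<partial>gauss_measure) \<partial>lborel)"
proof -
  interpret G: prob_space "gauss_measure :: (real^'d) measure" by (rule prob_space_gauss)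
  have "(\<integral>\<^sup>+n. f n \<partial>heat_measure c) = (\<integral>\<^sup>+s. (\<integral>\<^sup>+z. f (s, z) \<partial>gauss_measure) \<partial>time_measure c)"
    unfolding heat_measure_def by (subst G.nn_integral_fst) auto
  also have "\<dots> = (\<integral>\<^sup>+s. ennreal (rayleigh c s) * (\<integral>\<^sup>+z. f (s, z) \<partial>gauss_measure) \<partial>lborel)"
    unfolding time_measure_def by (subst nn_integral_density) auto
  finally show ?thesis .
qed

text \<open>Integrable, and changing by at most the factor exp (d/2) when the argument moves within
  a unit cell. A Gaussian changes by an unbounded factor under such moves, so it is first dominated
  by this weight.\<close>

definition laplace_weight :: "real^'d \<Rightarrow> real" where
  "laplace_weight x = (\<Prod>b\<in>Basis. exp (- \<bar>x \<bullet> b\<bar>))"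

lemma laplace_weight_measurable [measurable]: "laplace_weight \<in> borel_measurable borel"
  unfolding laplace_weight_def by measurable

lemma laplace_weight_pos: "laplace_weight x > 0"
  unfolding laplace_weight_def by (intro prod_pos) simp

lemma nn_integral_laplace_weight: "(\<integral>\<^sup>+x. ennreal (laplace_weight x) \<partial>(lborel :: (real^'d) measure)) \<le> ennreal (2 ^ CARD('d))"
proof -
  have half: "(\<integral>\<^sup>+t. ennreal (exp (- t)) * indicator {0..} t \<partial>lborel) = ennreal (0 - (- exp (- 0)))"
  proof (rule nn_integral_FTC_atLeast)
    show "((\<lambda>t::real. - exp (- t)) \<longlongrightarrow> 0) at_top" by real_asymp
  qed (auto intro!: derivative_eq_intros)
  have "(\<integral>\<^sup>+t. ennreal (exp (- \<bar>t\<bar>)) \<partial>lborel)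
    \<le> (\<integral>\<^sup>+t. ennreal (exp (- t)) * indicator {0..} t + ennreal (exp (- (- t))) * indicator {0..} (- t) \<partial>lborel)"
    by (intro nn_integral_mono) (auto simp: indicator_def)
  also have "\<dots> = (\<integral>\<^sup>+t. ennreal (exp (- t)) * indicator {0..} t \<partial>lborel)
     + (\<integral>\<^sup>+t. ennreal (exp (- (- t))) * indicator {0..} (- t) \<partial>lborel)"
    by (intro nn_integral_add) auto
  also have "\<dots> = 2"
    using half nn_integral_lborel_uminus[of "\<lambda>t::real. ennreal (exp (- t)) * indicator {0..} t"] by simp
  finally have one: "(\<integral>\<^sup>+t. ennreal (exp (- \<bar>t\<bar>)) \<partial>lborel) \<le> 2" .
  have "(\<integral>\<^sup>+x. ennreal (laplace_weight x) \<partial>(lborel :: (real^'d) measure))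
    = (\<integral>\<^sup>+x. (\<Prod>b\<in>Basis. ennreal (exp (- \<bar>x \<bullet> b\<bar>))) \<partial>(lborel :: (real^'d) measure))"
    by (simp add: laplace_weight_def prod_ennreal)
  also have "\<dots> = (\<Prod>b\<in>(Basis :: (real^'d) set). \<integral>\<^sup>+t. ennreal (exp (- \<bar>t\<bar>)) \<partial>lborel)"
    by (rule nn_integral_lborel_prod) auto
  also have "\<dots> = (\<integral>\<^sup>+t. ennreal (exp (- \<bar>t\<bar>)) \<partial>lborel) ^ CARD('d)" by simp
  also have "\<dots> \<le> 2 ^ CARD('d)" by (intro power_mono one) simp
  also have "\<dots> = ennreal (2 ^ CARD('d))" by (simp add: ennreal_power[symmetric])
  finally show ?thesis .
qed

section \<open>Uniform local bounds tested against the Gaussian kernel\<close>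

lemma mem_translated_cell: "y \<in> (+) x ` open_cell \<longleftrightarrow> (\<forall>b\<in>Basis. \<bar>(y - x) \<bullet> b\<bar> < 1 / 2)"
  for x y :: "real^'d"
proof -
  have "y \<in> (+) x ` open_cell \<longleftrightarrow> y - x \<in> open_cell"
    by (metis (no_types, lifting) add.commute diff_add_cancel image_iff add_diff_cancel_left')
  also have "\<dots> \<longleftrightarrow> (\<forall>b\<in>Basis. - (1/2) < (y - x) \<bullet> b \<and> (y - x) \<bullet> b < 1/2)"
    unfolding open_cell_def mem_box by (intro ball_cong refl) (auto simp: Basis_vec_def inner_axis)
  also have "\<dots> \<longleftrightarrow> (\<forall>b\<in>Basis. \<bar>(y - x) \<bullet> b\<bar> < 1 / 2)"
    by (intro ball_cong refl) linarith
  finally show ?thesis .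
qed

lemma cell_measurable [measurable]: "Measurable.pred (borel \<Otimes>\<^sub>M borel) (\<lambda>(x, y). y \<in> (+) (x :: real^'d) ` open_cell)"
  unfolding mem_translated_cell by measurable

lemma translated_cell_eq: "(+) x ` open_cell = box (x + (\<chi> i. - 1/2)) (x + (\<chi> i. 1/2))"
  for x :: "real^'d"
proof (rule set_eqI)
  fix y
  have "y \<in> box (x + (\<chi> i. - 1/2)) (x + (\<chi> i. 1/2)) \<longleftrightarrow> (\<forall>b\<in>Basis. x \<bullet> b - 1/2 < y \<bullet> b \<and> y \<bullet> b < x \<bullet> b + 1/2)"
    unfolding mem_box by (intro ball_cong refl) (auto simp: Basis_vec_def inner_axis)
  also have "\<dots> \<longleftrightarrow> y \<in> (+) x ` open_cell"
    unfolding mem_translated_cell inner_diff_left by (intro ball_cong refl) linarith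
  finally show "y \<in> (+) x ` open_cell \<longleftrightarrow> y \<in> box (x + (\<chi> i. - 1/2)) (x + (\<chi> i. 1/2))" by simp
qed

lemma emeasure_translated_cell: "emeasure lborel ((+) (x :: real^'d) ` open_cell) = 1"
proof -
  note translated_cell_eq
  moreover have "emeasure lborel (box (x + (\<chi> i. - 1/2)) (x + (\<chi> i. 1/2))) = 1"
  proof (subst emeasure_lborel_box)
    show "ennreal (\<Prod>b\<in>Basis. (x + (\<chi> i. 1/2) - (x + (\<chi> i. - 1/2))) \<bullet> b) = 1"
      by (subst prod.neutral) (auto simp: Basis_vec_def inner_axis inner_diff_left inner_add_left)
  qed (auto simp: Basis_vec_def inner_axis inner_add_left)
  ultimately show ?thesis by metis
qed

text \<open>Averaging the weight over unit cells avoids a summation over the lattice.\<close>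

lemma weighted_le_cell_bound:
  fixes g :: "real^'d \<Rightarrow> ennreal"
  assumes g [measurable]: "g \<in> borel_measurable borel"
    and K: "\<And>x. (\<integral>\<^sup>+y. g y * indicator ((+) x ` open_cell) y \<partial>lborel) \<le> ennreal K"
  shows "(\<integral>\<^sup>+x. g x * ennreal (laplace_weight (x - y)) \<partial>lborel) \<le> ennreal (exp (CARD('d) / 2) * 2 ^ CARD('d)) * ennreal K"
proof -
  have pt: "ennreal (laplace_weight (x - y))
    \<le> ennreal (exp (CARD('d) / 2)) * (\<integral>\<^sup>+z. indicator ((+) z ` open_cell) x * ennreal (laplace_weight (z - y)) \<partial>lborel)" for x
  proof -
    \<comment> \<open>Each coordinate of x differs from that of z by less than 1/2, which costs a
      factor exp (1/2) per coordinate.\<close>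
    have le: "laplace_weight (x - y) \<le> exp (CARD('d) / 2) * laplace_weight (z - y)" if "x \<in> (+) z ` open_cell" for z
    proof -
      have "laplace_weight (x - y) \<le> (\<Prod>b\<in>(Basis :: (real^'d) set). exp (1/2) * exp (- \<bar>(z - y) \<bullet> b\<bar>))"
        unfolding laplace_weight_def
      proof (intro prod_mono conjI)
        fix b :: "real^'d" assume "b \<in> Basis"
        then have "\<bar>(x - z) \<bullet> b\<bar> < 1 / 2" using that by (simp add: mem_translated_cell)
        then have "- \<bar>(x - y) \<bullet> b\<bar> \<le> 1 / 2 - \<bar>(z - y) \<bullet> b\<bar>"
          unfolding inner_diff_left by linarith
        then show "exp (- \<bar>(x - y) \<bullet> b\<bar>) \<le> exp (1/2) * exp (- \<bar>(z - y) \<bullet> b\<bar>)"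
          unfolding exp_add[symmetric] by simp
      qed simp
      also have "\<dots> = exp (CARD('d) / 2) * laplace_weight (z - y)"
        by (simp add: prod.distrib laplace_weight_def exp_of_nat_mult[symmetric] DIM_cart)
      finally show ?thesis .
    qed
    \<comment> \<open>The cell around x has measure one, so a constant equals its integral over that
      cell; and z lies in the cell around x exactly if x lies in the cell around z.\<close>
    have "ennreal (laplace_weight (x - y)) = (\<integral>\<^sup>+z. ennreal (laplace_weight (x - y)) * indicator ((+) x ` open_cell) z \<partial>lborel)"
      by (subst nn_integral_cmult_indicator, simp add: translated_cell_eq, simp add: emeasure_translated_cell)
    also have "\<dots> \<le> (\<integral>\<^sup>+z. ennreal (exp (CARD('d) / 2)) * (indicator ((+) z ` open_cell) x * ennreal (laplace_weight (z - y))) \<partial>lborel)"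
    proof (intro nn_integral_mono)
      fix z
      have sym: "z \<in> (+) x ` open_cell \<longleftrightarrow> x \<in> (+) z ` open_cell"
        by (simp add: mem_translated_cell inner_diff_left abs_minus_commute)
      show "ennreal (laplace_weight (x - y)) * indicator ((+) x ` open_cell) z
         \<le> ennreal (exp (CARD('d) / 2)) * (indicator ((+) z ` open_cell) x * ennreal (laplace_weight (z - y)))"
      proof (cases "x \<in> (+) z ` open_cell")
        case True
        then show ?thesis using le[OF True] sym
          by (simp add: ennreal_mult[symmetric] less_imp_le[OF laplace_weight_pos] ennreal_leI)
      qed (simp add: sym)
    qed
    also have "\<dots> = ennreal (exp (CARD('d) / 2)) * (\<integral>\<^sup>+z. indicator ((+) z ` open_cell) x * ennreal (laplace_weight (z - y)) \<partial>lborel)"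
      by (intro nn_integral_cmult) (simp add: indicator_def[abs_def])
    finally show ?thesis .
  qed
  have "(\<integral>\<^sup>+x. g x * ennreal (laplace_weight (x - y)) \<partial>lborel)
    \<le> (\<integral>\<^sup>+x. g x * (ennreal (exp (CARD('d) / 2)) * (\<integral>\<^sup>+z. indicator ((+) z ` open_cell) x * ennreal (laplace_weight (z - y)) \<partial>lborel)) \<partial>lborel)"
    by (intro nn_integral_mono mult_left_mono pt) simp
  also have "\<dots> = (\<integral>\<^sup>+x. ennreal (exp (CARD('d) / 2)) * (\<integral>\<^sup>+z. g x * indicator ((+) z ` open_cell) x * ennreal (laplace_weight (z - y)) \<partial>lborel) \<partial>lborel)"
    by (intro nn_integral_cong, subst nn_integral_cmult[symmetric], simp add: indicator_def[abs_def],
      subst nn_integral_cmult[symmetric], simp add: indicator_def[abs_def], simp add: ac_simps,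
      subst nn_integral_cmult[symmetric], simp add: indicator_def[abs_def], simp add: ac_simps)
  also have "\<dots> = ennreal (exp (CARD('d) / 2)) * (\<integral>\<^sup>+x. (\<integral>\<^sup>+z. g x * indicator ((+) z ` open_cell) x * ennreal (laplace_weight (z - y)) \<partial>lborel) \<partial>lborel)"
    by (intro nn_integral_cmult) (simp add: indicator_def[abs_def])
  finally have le: "(\<integral>\<^sup>+x. g x * ennreal (laplace_weight (x - y)) \<partial>lborel) \<le> ennreal (exp (CARD('d) / 2)) *
    (\<integral>\<^sup>+x. (\<integral>\<^sup>+z. g x * indicator ((+) z ` open_cell) x * ennreal (laplace_weight (z - y)) \<partial>lborel) \<partial>lborel)"
    (is "_ \<le> _ * ?X") .
  \<comment> \<open>After the exchange the inner integral runs over the cell around z, where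
    \<open>K\<close> applies, and only the weight is left to be integrated in z.\<close>
  have "(\<integral>\<^sup>+x. (\<integral>\<^sup>+z. g x * indicator ((+) z ` open_cell) x * ennreal (laplace_weight (z - y)) \<partial>lborel) \<partial>lborel)
    = (\<integral>\<^sup>+z. (\<integral>\<^sup>+x. g x * indicator ((+) z ` open_cell) x * ennreal (laplace_weight (z - y)) \<partial>lborel) \<partial>lborel)"
    by (rule lborel_pair.Fubini'[symmetric]) (simp add: indicator_def[abs_def])
  also have "\<dots> \<le> (\<integral>\<^sup>+z. ennreal K * ennreal (laplace_weight (z - y)) \<partial>lborel)"
  proof (intro nn_integral_mono)
    fix z
    have "(\<integral>\<^sup>+x. g x * indicator ((+) z ` open_cell) x * ennreal (laplace_weight (z - y)) \<partial>lborel)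
      = (\<integral>\<^sup>+x. g x * indicator ((+) z ` open_cell) x \<partial>lborel) * ennreal (laplace_weight (z - y))"
      by (intro nn_integral_multc) (simp add: indicator_def[abs_def])
    also have "\<dots> \<le> ennreal K * ennreal (laplace_weight (z - y))" by (intro mult_right_mono K) simp
    finally show "(\<integral>\<^sup>+x. g x * indicator ((+) z ` open_cell) x * ennreal (laplace_weight (z - y)) \<partial>lborel)
      \<le> ennreal K * ennreal (laplace_weight (z - y))" .
  qed
  also have "\<dots> = ennreal K * (\<integral>\<^sup>+z. ennreal (laplace_weight (z - y)) \<partial>lborel)"
    by (intro nn_integral_cmult) measurable
  also have "(\<integral>\<^sup>+z. ennreal (laplace_weight (z - y)) \<partial>lborel) = (\<integral>\<^sup>+z. ennreal (laplace_weight z) \<partial>(lborel :: (real^'d) measure))"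
    using nn_integral_lborel_translate[of "\<lambda>z. ennreal (laplace_weight z)" "- y"] by simp
  finally have "?X \<le> ennreal K * (\<integral>\<^sup>+z. ennreal (laplace_weight z) \<partial>(lborel :: (real^'d) measure))" .
  from order_trans[OF this mult_left_mono[OF nn_integral_laplace_weight]]
  have "?X \<le> ennreal K * ennreal (2 ^ CARD('d))" by simp
  from order_trans[OF le mult_left_mono[OF this]] show ?thesis by (simp add: ennreal_mult ac_simps)
qed

text \<open>In each coordinate u \<le> (u/s)^2/2 + s^2/2 with u the absolute value of the coordinate
  of \<open>w\<close>. The growth exp (d s^2/2) is harmless because the time density decays like exp
  (- c s^2/2) with c at choice.\<close>

lemma gauss_density_le:
  fixes w :: "real^'d" and s :: real
  assumes s: "s > 0"
  shows "gauss_density ((1 / s) *\<^sub>R w) \<le> exp (real CARD('d) * s\<^sup>2 / 2) * laplace_weight w"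
proof -
  have "gauss_density ((1 / s) *\<^sub>R w) \<le> (\<Prod>b\<in>(Basis :: (real^'d) set). exp (s\<^sup>2 / 2) * exp (- \<bar>w \<bullet> b\<bar>))"
    unfolding gauss_density_def
  proof (intro prod_mono conjI)
    fix b :: "real^'d"
    define u where "u = \<bar>w \<bullet> b\<bar>"
    have "0 \<le> (u / s - s)\<^sup>2" by simp
    then have "u \<le> (u / s)\<^sup>2 / 2 + s\<^sup>2 / 2" using s by (simp add: power2_diff)
    then have e: "exp (- (((1 / s) *\<^sub>R w) \<bullet> b)\<^sup>2 / 2) \<le> exp (s\<^sup>2 / 2) * exp (- \<bar>w \<bullet> b\<bar>)"
      unfolding exp_add[symmetric] by (simp add: u_def power_divide)
    have "std_normal_density (((1 / s) *\<^sub>R w) \<bullet> b) \<le> exp (- (((1 / s) *\<^sub>R w) \<bullet> b)\<^sup>2 / 2)"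
    proof -
      have "1 / sqrt (2 * pi) \<le> 1" using pi_ge_two by (simp add: real_le_rsqrt)
      from mult_right_mono[OF this exp_ge_zero] show ?thesis
        unfolding std_normal_density_def by (simp only: mult_1_left)
    qed
    with e show "std_normal_density (((1 / s) *\<^sub>R w) \<bullet> b) \<le> exp (s\<^sup>2 / 2) * exp (- \<bar>w \<bullet> b\<bar>)" by linarith
  qed simp
  also have "\<dots> = exp (real CARD('d) * s\<^sup>2 / 2) * laplace_weight w"
    by (simp add: prod.distrib laplace_weight_def exp_of_nat_mult[symmetric])
  finally show ?thesis .
qed

text \<open>\<open>K\<close> bounds the p-th power of the local norms, which avoids roots in the
  estimates; the cells are centred at all points of space, not only at lattice points.\<close>

definition cell_bound :: "real \<Rightarrow> real \<Rightarrow> (real^'d \<Rightarrow> real) \<Rightarrow> bool" where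
  "cell_bound p K V \<longleftrightarrow>
    (\<forall>x. (\<integral>\<^sup>+y. ennreal (\<bar>V y\<bar> powr p) * indicator ((+) x ` open_cell) y \<partial>lborel) \<le> ennreal K)"

text \<open>The two summands come from the two terms of
  \<open>L\<^sup>2 + L powr (2 - p) * \<bar>v\<bar> powr p\<close>; the second carries the constant
  of \<open>weighted_le_cell_bound\<close>.\<close>

definition cell_const :: "('d::finite) itself \<Rightarrow> real \<Rightarrow> real" where
  "cell_const _ K = 1 + exp (real CARD('d) / 2) * 2 ^ CARD('d) * K"

text \<open>
  The inequality \<open>v\<^sup>2 \<le> L\<^sup>2 + L\<^bsup>2-p\<^esup> v\<^bsup>p\<^esup>\<close> with \<open>L = s\<^bsup>-d/p\<^esup>\<close> replaces Hoelder's inequality.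
\<close>

lemma potential_gauss_bound:
  fixes V :: "real^'d \<Rightarrow> real"
  assumes V [measurable]: "V \<in> borel_measurable borel" and p: "p > 2" and K: "K \<ge> 0"
    and cell: "cell_bound p K V" and s: "s > 0"
  shows "(\<integral>\<^sup>+z. ennreal ((V (y - s *\<^sub>R z))\<^sup>2) \<partial>gauss_measure)
    \<le> ennreal (cell_const TYPE('d) K * (s powr (- real CARD('d) / p) * exp (real CARD('d) / 4 * s\<^sup>2))\<^sup>2)"
proof -
  let ?d = "real CARD('d)"
  interpret G: prob_space "gauss_measure :: (real^'d) measure" by (rule prob_space_gauss)
  \<comment> \<open>The level at which both terms scale alike: the Gaussian average of
    \<open>\<bar>V\<bar> powr p\<close> is of order \<open>s powr (- d)\<close> for small
    \<open>s\<close>, and \<open>L powr (2 - p) * s powr (- d)\<close> equals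
    \<open>L\<^sup>2\<close>.\<close>
  define L where "L = s powr (- ?d / p)"
  have L: "L > 0" using s by (simp add: L_def)
  have ptw: "v\<^sup>2 \<le> L\<^sup>2 + L powr (2 - p) * \<bar>v\<bar> powr p" for v :: real
  proof (cases "\<bar>v\<bar> \<le> L")
    case True
    then have "v\<^sup>2 \<le> L\<^sup>2" by (metis abs_ge_zero power2_abs power_mono)
    then show ?thesis by (simp add: add_increasing2)
  next
    case False
    then have v: "\<bar>v\<bar> > L" by simp
    have "v\<^sup>2 = \<bar>v\<bar> powr (2 - p) * \<bar>v\<bar> powr p" using v L by (simp add: powr_add[symmetric])
    also have "\<dots> \<le> L powr (2 - p) * \<bar>v\<bar> powr p"
      using v L p by (intro mult_right_mono powr_mono2') auto
    finally show ?thesis by (simp add: add_increasing)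
  qed
  define A where "A = (\<integral>\<^sup>+z. ennreal (\<bar>V (y - s *\<^sub>R z)\<bar> powr p) \<partial>gauss_measure)"
  \<comment> \<open>The factor on the left is the Jacobian of the substitution x = y - s z, which
    turns the Gaussian average into an integral of the p-th power against a kernel centred at
    y.\<close>
  have A: "ennreal (s ^ CARD('d)) * A \<le> ennreal (exp (?d * s\<^sup>2 / 2)) * (ennreal (exp (?d / 2) * 2 ^ CARD('d)) * ennreal K)"
  proof -
    have "ennreal (s ^ CARD('d)) * A = ennreal (\<bar>- s\<bar> ^ DIM(real^'d)) *
      (\<integral>\<^sup>+z. ennreal (gauss_density ((1 / s) *\<^sub>R (y - (y + (- s) *\<^sub>R z)))) * ennreal (\<bar>V (y + (- s) *\<^sub>R z)\<bar> powr p) \<partial>lborel)"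
      unfolding A_def gauss_measure_def using s by (subst nn_integral_density) auto
    also have "\<dots> = (\<integral>\<^sup>+x. ennreal (gauss_density ((1 / s) *\<^sub>R (y - x))) * ennreal (\<bar>V x\<bar> powr p) \<partial>lborel)"
      using s by (intro nn_integral_lborel_scale[symmetric]) auto
    also have "\<dots> \<le> (\<integral>\<^sup>+x. ennreal (exp (?d * s\<^sup>2 / 2)) * (ennreal (\<bar>V x\<bar> powr p) * ennreal (laplace_weight (x - y))) \<partial>lborel)"
    proof (intro nn_integral_mono)
      fix x
      have "gauss_density ((1 / s) *\<^sub>R (y - x)) \<le> exp (?d * s\<^sup>2 / 2) * laplace_weight (x - y)"
        using gauss_density_le[OF s, of "y - x"]
        by (simp add: laplace_weight_def inner_diff_left abs_minus_commute)
      then have "gauss_density ((1 / s) *\<^sub>R (y - x)) * \<bar>V x\<bar> powr p \<le> (exp (?d * s\<^sup>2 / 2) * laplace_weight (x - y)) * \<bar>V x\<bar> powr p"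
        by (rule mult_right_mono) simp
      then show "ennreal (gauss_density ((1 / s) *\<^sub>R (y - x))) * ennreal (\<bar>V x\<bar> powr p)
        \<le> ennreal (exp (?d * s\<^sup>2 / 2)) * (ennreal (\<bar>V x\<bar> powr p) * ennreal (laplace_weight (x - y)))"
        by (simp add: ennreal_mult[symmetric] less_imp_le[OF laplace_weight_pos] ennreal_leI mult.assoc mult.commute[of "laplace_weight _"])
    qed
    also have "\<dots> = ennreal (exp (?d * s\<^sup>2 / 2)) * (\<integral>\<^sup>+x. ennreal (\<bar>V x\<bar> powr p) * ennreal (laplace_weight (x - y)) \<partial>lborel)"
      by (intro nn_integral_cmult) measurable
    also have "\<dots> \<le> ennreal (exp (?d * s\<^sup>2 / 2)) * (ennreal (exp (?d / 2) * 2 ^ CARD('d)) * ennreal K)"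
      using cell unfolding cell_bound_def by (intro mult_left_mono weighted_le_cell_bound) auto
    finally show ?thesis .
  qed
  have "A = ennreal (s powr (- ?d)) * (ennreal (s ^ CARD('d)) * A)"
    using s by (simp add: mult.assoc[symmetric] ennreal_mult[symmetric] powr_minus powr_realpow)
  also have "\<dots> \<le> ennreal (s powr (- ?d)) * (ennreal (exp (?d * s\<^sup>2 / 2)) * (ennreal (exp (?d / 2) * 2 ^ CARD('d)) * ennreal K))"
    by (intro mult_left_mono A) simp
  also have "\<dots> = ennreal (s powr (- ?d) * exp (?d * s\<^sup>2 / 2) * (exp (?d / 2) * 2 ^ CARD('d) * K))"
    using K by (simp add: ennreal_mult[symmetric] mult.assoc)
  finally have A2: "A \<le> ennreal (s powr (- ?d) * exp (?d * s\<^sup>2 / 2) * (exp (?d / 2) * 2 ^ CARD('d) * K))" .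
  have "(\<integral>\<^sup>+z. ennreal ((V (y - s *\<^sub>R z))\<^sup>2) \<partial>gauss_measure)
    \<le> (\<integral>\<^sup>+z. ennreal (L\<^sup>2) + ennreal (L powr (2 - p)) * ennreal (\<bar>V (y - s *\<^sub>R z)\<bar> powr p) \<partial>gauss_measure)"
    using ptw by (intro nn_integral_mono) (simp add: ennreal_mult[symmetric] ennreal_plus[symmetric] ennreal_leI del: ennreal_plus)
  also have "\<dots> = ennreal (L\<^sup>2) + ennreal (L powr (2 - p)) * A"
    unfolding A_def by (simp add: nn_integral_add nn_integral_cmult G.emeasure_space_1)
  also have "\<dots> \<le> ennreal (L\<^sup>2) + ennreal (L powr (2 - p)) * ennreal (s powr (- ?d) * exp (?d * s\<^sup>2 / 2) * (exp (?d / 2) * 2 ^ CARD('d) * K))"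
    by (intro add_left_mono mult_left_mono A2) simp
  also have "\<dots> = ennreal (L\<^sup>2 + (L powr (2 - p) * s powr (- ?d)) * exp (?d * s\<^sup>2 / 2) * (exp (?d / 2) * 2 ^ CARD('d) * K))"
    using K by (simp add: ennreal_mult[symmetric] ennreal_plus[symmetric] mult.assoc del: ennreal_plus)
  also have "L powr (2 - p) * s powr (- ?d) = L\<^sup>2"
  proof -
    have "L powr (2 - p) * s powr (- ?d) = s powr (- ?d / p * (2 - p) + - ?d)"
      using s by (simp add: L_def powr_powr powr_add[symmetric])
    also have "- ?d / p * (2 - p) + - ?d = - ?d / p * 2" using p by (simp add: field_simps)
    also have "s powr (- ?d / p * 2) = L powr 2" by (simp add: L_def powr_powr)
    also have "L powr 2 = L\<^sup>2" using L by simp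
    finally show ?thesis .
  qed
  also have "L\<^sup>2 + L\<^sup>2 * exp (?d * s\<^sup>2 / 2) * (exp (?d / 2) * 2 ^ CARD('d) * K)
    \<le> L\<^sup>2 * exp (?d * s\<^sup>2 / 2) + L\<^sup>2 * exp (?d * s\<^sup>2 / 2) * (exp (?d / 2) * 2 ^ CARD('d) * K)"
    by (intro add_right_mono) (simp add: mult_le_cancel_left1)
  also have "\<dots> = cell_const TYPE('d) K * (s powr (- ?d / p) * exp (?d / 4 * s\<^sup>2))\<^sup>2"
    by (simp add: cell_const_def L_def power_mult_distrib exp_double[symmetric] algebra_simps)
  finally show ?thesis by (simp add: ennreal_leI)
qed

text \<open>With \<open>e = d / p\<close> and \<open>\<beta> = d / 4\<close> this is, up to the
  constant \<open>cell_const\<close>, the root of the bound in \<open>potential_gauss_bound\<close>: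
  the size of the potential as seen at scale s. It also serves as the weight in the Schur test, and
  this choice makes both Schur factors the same time integral up to that constant.\<close>

definition theta :: "real \<Rightarrow> real \<Rightarrow> real \<Rightarrow> real" where
  "theta e \<beta> s = s powr (- e) * exp (\<beta> * s\<^sup>2)"

text \<open>Splitting at \<open>\<delta>\<close>: near zero the power is integrable since \<open>e < 2\<close>, beyond \<open>\<delta>\<close> large \<open>c\<close> wins.\<close>

lemma time_integral_small:
  assumes e: "0 \<le> e" "e < 2" and \<beta>: "\<beta> \<ge> 0" and \<eta>: "\<eta> > 0"
  shows "\<exists>c0>0. \<forall>c\<ge>c0. (\<integral>\<^sup>+s. ennreal (rayleigh c s) * ennreal (theta e \<beta> s) \<partial>lborel) \<le> ennreal \<eta>"
proof -
  \<comment> \<open>Chosen so that the integral of \<open>s powr (1 - e)\<close> from 0 to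
    \<open>\<delta>\<close> is exactly half of \<open>\<eta>\<close>.\<close>
  define \<delta> where "\<delta> = ((2 - e) * \<eta> / 2) powr (1 / (2 - e))"
  have \<delta>: "\<delta> > 0" using e \<eta> by (simp add: \<delta>_def)
  have "\<delta> powr (2 - e) = (2 - e) * (\<eta> / 2)" using e \<eta> by (simp add: \<delta>_def powr_powr)
  then have \<delta>p: "\<delta> powr (2 - e) / (2 - e) = \<eta> / 2" using e by simp
  \<comment> \<open>The bound \<open>4 * \<beta>\<close> lets exp (c s^2/4) absorb the growth of
    \<open>theta\<close>; the last entry makes the part beyond \<open>\<delta>\<close>, which is at
    most \<open>\<delta> powr (- e) * (2 / c)\<close>, no larger than half of
    \<open>\<eta>\<close>.\<close>
  define c0 where "c0 = Max {4 * \<beta>, 1, 4 * \<delta> powr (- e) / \<eta>}"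
  have c0: "c0 \<ge> 4 * \<beta>" "c0 \<ge> 1" "c0 \<ge> 4 * \<delta> powr (- e) / \<eta>" unfolding c0_def by auto
  have "(\<integral>\<^sup>+s. ennreal (rayleigh c s) * ennreal (theta e \<beta> s) \<partial>lborel) \<le> ennreal \<eta>" if c: "c \<ge> c0" for c
  proof -
    have cp: "c > 0" using c c0 by linarith
    have I1: "(\<integral>\<^sup>+s. ennreal (s powr (1 - e)) * indicator {0..\<delta>} s \<partial>lborel) = ennreal (\<eta> / 2)"
    proof -
      have "((\<lambda>x. x powr (1 - e)) has_integral (\<delta> powr (1 - e + 1) / (1 - e + 1))) {0..\<delta>}"
        using e \<delta> by (intro has_integral_powr_from_0) auto
      from nn_integral_has_integral_lebesgue'[OF _ this] show ?thesis using \<delta>p by (simp add: algebra_simps)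
    qed
    have I2: "(\<integral>\<^sup>+s. ennreal (s * exp (- (c / 4) * s\<^sup>2)) * indicator {0..} s \<partial>lborel) = ennreal (0 - (- exp (- (c / 4) * 0\<^sup>2) / (c / 2)))"
    proof (rule nn_integral_FTC_atLeast)
      fix s :: real
      show "((\<lambda>s. - exp (- (c / 4) * s\<^sup>2) / (c / 2)) has_real_derivative s * exp (- (c / 4) * s\<^sup>2)) (at s)"
        using cp by (auto intro!: derivative_eq_intros)
      show "((\<lambda>s. - exp (- (c / 4) * s\<^sup>2) / (c / 2)) \<longlongrightarrow> 0) at_top" using cp by real_asymp
    qed auto
    have pt: "rayleigh c s * theta e \<beta> s
      \<le> s powr (1 - e) * indicator {0..\<delta>} s + \<delta> powr (- e) * (s * exp (- (c / 4) * s\<^sup>2) * indicator {0..} s)" for s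
    proof (cases "s > 0")
      case True
      have E: "exp (- c * s\<^sup>2 / 2) * exp (\<beta> * s\<^sup>2) \<le> exp (- (c / 4) * s\<^sup>2)"
      proof -
        have "\<beta> * s\<^sup>2 \<le> c / 4 * s\<^sup>2" using c c0 by (intro mult_right_mono) auto
        then show ?thesis unfolding exp_add[symmetric] by simp
      qed
      have r: "rayleigh c s * theta e \<beta> s = s * s powr (- e) * (exp (- c * s\<^sup>2 / 2) * exp (\<beta> * s\<^sup>2))"
        using True by (simp add: rayleigh_def theta_def)
      have sp: "s * s powr (- e) = s powr (1 - e)" using True by (simp add: powr_diff powr_minus field_simps)
      show ?thesis
      proof (cases "s \<le> \<delta>")
        case s\<delta>: True
        have "exp (- (c / 4) * s\<^sup>2) \<le> 1" using cp by simp
        then have "exp (- c * s\<^sup>2 / 2) * exp (\<beta> * s\<^sup>2) \<le> 1" using E by linarith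
        then have "rayleigh c s * theta e \<beta> s \<le> s powr (1 - e)"
          unfolding r sp using mult_left_mono[of _ 1 "s powr (1 - e)"] by simp
        moreover have "0 \<le> \<delta> powr (- e) * (s * exp (- (c / 4) * s\<^sup>2) * indicator {0..} s)" using True by simp
        ultimately show ?thesis using True s\<delta> by (simp add: add_increasing2)
      next
        case s\<delta>: False
        have "s powr (- e) \<le> \<delta> powr (- e)" using s\<delta> \<delta> e by (intro powr_mono2') auto
        then have "s * s powr (- e) * (exp (- c * s\<^sup>2 / 2) * exp (\<beta> * s\<^sup>2)) \<le> s * \<delta> powr (- e) * exp (- (c / 4) * s\<^sup>2)"
          using True E by (intro mult_mono) auto
        then show ?thesis unfolding r using True s\<delta> by (simp add: ac_simps)
      qed
    next
      case False
      then show ?thesis by (auto simp: rayleigh_def indicator_def)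
    qed
    have "(\<integral>\<^sup>+s. ennreal (rayleigh c s) * ennreal (theta e \<beta> s) \<partial>lborel)
      \<le> (\<integral>\<^sup>+s. ennreal (s powr (1 - e)) * indicator {0..\<delta>} s
         + ennreal (\<delta> powr (- e)) * (ennreal (s * exp (- (c / 4) * s\<^sup>2)) * indicator {0..} s) \<partial>lborel)"
    proof (intro nn_integral_mono)
      fix s
      have "ennreal (rayleigh c s) * ennreal (theta e \<beta> s) = ennreal (rayleigh c s * theta e \<beta> s)"
        by (simp add: ennreal_mult' )
      also have "\<dots> \<le> ennreal (s powr (1 - e) * indicator {0..\<delta>} s + \<delta> powr (- e) * (s * exp (- (c / 4) * s\<^sup>2) * indicator {0..} s))"
        by (intro ennreal_leI pt)
      also have "\<dots> = ennreal (s powr (1 - e)) * indicator {0..\<delta>} s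
         + ennreal (\<delta> powr (- e)) * (ennreal (s * exp (- (c / 4) * s\<^sup>2)) * indicator {0..} s)"
        by (auto simp: indicator_def ennreal_mult)
      finally show "ennreal (rayleigh c s) * ennreal (theta e \<beta> s) \<le> \<dots>" .
    qed
    also have "\<dots> = ennreal (\<eta> / 2) + ennreal (\<delta> powr (- e)) * ennreal (2 / c)"
      using I2 by (simp add: nn_integral_add nn_integral_cmult I1)
    also have "\<dots> = ennreal (\<eta> / 2 + \<delta> powr (- e) * (2 / c))"
      using \<eta> cp by (simp add: ennreal_mult[symmetric] ennreal_plus[symmetric] del: ennreal_plus)
    also have "\<dots> \<le> ennreal \<eta>"
    proof (rule ennreal_leI)
      have "4 * \<delta> powr (- e) / \<eta> \<le> c" using c c0 by linarith
      then have "\<delta> powr (- e) * (2 / c) \<le> \<eta> / 2" using \<eta> cp by (simp add: field_simps)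
      then show "\<eta> / 2 + \<delta> powr (- e) * (2 / c) \<le> \<eta>" by simp
    qed
    finally show ?thesis .
  qed
  then show ?thesis using c0(2) by (intro exI[of _ c0]) auto
qed

abbreviation resolvent :: "real \<Rightarrow> (real^'d \<Rightarrow> complex) \<Rightarrow> real^'d \<Rightarrow> complex" where
  "resolvent c \<equiv> averaging.avg (heat_measure c) shift"

text \<open>The Schur test \<open>weighted_bound\<close> with \<open>q\<close> the square of
  \<open>V\<close> and weight \<open>theta\<close>. The mass of the weight is at most
  \<open>\<eta>\<close>. Dividing the Gaussian bound, of order \<open>theta\<close> squared, by the
  weight leaves \<open>theta\<close> once more, so the second factor is at most
  \<open>cell_const\<close> times \<open>\<eta>\<close>.\<close>

lemma potential_resolvent_bound:
  fixes V :: "real^'d \<Rightarrow> real" and a :: "real^'d \<Rightarrow> complex"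
  assumes V [measurable]: "V \<in> borel_measurable borel" and p: "p > 2" and K: "K \<ge> 0"
    and cell: "cell_bound p K V" and c: "c > 0"
    and I: "(\<integral>\<^sup>+s. ennreal (rayleigh c s) * ennreal (theta (real CARD('d) / p) (real CARD('d) / 4) s) \<partial>lborel) \<le> ennreal \<eta>"
    and \<eta>: "\<eta> \<ge> 0"
    and a [measurable]: "a \<in> borel_measurable borel" and a2: "a \<in> L2"
  shows "(\<lambda>x. complex_of_real (V x) * resolvent c a x) \<in> L2"
    and "(L2_norm (\<lambda>x. complex_of_real (V x) * resolvent c a x))\<^sup>2 \<le> cell_const TYPE('d) K * \<eta>\<^sup>2 * (L2_norm a)\<^sup>2"
proof -
  interpret averaging "heat_measure c" "shift :: _ \<Rightarrow> real^'d" by (rule averaging_heat[OF c])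
  let ?M = "cell_const TYPE('d) K"
  have M: "?M \<ge> 0" using K by (simp add: cell_const_def)
  define \<theta> where "\<theta> = theta (real CARD('d) / p) (real CARD('d) / 4)"
  have \<theta>m [measurable]: "\<theta> \<in> borel_measurable borel" unfolding \<theta>_def theta_def by measurable
  have \<theta>pos: "s > 0 \<Longrightarrow> \<theta> s > 0" for s by (simp add: \<theta>_def theta_def)
  \<comment> \<open>The value 1 at nonpositive times only keeps the weight positive; the time
    measure does not charge them.\<close>
  define w where "w n = (if fst n > 0 then \<theta> (fst n) else 1)" for n :: "real \<times> (real^'d)"
  have wm [measurable]: "w \<in> borel_measurable (borel \<Otimes>\<^sub>M borel)" unfolding w_def by measurable
  interpret G: prob_space "gauss_measure :: (real^'d) measure" by (rule prob_space_gauss)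
  have W: "(\<integral>\<^sup>+n. ennreal (w n) \<partial>heat_measure c) \<le> ennreal \<eta>"
  proof -
    have "(\<integral>\<^sup>+n. ennreal (w n) \<partial>heat_measure c) = (\<integral>\<^sup>+s. ennreal (rayleigh c s) * ennreal (\<theta> s) \<partial>lborel)"
      by (subst nn_integral_heat, simp, intro nn_integral_cong)
        (auto simp: w_def G.emeasure_space_1 rayleigh_def indicator_def)
    then show ?thesis using I by (simp add: \<theta>_def)
  qed
  have \<kappa>: "(\<integral>\<^sup>+n. ennreal (1 / w n) * ennreal ((V (y - shift n))\<^sup>2) \<partial>heat_measure c) \<le> ennreal (?M * \<eta>)" for y
  proof -
    have "(\<integral>\<^sup>+n. ennreal (1 / w n) * ennreal ((V (y - shift n))\<^sup>2) \<partial>heat_measure c)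
      = (\<integral>\<^sup>+s. ennreal (rayleigh c s) * (\<integral>\<^sup>+z. ennreal (1 / w (s, z)) * ennreal ((V (y - s *\<^sub>R z))\<^sup>2) \<partial>gauss_measure) \<partial>lborel)"
      by (subst nn_integral_heat) (auto simp: shift_def)
    also have "\<dots> \<le> (\<integral>\<^sup>+s. ennreal ?M * (ennreal (rayleigh c s) * ennreal (\<theta> s)) \<partial>lborel)"
    proof (rule nn_integral_mono)
      fix s
      show "ennreal (rayleigh c s) * (\<integral>\<^sup>+z. ennreal (1 / w (s, z)) * ennreal ((V (y - s *\<^sub>R z))\<^sup>2) \<partial>gauss_measure)
        \<le> ennreal ?M * (ennreal (rayleigh c s) * ennreal (\<theta> s))"
      proof (cases "s > 0")
        case True
        have "(\<integral>\<^sup>+z. ennreal (1 / w (s, z)) * ennreal ((V (y - s *\<^sub>R z))\<^sup>2) \<partial>gauss_measure)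
          = ennreal (1 / \<theta> s) * (\<integral>\<^sup>+z. ennreal ((V (y - s *\<^sub>R z))\<^sup>2) \<partial>gauss_measure)"
          using True by (simp add: w_def nn_integral_cmult)
        also have "\<dots> \<le> ennreal (1 / \<theta> s) * ennreal (?M * (\<theta> s)\<^sup>2)"
          using potential_gauss_bound[OF V p K cell True, of y]
          unfolding \<theta>_def theta_def minus_divide_left by (rule mult_left_mono) simp
        also have "\<dots> = ennreal (?M * \<theta> s)"
          using \<theta>pos[OF True] M by (simp add: ennreal_mult[symmetric] power2_eq_square)
        finally have "ennreal (rayleigh c s) * (\<integral>\<^sup>+z. ennreal (1 / w (s, z)) * ennreal ((V (y - s *\<^sub>R z))\<^sup>2) \<partial>gauss_measure)
          \<le> ennreal (rayleigh c s) * ennreal (?M * \<theta> s)" by (intro mult_left_mono) auto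
        then show ?thesis using M \<theta>pos[OF True] by (simp add: ennreal_mult ac_simps)
      qed (simp add: rayleigh_def)
    qed
    also have "\<dots> = ennreal ?M * (\<integral>\<^sup>+s. ennreal (rayleigh c s) * ennreal (\<theta> s) \<partial>lborel)"
      by (intro nn_integral_cmult) measurable
    also have "\<dots> \<le> ennreal ?M * ennreal \<eta>" using I by (intro mult_left_mono) (auto simp: \<theta>_def)
    also have "\<dots> = ennreal (?M * \<eta>)" using M \<eta> by (simp add: ennreal_mult)
    finally show ?thesis .
  qed
  have na: "(\<integral>\<^sup>+y. ennreal ((norm (a y))\<^sup>2) \<partial>lborel) = ennreal ((L2_norm a)\<^sup>2)"
    using L2_norm_nn[OF a2] by (simp add: nn_integral_completion)
  have "(\<integral>\<^sup>+x. ennreal ((norm (complex_of_real (V x) * resolvent c a x))\<^sup>2) \<partial>lborel)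
    \<le> (\<integral>\<^sup>+x. ennreal ((V x)\<^sup>2) * (\<integral>\<^sup>+n. ennreal (norm (a (x + shift n))) \<partial>heat_measure c)\<^sup>2 \<partial>lborel)"
  proof (rule nn_integral_mono)
    fix x
    have "ennreal ((norm (complex_of_real (V x) * resolvent c a x))\<^sup>2) = ennreal ((V x)\<^sup>2) * ennreal ((norm (resolvent c a x))\<^sup>2)"
      by (simp add: norm_mult power_mult_distrib ennreal_mult)
    also have "\<dots> \<le> ennreal ((V x)\<^sup>2) * (\<integral>\<^sup>+n. ennreal (norm (a (x + shift n))) \<partial>heat_measure c)\<^sup>2"
      by (intro mult_left_mono norm_avg_sq_le) simp
    finally show "ennreal ((norm (complex_of_real (V x) * resolvent c a x))\<^sup>2)
      \<le> ennreal ((V x)\<^sup>2) * (\<integral>\<^sup>+n. ennreal (norm (a (x + shift n))) \<partial>heat_measure c)\<^sup>2" .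
  qed
  also have "\<dots> \<le> (\<integral>\<^sup>+n. ennreal (w n) \<partial>heat_measure c) * ennreal (?M * \<eta>) * (\<integral>\<^sup>+y. ennreal ((norm (a y))\<^sup>2) \<partial>lborel)"
    by (rule weighted_bound) (use \<kappa> in \<open>auto simp: w_def \<theta>pos\<close>)
  also have "\<dots> \<le> ennreal \<eta> * ennreal (?M * \<eta>) * ennreal ((L2_norm a)\<^sup>2)"
    unfolding na by (intro mult_right_mono W) auto
  also have "\<dots> = ennreal (?M * \<eta>\<^sup>2 * (L2_norm a)\<^sup>2)"
    using M \<eta> by (simp add: ennreal_mult[symmetric] power2_eq_square ac_simps)
  finally have le: "(\<integral>\<^sup>+x. ennreal ((norm (complex_of_real (V x) * resolvent c a x))\<^sup>2) \<partial>lborel)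
    \<le> ennreal (?M * \<eta>\<^sup>2 * (L2_norm a)\<^sup>2)" .
  have bm: "(\<lambda>x. complex_of_real (V x) * resolvent c a x) \<in> borel_measurable borel" by measurable
  show L2: "(\<lambda>x. complex_of_real (V x) * resolvent c a x) \<in> L2"
    using le by (subst borel_L2_nn[OF bm]) (auto intro: le_less_trans)
  show "(L2_norm (\<lambda>x. complex_of_real (V x) * resolvent c a x))\<^sup>2 \<le> ?M * \<eta>\<^sup>2 * (L2_norm a)\<^sup>2"
    using le L2_norm_nn[OF L2] M by (simp add: nn_integral_completion)
qed

section \<open>Test functions\<close>

lemma partial_eq:
  assumes "(f has_derivative D) (at x)"
  shows "partial i f x = D (axis i 1)"
  using frechet_derivative_at[OF assms] by (simp add: partial_def)

lemma Ck_continuous: "Ck n f \<Longrightarrow> continuous_on UNIV f"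
  by (cases n) (auto intro!: differentiable_imp_continuous_on simp: differentiable_on_def)

lemma Ck_Suc_imp: "Ck (Suc n) f \<Longrightarrow> Ck n f"
proof (induction n arbitrary: f)
  case 0
  then show ?case using Ck_continuous[of "Suc 0" f] by simp
qed auto

lemma Ck_const [simp]: "Ck n (\<lambda>x. c)"
proof (induction n arbitrary: c)
  case (Suc n)
  have "partial i (\<lambda>x. c) = (\<lambda>x. 0)" for i :: 'a and c :: complex
    by (rule ext) (simp add: partial_eq[OF has_derivative_const])
  with Suc show ?case by simp
qed simp

lemma has_derivative_frechet:
  "f differentiable (at x) \<Longrightarrow> (f has_derivative frechet_derivative f (at x)) (at x)"
  by (simp add: frechet_derivative_works)

lemma partial_add:
  assumes "f differentiable (at x)" "g differentiable (at x)"
  shows "partial i (\<lambda>x. f x + g x) x = partial i f x + partial i g x"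
  by (subst partial_eq[OF has_derivative_add[OF assms[THEN has_derivative_frechet]]]) (simp add: partial_def)

lemma partial_mult:
  assumes "f differentiable (at x)" "g differentiable (at x)"
  shows "partial i (\<lambda>x. f x * g x) x = f x * partial i g x + partial i f x * g x"
  by (subst partial_eq[OF has_derivative_mult[OF assms[THEN has_derivative_frechet]]]) (simp add: partial_def)

lemma partial_translate:
  assumes "f differentiable (at (x + t))"
  shows "partial i (\<lambda>x. f (x + t)) x = partial i f (x + t)"
proof -
  have "((\<lambda>x. f (x + t)) has_derivative (\<lambda>h. frechet_derivative f (at (x + t)) h)) (at x)"
    by (rule has_derivative_compose[of "\<lambda>x. x + t" "\<lambda>h. h" x UNIV f, OF _ has_derivative_frechet[OF assms], simplified])
      (auto intro!: derivative_eq_intros)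
  from partial_eq[OF this] show ?thesis by (simp add: partial_def)
qed

lemma Ck_add: "Ck n f \<Longrightarrow> Ck n g \<Longrightarrow> Ck n (\<lambda>x. f x + g x)"
proof (induction n arbitrary: f g)
  case 0 then show ?case by (auto intro!: continuous_intros)
next
  case (Suc n)
  then have "partial i (\<lambda>x. f x + g x) = (\<lambda>x. partial i f x + partial i g x)" for i
    by (intro ext partial_add) auto
  with Suc show ?case by auto
qed

lemma Ck_mult: "Ck n f \<Longrightarrow> Ck n g \<Longrightarrow> Ck n (\<lambda>x. f x * g x)"
proof (induction n arbitrary: f g)
  case 0 then show ?case by (auto intro!: continuous_intros)
next
  case (Suc n)
  then have "partial i (\<lambda>x. f x * g x) = (\<lambda>x. f x * partial i g x + partial i f x * g x)" for i
    by (intro ext partial_mult) auto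
  moreover have "Ck n f" "Ck n g" using Suc.prems Ck_Suc_imp by blast+
  moreover have "Ck n (partial i f)" "Ck n (partial i g)" for i using Suc.prems by auto
  ultimately show ?case using Suc.prems by (auto intro!: Ck_add Suc.IH)
qed

lemma Ck_translate: "Ck n f \<Longrightarrow> Ck n (\<lambda>x. f (x + t))"
proof (induction n arbitrary: f)
  case 0
  then have "continuous_on UNIV f" by simp
  from continuous_on_compose2[OF this _ subset_UNIV, of UNIV "\<lambda>x. x + t"] show ?case
    by (simp add: continuous_on_add continuous_on_id continuous_on_const)
next
  case (Suc n)
  then have "partial i (\<lambda>x. f (x + t)) = (\<lambda>x. partial i f (x + t))" for i
    by (intro ext partial_translate) auto
  moreover have "(\<lambda>x. f (x + t)) differentiable (at x)" for x
    by (rule differentiable_compose[of f "\<lambda>x. x + t"]) (use Suc.prems in auto)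
  ultimately show ?case using Suc by auto
qed

lemma Ck_prod: "finite I \<Longrightarrow> (\<And>i. i \<in> I \<Longrightarrow> Ck n (F i)) \<Longrightarrow> Ck n (\<lambda>x. \<Prod>i\<in>I. F i x)"
  by (induction I rule: finite_induct) (auto intro!: Ck_mult)

text \<open>For k = 0 this is the classical smooth function exp (-1/s) extended by zero. The powers
  of 1/s make the family closed under differentiation up to linear combinations, so that smoothness
  becomes an induction over the order for all k at once.\<close>

definition flat :: "nat \<Rightarrow> real \<Rightarrow> real" where
  "flat k s = (if s > 0 then (1 / s) ^ k * exp (- (1 / s)) else 0)"

lemma flat_tendsto_0: "(flat k \<longlongrightarrow> 0) (at 0)"
proof (rule filterlim_split_at)
  have "((\<lambda>s::real. (1 / s) ^ k / exp (1 / s)) \<longlongrightarrow> 0) (at_right 0)"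
    by (rule filterlim_compose[OF tendsto_power_div_exp_0]) real_asymp
  moreover have "eventually (\<lambda>s. (1 / s) ^ k / exp (1 / s) = flat k s) (at_right 0)"
    using eventually_at_right_less[of 0] by eventually_elim (simp add: flat_def exp_minus field_simps)
  ultimately show "(flat k \<longlongrightarrow> 0) (at_right 0)" by (rule Lim_transform_eventually)
  have "eventually (\<lambda>s. 0 = flat k s) (at_left (0::real))"
    unfolding eventually_at_filter by (intro always_eventually) (auto simp: flat_def)
  then show "(flat k \<longlongrightarrow> 0) (at_left 0)" by (rule Lim_transform_eventually[OF tendsto_const])
qed

text \<open>The only delicate point is the origin, where the difference quotient of
  \<open>flat k\<close> is \<open>flat (Suc k)\<close> itself and tends to zero.\<close>

lemma flat_has_derivative: "(flat k has_real_derivative (- real k * flat (Suc k) s + flat (Suc (Suc k)) s)) (at s)"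
proof -
  consider "s > 0" | "s < 0" | "s = 0" by linarith
  then show ?thesis
  proof cases
    case 1
    have "((\<lambda>s. (1 / s) ^ k * exp (- (1 / s))) has_real_derivative (- real k * flat (Suc k) s + flat (Suc (Suc k)) s)) (at s)"
    proof -
      have D1: "((\<lambda>s. 1 / s) has_real_derivative - ((1 / s) ^ 2)) (at s)"
        using 1 by (auto intro!: derivative_eq_intros simp: power2_eq_square)
      have D2: "((\<lambda>s. exp (- (1 / s))) has_real_derivative exp (- (1 / s)) * (1 / s) ^ 2) (at s)"
        using 1 by (auto intro!: derivative_eq_intros simp: power2_eq_square)
      have P: "((\<lambda>s. (1 / s) ^ k) has_real_derivative - (real k * (1 / s) ^ Suc k)) (at s)"
      proof (rule DERIV_cong[OF DERIV_power[OF D1, of k]])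
        show "real k * (- ((1 / s)\<^sup>2) * (1 / s) ^ (k - Suc 0)) = - (real k * (1 / s) ^ Suc k)"
          by (cases k) (simp_all add: power2_eq_square)
      qed
      show ?thesis
        by (rule DERIV_cong[OF DERIV_mult[OF P D2]]) (use 1 in \<open>simp add: flat_def power2_eq_square algebra_simps\<close>)
    qed
    then show ?thesis
    proof (rule has_field_derivative_transform_within_open[where S = "{0<..}"])
    qed (use 1 in \<open>auto simp: flat_def\<close>)
  next
    case 2
    have "((\<lambda>s. 0) has_real_derivative (- real k * flat (Suc k) s + flat (Suc (Suc k)) s)) (at s)"
      using 2 by (simp add: flat_def)
    then show ?thesis
    proof (rule has_field_derivative_transform_within_open[where S = "{..<0}"])
    qed (use 2 in \<open>auto simp: flat_def\<close>)
  next
    case 3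
    have "((\<lambda>h. (flat k (0 + h) - flat k 0) / h) \<longlongrightarrow> 0) (at 0)"
    proof (rule Lim_transform_eventually[OF flat_tendsto_0[of "Suc k"]])
      show "eventually (\<lambda>h. flat (Suc k) h = (flat k (0 + h) - flat k 0) / h) (at 0)"
        unfolding eventually_at_filter by (intro always_eventually) (auto simp: flat_def)
    qed
    then show ?thesis using 3 by (simp add: DERIV_def flat_def)
  qed
qed

lemma Ck_flat: "Ck n (\<lambda>x. complex_of_real (flat k (\<alpha> * x $ i + \<kappa>)))"
proof (induction n arbitrary: k)
  case 0
  have "continuous_on UNIV (flat k)"
    by (rule DERIV_continuous_on[OF flat_has_derivative])
  then have "continuous_on UNIV (\<lambda>x :: real^'a. flat k (\<alpha> * x $ i + \<kappa>))"
    by (rule continuous_on_compose2) (auto intro!: continuous_intros)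
  then show ?case by (auto intro!: continuous_intros)
next
  case (Suc n)
  let ?f = "\<lambda>k (x :: real^'a). complex_of_real (flat k (\<alpha> * x $ i + \<kappa>))"
  have D: "(?f k has_derivative (\<lambda>h. complex_of_real ((\<alpha> * h $ i) * (- real k * flat (Suc k) (\<alpha> * x $ i + \<kappa>) + flat (Suc (Suc k)) (\<alpha> * x $ i + \<kappa>))))) (at x)" for x
  proof (rule has_derivative_of_real)
    have "((\<lambda>x :: real^'a. \<alpha> * x $ i + \<kappa>) has_derivative (\<lambda>h. \<alpha> * h $ i)) (at x)"
      by (auto intro!: derivative_eq_intros bounded_linear.has_derivative[OF bounded_linear_vec_nth])
    from has_derivative_compose[OF this flat_has_derivative[of k, unfolded has_field_derivative_def]]
    show "((\<lambda>x. flat k (\<alpha> * x $ i + \<kappa>)) has_derivative (\<lambda>h. (\<alpha> * h $ i) * (- real k * flat (Suc k) (\<alpha> * x $ i + \<kappa>) + flat (Suc (Suc k)) (\<alpha> * x $ i + \<kappa>)))) (at x)"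
      by (simp add: mult.commute)
  qed
  have P: "partial j (?f k) = (\<lambda>x. (if j = i then complex_of_real \<alpha> else 0) * (complex_of_real (- real k) * ?f (Suc k) x + ?f (Suc (Suc k)) x))" for j
    by (rule ext, subst partial_eq[OF D]) (simp add: axis_def)
  have "Ck n (partial j (?f k))" for j
    unfolding P by (intro Ck_mult Ck_add Ck_const Suc.IH)
  moreover have "?f k differentiable (at x)" for x using D unfolding differentiable_def by blast
  ultimately show ?case by simp
qed

section \<open>Closure properties of test functions\<close>

lemma test_functionD:
  assumes "\<phi> \<in> test_functions"
  shows "continuous_on UNIV \<phi>" "\<phi> differentiable (at x)" "Ck n \<phi>"
    "\<phi> \<in> borel_measurable borel"
proof -
  show C: "Ck n \<phi>" for n using assms by (simp add: test_functions_def)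
  show c: "continuous_on UNIV \<phi>" using C[of 0] by simp
  show "\<phi> differentiable (at x)" using C[of "Suc 0"] by simp
  show "\<phi> \<in> borel_measurable borel" using c by (rule borel_measurable_continuous_onI)
qed

lemma test_function_support:
  assumes "\<phi> \<in> test_functions"
  shows "\<exists>R>0. \<forall>x. norm x \<ge> R \<longrightarrow> \<phi> x = 0"
proof -
  have "bounded {x. \<phi> x \<noteq> 0}"
    using assms compact_imp_bounded bounded_subset[OF _ closure_subset] by (auto simp: test_functions_def)
  then obtain R where R: "R > 0" "\<And>x. \<phi> x \<noteq> 0 \<Longrightarrow> norm x \<le> R" by (auto simp: bounded_pos)
  show ?thesis by (rule exI[of _ "R + 1"]) (use R in force)
qed

lemma test_functionI:
  assumes "\<And>n. Ck n \<phi>" and "\<And>x. norm x \<ge> R \<Longrightarrow> \<phi> x = 0"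
  shows "\<phi> \<in> test_functions"
proof -
  have "norm x \<le> R" if "\<phi> x \<noteq> 0" for x using assms(2)[of x] that by linarith
  then have "bounded {x. \<phi> x \<noteq> 0}" unfolding bounded_iff by (intro exI[of _ R]) simp
  then show ?thesis using assms(1) by (simp add: test_functions_def compact_eq_bounded_closed bounded_closure)
qed

lemma partial_test_function:
  assumes \<phi>: "\<phi> \<in> test_functions"
  shows "partial i \<phi> \<in> test_functions"
proof -
  obtain R where R: "R > 0" "\<forall>x. norm x \<ge> R \<longrightarrow> \<phi> x = 0" using test_function_support[OF \<phi>] by blast
  show ?thesis
  proof (rule test_functionI)
    show "Ck n (partial i \<phi>)" for n using test_functionD(3)[OF \<phi>, of "Suc n"] by simp
    fix x :: "real^'a" assume x: "norm x \<ge> R + 1"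
    have "(\<phi> has_derivative (\<lambda>h. 0)) (at x)"
    proof (rule has_derivative_transform_within_open[OF has_derivative_const[of 0]])
      show "open {y. norm y > R}" by (intro open_Collect_less continuous_intros)
      show "x \<in> {y. norm y > R}" using x by simp
    qed (use R in auto)
    from partial_eq[OF this] show "partial i \<phi> x = 0" .
  qed
qed

lemma test_function_add: "\<phi> \<in> test_functions \<Longrightarrow> \<psi> \<in> test_functions \<Longrightarrow> (\<lambda>x. \<phi> x + \<psi> x) \<in> test_functions"
proof -
  assume \<phi>: "\<phi> \<in> test_functions" and \<psi>: "\<psi> \<in> test_functions"
  obtain R where "\<forall>x. norm x \<ge> R \<longrightarrow> \<phi> x = 0" using test_function_support[OF \<phi>] by blast
  moreover obtain S where "\<forall>x. norm x \<ge> S \<longrightarrow> \<psi> x = 0" using test_function_support[OF \<psi>] by blast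
  ultimately show ?thesis
    using Ck_add[OF test_functionD(3)[OF \<phi>] test_functionD(3)[OF \<psi>]] by (intro test_functionI[where R = "max R S"]) auto
qed

lemma test_function_translate:
  assumes \<phi>: "\<phi> \<in> test_functions" shows "(\<lambda>x. \<phi> (x + t)) \<in> test_functions"
proof -
  obtain R where R: "\<forall>x. norm x \<ge> R \<longrightarrow> \<phi> x = 0" using test_function_support[OF \<phi>] by blast
  show ?thesis
  proof (rule test_functionI[where R = "R + norm t"])
    show "Ck n (\<lambda>x. \<phi> (x + t))" for n by (rule Ck_translate[OF test_functionD(3)[OF \<phi>]])
    fix x :: "real^'a" assume "norm x \<ge> R + norm t"
    then have "norm (x + t) \<ge> R" using norm_triangle_ineq4[of "x + t" t] by simp
    then show "\<phi> (x + t) = 0" using R by simp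
  qed
qed

lemma test_function_bounded:
  assumes \<phi>: "\<phi> \<in> test_functions"
  shows "\<exists>B\<ge>0. \<forall>x. norm (\<phi> x) \<le> B"
proof -
  obtain R where R: "\<forall>x. norm x \<ge> R \<longrightarrow> \<phi> x = 0" using test_function_support[OF \<phi>] by blast
  have "compact (\<phi> ` cball 0 R)"
    by (intro compact_continuous_image continuous_on_subset[OF test_functionD(1)[OF \<phi>]]) auto
  then have "bounded (\<phi> ` cball 0 R)" by (rule compact_imp_bounded)
  then obtain B where B: "B > 0" "\<forall>y\<in>\<phi> ` cball 0 R. norm y \<le> B" unfolding bounded_pos by blast
  show ?thesis
  proof (intro exI[of _ B] conjI allI)
    fix x show "norm (\<phi> x) \<le> B"
      using B R[rule_format, of x] by (cases "norm x \<le> R") auto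
  qed (use B in simp)
qed

lemma bounded_support_L2:
  fixes f :: "real^'d \<Rightarrow> complex"
  assumes [measurable]: "f \<in> borel_measurable borel" and B: "\<And>x. norm (f x) \<le> B" and R: "\<And>x. norm x > R \<Longrightarrow> f x = 0"
  shows "f \<in> L2"
proof -
  have "(\<integral>\<^sup>+x. ennreal ((norm (f x))\<^sup>2) \<partial>lborel) \<le> (\<integral>\<^sup>+x. ennreal (B\<^sup>2) * indicator (cball 0 R) x \<partial>(lborel :: (real^'d) measure))"
  proof (intro nn_integral_mono)
    fix x show "ennreal ((norm (f x))\<^sup>2) \<le> ennreal (B\<^sup>2) * indicator (cball 0 R) x"
      using B[of x] R[of x] by (auto simp: indicator_def intro!: ennreal_leI power_mono)
  qed
  also have "\<dots> < \<infinity>"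
    using emeasure_lborel_cball_finite[of "0 :: real^'d" R] by (simp add: nn_integral_cmult_indicator ennreal_mult_less_top)
  finally show ?thesis
    by (auto simp: L2_iff_nn nn_integral_completion intro: measurable_completion)
qed

lemma test_function_L2:
  assumes \<phi>: "\<phi> \<in> test_functions"
  shows "\<phi> \<in> L2"
proof -
  obtain R where "\<forall>x. norm x \<ge> R \<longrightarrow> \<phi> x = 0" using test_function_support[OF \<phi>] by blast
  moreover obtain B where "\<forall>x. norm (\<phi> x) \<le> B" using test_function_bounded[OF \<phi>] by blast
  ultimately show ?thesis using test_functionD(4)[OF \<phi>] by (intro bounded_support_L2[where R = R]) auto
qed

section \<open>Testing against boxes and against smooth functions\<close>

definition rat_vec :: "rat^'d \<Rightarrow> real^'d" where
  "rat_vec q = (\<chi> i. real_of_rat (q $ i))"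

lemma indicator_box_L2: "(indicator (box a b) :: real^'d \<Rightarrow> complex) \<in> L2"
proof -
  obtain R where R: "\<forall>x\<in>box a b. norm x \<le> R" using bounded_box[of a b] unfolding bounded_iff by blast
  show ?thesis
  proof (rule bounded_support_L2[where B = 1 and R = R])
    fix x :: "real^'d" assume "norm x > R"
    then have "x \<notin> box a b" using R by force
    then show "(indicator (box a b) x :: complex) = 0" by simp
  next
    fix x :: "real^'d" show "norm (indicator (box a b) x :: complex) \<le> 1" by (simp add: indicator_def)
  qed simp
qed

lemma rational_vec_above:
  fixes a :: "real^'d" shows "\<exists>q. \<forall>i. a $ i < rat_vec q $ i \<and> rat_vec q $ i < a $ i + 1 / Suc n"
proof -
  have "\<forall>i. \<exists>r. a $ i < real_of_rat r \<and> real_of_rat r < a $ i + 1 / Suc n" by (intro allI of_rat_dense) simp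
  then have "\<exists>r. \<forall>i. a $ i < real_of_rat (r i) \<and> real_of_rat (r i) < a $ i + 1 / Suc n" by (rule choice)
  then obtain r where "\<forall>i. a $ i < real_of_rat (r i) \<and> real_of_rat (r i) < a $ i + 1 / Suc n" by blast
  then show ?thesis by (intro exI[of _ "\<chi> i. r i"]) (simp add: rat_vec_def)
qed

lemma rational_vec_below:
  fixes a :: "real^'d" shows "\<exists>q. \<forall>i. a $ i - 1 / Suc n < rat_vec q $ i \<and> rat_vec q $ i < a $ i"
proof -
  have "\<forall>i. \<exists>r. a $ i - 1 / Suc n < real_of_rat r \<and> real_of_rat r < a $ i" by (intro allI of_rat_dense) simp
  then have "\<exists>r. \<forall>i. a $ i - 1 / Suc n < real_of_rat (r i) \<and> real_of_rat (r i) < a $ i" by (rule choice)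
  then obtain r where "\<forall>i. a $ i - 1 / Suc n < real_of_rat (r i) \<and> real_of_rat (r i) < a $ i" by blast
  then show ?thesis by (intro exI[of _ "\<chi> i. r i"]) (simp add: rat_vec_def)
qed

text \<open>Every open box is exhausted from inside by rational ones, so all box integrals vanish by
  dominated convergence. Boxes form an intersection-stable generator, which extends this to all
  Borel sets. Rational corners keep the family countable, as needed for separability.\<close>

lemma AE_zero_if_rational_boxes:
  fixes f :: "real^'d \<Rightarrow> complex"
  assumes f2: "f \<in> L2"
    and rat: "\<And>p q. (\<integral>x. f x * indicator (box (rat_vec p) (rat_vec q)) x \<partial>lebesgue) = 0"
  shows "AE x in lebesgue. f x = 0"
proof -
  have box: "(\<integral>x. f x * indicator (box a b) x \<partial>lebesgue) = 0" for a b
  proof -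
    have "\<exists>p. \<forall>n. \<forall>i. a $ i < rat_vec (p n) $ i \<and> rat_vec (p n) $ i < a $ i + 1 / Suc n"
      by (rule choice[OF allI[OF rational_vec_above]])
    then obtain p where p: "\<And>n i. a $ i < rat_vec (p n) $ i \<and> rat_vec (p n) $ i < a $ i + 1 / Suc n" by blast
    have "\<exists>q. \<forall>n. \<forall>i. b $ i - 1 / Suc n < rat_vec (q n) $ i \<and> rat_vec (q n) $ i < b $ i"
      by (rule choice[OF allI[OF rational_vec_below]])
    then obtain q where q: "\<And>n i. b $ i - 1 / Suc n < rat_vec (q n) $ i \<and> rat_vec (q n) $ i < b $ i" by blast
    have "(\<lambda>n. \<integral>x. f x * indicator (box (rat_vec (p n)) (rat_vec (q n))) x \<partial>lebesgue) \<longlonglongrightarrow> (\<integral>x. f x * indicator (box a b) x \<partial>lebesgue)"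
    proof (rule integral_dominated_convergence[where w = "\<lambda>x. norm (f x) * norm (indicator (box a b) x :: complex)"])
      show "(\<lambda>x. f x * indicator (box a b) x) \<in> borel_measurable lebesgue"
        "\<And>n. (\<lambda>x. f x * indicator (box (rat_vec (p n)) (rat_vec (q n))) x) \<in> borel_measurable lebesgue"
        using L2_measurable[OF f2] L2_measurable[OF indicator_box_L2] by (auto intro!: borel_measurable_times)
      show "integrable lebesgue (\<lambda>x. norm (f x) * norm (indicator (box a b) x :: complex))"
        by (intro integrable_norm_mult_L2 f2 indicator_box_L2)
      have sub: "box (rat_vec (p n)) (rat_vec (q n)) \<subseteq> box a b" for n
      proof
        fix x assume x: "x \<in> box (rat_vec (p n)) (rat_vec (q n))"
        show "x \<in> box a b"
          unfolding mem_box_cart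
        proof
          fix i
          have "rat_vec (p n) $ i < x $ i" "x $ i < rat_vec (q n) $ i" using x by (auto simp: mem_box_cart)
          then show "a $ i < x $ i \<and> x $ i < b $ i" using p[of i n] q[of i n] by linarith
        qed
      qed
      show "AE x in lebesgue. (\<lambda>n. f x * indicator (box (rat_vec (p n)) (rat_vec (q n))) x) \<longlonglongrightarrow> f x * indicator (box a b) x"
      proof (intro AE_I2)
        fix x
        show "(\<lambda>n. f x * indicator (box (rat_vec (p n)) (rat_vec (q n))) x) \<longlonglongrightarrow> f x * indicator (box a b) x"
        proof (cases "x \<in> box a b")
          case True
          then have "eventually (\<lambda>n. \<forall>i. 1 / Suc n < x $ i - a $ i \<and> 1 / Suc n < b $ i - x $ i) sequentially"
            by (intro eventually_all_finite eventually_conj order_tendstoD(2)[OF LIMSEQ_Suc[OF lim_1_over_n]])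
              (auto simp: mem_box_cart)
          then have "eventually (\<lambda>n. f x * indicator (box a b) x = f x * indicator (box (rat_vec (p n)) (rat_vec (q n))) x) sequentially"
          proof eventually_elim
            case (elim n)
            have "x \<in> box (rat_vec (p n)) (rat_vec (q n))"
              unfolding mem_box_cart
            proof
              fix i show "rat_vec (p n) $ i < x $ i \<and> x $ i < rat_vec (q n) $ i"
                using elim[rule_format, of i] p[of i n] q[of i n] by linarith
            qed
            then show ?case using True by simp
          qed
          then show ?thesis by (rule Lim_transform_eventually[OF tendsto_const])
        next
          case False
          then have "x \<notin> box (rat_vec (p n)) (rat_vec (q n))" for n using sub by blast
          then show ?thesis using False by simp
        qed
      qed
      show "AE x in lebesgue. norm (f x * indicator (box (rat_vec (p n)) (rat_vec (q n))) x) \<le> norm (f x) * norm (indicator (box a b) x :: complex)" for n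
        using sub[of n] by (intro AE_I2) (auto simp: norm_mult indicator_def)
    qed
    then show ?thesis by (simp add: rat LIMSEQ_const_iff)
  qed
  obtain g where gm [measurable]: "g \<in> borel_measurable borel" and fg: "AE x in lebesgue. f x = g x"
    using lebesgue_borel_version[OF L2_measurable[OF f2]] by blast
  have g2: "g \<in> L2" by (rule L2_cong_AE[OF f2]) (use fg in auto)
  have gint: "integrable lborel (\<lambda>x. g x * indicator (box a b) x)" for a b
    using integrable_mult_L2[OF g2 indicator_box_L2[of a b]] by (subst (asm) integrable_completion) auto
  have gbox: "(\<integral>x. g x * indicator (box a b) x \<partial>lborel) = 0" for a b
  proof -
    have "(\<integral>x. g x * indicator (box a b) x \<partial>lebesgue) = (\<integral>x. f x * indicator (box a b) x \<partial>lebesgue)"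
      by (rule integral_cong_AE)
        (use fg L2_measurable[OF g2] L2_measurable[OF f2] L2_measurable[OF indicator_box_L2[of a b]] in \<open>auto intro!: borel_measurable_times\<close>)
    then show ?thesis by (simp add: box integral_completion)
  qed
  \<comment> \<open>A square integrable function need not be integrable. Cutting it off to a box
    makes it so, and countably many boxes cover the space.\<close>
  have local: "AE x in lborel. g x * indicator (box a b) x = 0" for a b
  proof (rule sigma_finite_measure.density_zero[OF sigma_finite_lborel gint])
    let ?h = "\<lambda>x. g x * indicator (box a b) x"
    fix A :: "(real^'d) set" assume "A \<in> sets lborel"
    have "Int_stable (range (\<lambda>(a, b). box a b :: (real^'d) set))"
      by (auto simp: Int_stable_def box_Int_box)
    moreover have "range (\<lambda>(a, b). box a b :: (real^'d) set) \<subseteq> Pow UNIV" by auto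
    moreover have "A \<in> sigma_sets UNIV (range (\<lambda>(a, b). box a b))"
      using \<open>A \<in> sets lborel\<close> by (simp add: borel_eq_box)
    ultimately show "set_lebesgue_integral lborel A ?h = 0"
    proof (induction rule: sigma_sets_induct_disjoint)
      case (basic A)
      then obtain c d where A: "A = box c d" by auto
      have "set_lebesgue_integral lborel A ?h = (\<integral>x. g x * indicator (box a b \<inter> box c d) x \<partial>lborel)"
        unfolding A set_lebesgue_integral_def
        by (intro Bochner_Integration.integral_cong refl) (auto simp: indicator_def)
      then show ?case by (simp add: box_Int_box gbox)
    next
      case empty then show ?case by (simp add: set_lebesgue_integral_def)
    next
      case (compl A)
      then have A: "A \<in> sets lborel" by (simp add: borel_eq_box)
      have "set_lebesgue_integral lborel (UNIV - A) ?h = (\<integral>x. ?h x - indicator A x *\<^sub>R ?h x \<partial>lborel)"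
        unfolding set_lebesgue_integral_def by (intro Bochner_Integration.integral_cong refl) (auto simp: indicator_def)
      also have "\<dots> = (\<integral>x. ?h x \<partial>lborel) - set_lebesgue_integral lborel A ?h"
        unfolding set_lebesgue_integral_def
        by (intro Bochner_Integration.integral_diff gint integrable_mult_indicator A)
      finally show ?case using compl by (simp add: gbox)
    next
      case (union F)
      then have F: "F i \<in> sets lborel" for i by (auto simp: borel_eq_box)
      have "set_lebesgue_integral lborel (\<Union>i. F i) ?h = (\<Sum>i. set_lebesgue_integral lborel (F i) ?h)"
      proof (rule lebesgue_integral_countable_add)
        show "set_integrable lborel (\<Union>i. F i) ?h"
          unfolding set_integrable_def using F by (intro integrable_mult_indicator gint) auto
      qed (use F union in \<open>auto simp: disjoint_family_on_def\<close>)
      then show ?case using union by simp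
    qed
  qed
  have "AE x in lborel. \<forall>n::nat. g x * indicator (box (\<chi> i. - real n) (\<chi> i. real n)) x = 0"
    unfolding AE_all_countable using local by blast
  then have "AE x in lborel. g x = 0"
  proof eventually_elim
    case (elim x)
    obtain n :: nat where n: "norm x < real n" using reals_Archimedean2 by blast
    have "x \<in> box (\<chi> i. - real n) (\<chi> i. real n)"
      unfolding mem_box_cart
    proof
      fix i
      have "\<bar>x $ i\<bar> < real n" using component_le_norm_cart[of x i] n by linarith
      then show "(\<chi> i. - real n) $ i < x $ i \<and> x $ i < (\<chi> i. real n) $ i" by auto
    qed
    then show ?case using elim[rule_format, of n] by simp
  qed
  then have "AE x in lebesgue. g x = 0" by (rule AE_completion)
  with fg show ?thesis by eventually_elim simp
qed

text \<open>A smooth approximation of the indicator of the box from below: \<open>flat 0\<close>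
  vanishes on nonpositive arguments and tends to 1 at infinity, and the arguments are n times the
  distances to the faces. They are written as affine functions of one coordinate to fit
  \<open>Ck_flat\<close>.\<close>

definition bump :: "nat \<Rightarrow> real^'d \<Rightarrow> real^'d \<Rightarrow> real^'d \<Rightarrow> complex" where
  "bump n a b x = (\<Prod>i\<in>UNIV. complex_of_real (flat 0 (n * x $ i + - (n * a $ i))) * complex_of_real (flat 0 (- n * x $ i + n * b $ i)))"

lemma flat0_bounds: "0 \<le> flat 0 s" "flat 0 s \<le> 1"
  by (auto simp: flat_def)

lemma bump_outside: "n > 0 \<Longrightarrow> x \<notin> box a b \<Longrightarrow> bump n a b x = 0"
proof -
  assume n: "n > 0" and "x \<notin> box a b"
  then obtain i where i: "\<not> (a $ i < x $ i \<and> x $ i < b $ i)" unfolding mem_box_cart by blast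
  have "flat 0 (n * x $ i + - (n * a $ i)) = 0 \<or> flat 0 (- n * x $ i + n * b $ i) = 0"
    using i n by (auto simp: flat_def not_less)
  then show ?thesis unfolding bump_def by (intro prod_zero[OF finite]) auto
qed

lemma bump_bound: "norm (bump n a b x) \<le> 1"
  unfolding bump_def prod_norm[symmetric]
  by (intro prod_le_1) (auto simp: norm_mult flat0_bounds intro!: mult_le_one)

lemma bump_test_function: "n > 0 \<Longrightarrow> bump n a b \<in> test_functions"
proof -
  assume n: "n > 0"
  obtain R where R: "\<forall>x\<in>box a b. norm x \<le> R" using bounded_box[of a b] unfolding bounded_iff by blast
  show ?thesis
  proof (rule test_functionI[where R = "R + 1"])
    show "Ck k (bump n a b)" for k unfolding bump_def[abs_def] by (intro Ck_prod Ck_mult Ck_flat finite)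
    show "bump n a b x = 0" if "norm x \<ge> R + 1" for x using R that by (intro bump_outside n) force
  qed
qed

lemma bump_tendsto: "(\<lambda>n. bump (Suc n) a b x) \<longlonglongrightarrow> indicator (box a b) x"
proof (cases "x \<in> box a b")
  case True
  have one: "(\<lambda>n. complex_of_real (flat 0 (t n))) \<longlonglongrightarrow> 1" if "\<And>n. t n = real (Suc n) * s" "s > 0" for t s
  proof -
    have "(\<lambda>n::nat. exp (- (1 / (real (Suc n) * s)))) \<longlonglongrightarrow> 1" using that(2) by real_asymp
    then have "(\<lambda>n. flat 0 (t n)) \<longlonglongrightarrow> 1" using that by (simp add: flat_def)
    then show ?thesis using tendsto_of_real[of _ 1] by fastforce
  qed
  have "(\<lambda>n. bump (Suc n) a b x) \<longlonglongrightarrow> (\<Prod>i\<in>(UNIV :: 'a set). 1 * 1)"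
    unfolding bump_def
  proof (intro tendsto_prod tendsto_mult)
    fix i
    have i: "a $ i < x $ i" "x $ i < b $ i" using True by (auto simp: mem_box_cart)
    show "(\<lambda>n. complex_of_real (flat 0 (real (Suc n) * x $ i + - (real (Suc n) * a $ i)))) \<longlonglongrightarrow> 1"
      by (rule one[where s = "x $ i - a $ i"]) (use i in \<open>auto simp: algebra_simps\<close>)
    show "(\<lambda>n. complex_of_real (flat 0 (- real (Suc n) * x $ i + real (Suc n) * b $ i))) \<longlonglongrightarrow> 1"
      by (rule one[where s = "b $ i - x $ i"]) (use i in \<open>auto simp: algebra_simps\<close>)
  qed
  then show ?thesis using True by simp
qed (simp add: bump_outside)

text \<open>The bumps are dominated by the indicator of a rational box and converge to it, which
  reduces the claim to \<open>AE_zero_if_rational_boxes\<close>.\<close>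

lemma AE_zero_if_test_functions:
  fixes f :: "real^'d \<Rightarrow> complex"
  assumes f2: "f \<in> L2" and test: "\<And>\<psi>. \<psi> \<in> test_functions \<Longrightarrow> (\<integral>x. f x * \<psi> x \<partial>lebesgue) = 0"
  shows "AE x in lebesgue. f x = 0"
proof (rule AE_zero_if_rational_boxes[OF f2])
  fix p q :: "rat^'d"
  let ?b = "box (rat_vec p) (rat_vec q)"
  let ?\<psi> = "\<lambda>n. bump (Suc n) (rat_vec p) (rat_vec q)"
  have "(\<lambda>n. \<integral>x. f x * ?\<psi> n x \<partial>lebesgue) \<longlonglongrightarrow> (\<integral>x. f x * indicator ?b x \<partial>lebesgue)"
  proof (rule integral_dominated_convergence[where w = "\<lambda>x. norm (f x) * norm (indicator ?b x :: complex)"])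
    show "(\<lambda>x. f x * indicator ?b x) \<in> borel_measurable lebesgue"
      "\<And>n. (\<lambda>x. f x * ?\<psi> n x) \<in> borel_measurable lebesgue"
      using L2_measurable[OF f2] L2_measurable[OF indicator_box_L2]
        L2_measurable[OF test_function_L2[OF bump_test_function[OF zero_less_Suc]]]
      by (auto intro!: borel_measurable_times simp del: of_nat_Suc)
    show "integrable lebesgue (\<lambda>x. norm (f x) * norm (indicator ?b x :: complex))"
      by (intro integrable_norm_mult_L2 f2 indicator_box_L2)
    show "AE x in lebesgue. (\<lambda>n. f x * ?\<psi> n x) \<longlonglongrightarrow> f x * indicator ?b x"
      by (intro AE_I2 tendsto_mult tendsto_const bump_tendsto)
    show "AE x in lebesgue. norm (f x * ?\<psi> n x) \<le> norm (f x) * norm (indicator ?b x :: complex)" for n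
    proof (intro AE_I2)
      fix x
      have "norm (?\<psi> n x) \<le> norm (indicator ?b x :: complex)"
        using bump_bound[of "Suc n" "rat_vec p" "rat_vec q" x] bump_outside[of "Suc n" x "rat_vec p" "rat_vec q"]
        by (cases "x \<in> ?b") auto
      then show "norm (f x * ?\<psi> n x) \<le> norm (f x) * norm (indicator ?b x :: complex)"
        unfolding norm_mult by (rule mult_left_mono) simp
    qed
  qed
  then show "(\<integral>x. f x * indicator ?b x \<partial>lebesgue) = 0"
    by (simp add: test[OF bump_test_function] LIMSEQ_const_iff)
qed

section \<open>The resolvent of the Laplacian\<close>

definition lap :: "(real^'d \<Rightarrow> complex) \<Rightarrow> real^'d \<Rightarrow> complex" where
  "lap \<phi> x = (\<Sum>i\<in>UNIV. partial i (partial i \<phi>) x)"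

lemma lap_test_function: "\<phi> \<in> test_functions \<Longrightarrow> lap \<phi> \<in> test_functions"
proof -
  assume \<phi>: "\<phi> \<in> test_functions"
  have "(\<lambda>x. \<Sum>i\<in>I. partial i (partial i \<phi>) x) \<in> test_functions" if "finite I" for I
    using that
  proof (induction I rule: finite_induct)
    case empty
    show ?case by (rule test_functionI[where R = 0]) auto
  next
    case (insert i I)
    then show ?case
      using test_function_add[OF partial_test_function[OF partial_test_function[OF \<phi>, of i], of i] insert.IH] by simp
  qed
  then show ?thesis unfolding lap_def[abs_def] by simp
qed

section \<open>Integration by parts, also against the Gaussian\<close>

lemma partial_line_derivative:
  assumes "f differentiable (at (x + t *\<^sub>R axis i 1))"
  shows "((\<lambda>t. f (x + t *\<^sub>R axis i 1)) has_derivative (\<lambda>h. h *\<^sub>R partial i f (x + t *\<^sub>R axis i 1))) (at t)"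
proof -
  let ?D = "frechet_derivative f (at (x + t *\<^sub>R axis i 1))"
  have l: "((\<lambda>t. x + t *\<^sub>R axis i 1) has_derivative (\<lambda>h. h *\<^sub>R axis i 1)) (at t)"
    by (auto intro!: derivative_eq_intros)
  have "((\<lambda>t. f (x + t *\<^sub>R axis i 1)) has_derivative (\<lambda>h. ?D (h *\<^sub>R axis i 1))) (at t)"
    by (rule has_derivative_compose[OF l has_derivative_frechet[OF assms]])
  moreover have "?D (h *\<^sub>R axis i 1) = h *\<^sub>R partial i f (x + t *\<^sub>R axis i 1)" for h
    using linear_scale[OF has_derivative_linear[OF has_derivative_frechet[OF assms]]] by (simp add: partial_def)
  ultimately show ?thesis by simp
qed

text \<open>Translation invariance of the integral, differentiated in direction \<open>i\<close>.\<close>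

lemma integral_partial_eq_0:
  fixes F :: "real^'d \<Rightarrow> complex"
  assumes d: "\<And>x. F differentiable (at x)" and B: "\<And>x. norm (partial i F x) \<le> B"
    and R: "\<And>x. norm x \<ge> R \<Longrightarrow> F x = 0" and m [measurable]: "partial i F \<in> borel_measurable borel"
  shows "(\<integral>x. partial i F x \<partial>lborel) = 0"
proof -
  have Fc: "continuous_on UNIV F" using d by (auto intro!: differentiable_imp_continuous_on simp: differentiable_on_def)
  then have [measurable]: "F \<in> borel_measurable borel" by (rule borel_measurable_continuous_onI)
  have B0: "B \<ge> 0" using order_trans[OF norm_ge_zero B] .
  let ?e = "axis i 1 :: real^'d"
  let ?s = "\<lambda>n x. real (Suc n) *\<^sub>R (F (x + (1 / real (Suc n)) *\<^sub>R ?e) - F x)"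
  have lip: "norm (F (x + h *\<^sub>R ?e) - F x) \<le> B * \<bar>h\<bar>" for x h
  proof -
    have "norm (F (x + h *\<^sub>R ?e) - F (x + 0 *\<^sub>R ?e)) \<le> B * norm (h - 0)"
    proof (rule differentiable_bound[where S = UNIV and f' = "\<lambda>t h. h *\<^sub>R partial i F (x + t *\<^sub>R ?e)"])
      fix t
      show "((\<lambda>t. F (x + t *\<^sub>R ?e)) has_derivative (\<lambda>h. h *\<^sub>R partial i F (x + t *\<^sub>R ?e))) (at t within UNIV)"
        by (rule partial_line_derivative[OF d])
      show "onorm (\<lambda>h. h *\<^sub>R partial i F (x + t *\<^sub>R ?e)) \<le> B"
        by (rule onorm_bound[OF B0]) (simp add: B mult.commute[of B] mult_left_mono)
    qed auto
    then show ?thesis by simp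
  qed
  have Fint: "integrable lborel F"
  proof -
    have "F \<in> L2"
    proof (rule bounded_support_L2[where R = R and B = "B * (2 * \<bar>R\<bar> + 1)"])
      fix x
      show "norm (F x) \<le> B * (2 * \<bar>R\<bar> + 1)"
      proof (cases "norm x < R")
        case True
        \<comment> \<open>A step of this length along the axis leaves the ball of radius R, beyond
          which F vanishes; so the Lipschitz bound also bounds F itself.\<close>
        let ?h = "2 * \<bar>R\<bar> + 1"
        have "norm (?h *\<^sub>R ?e) = ?h" by simp
        then have "norm (x + ?h *\<^sub>R ?e) \<ge> R" using norm_triangle_ineq4[of "x + ?h *\<^sub>R ?e" x] True by simp
        then have "F (x + ?h *\<^sub>R ?e) = 0" by (rule R)
        then show ?thesis using lip[of x ?h] by simp
      qed (use R[of x] B0 in simp)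
    qed (use R in auto)
    moreover have "(indicator (cball 0 R) :: real^'d \<Rightarrow> complex) \<in> L2"
      by (rule bounded_support_L2[where R = R and B = 1], measurable) (auto split: split_indicator)
    ultimately have "integrable lebesgue (\<lambda>x. F x * indicator (cball 0 R) x)" by (rule integrable_mult_L2)
    also have "(\<lambda>x. F x * indicator (cball 0 R) x) = F" using R by (auto simp: indicator_def fun_eq_iff)
    finally show ?thesis by (subst (asm) integrable_completion) auto
  qed
  have "(\<lambda>n. \<integral>x. ?s n x \<partial>lborel) \<longlonglongrightarrow> (\<integral>x. partial i F x \<partial>lborel)"
  \<comment> \<open>The steps have length at most one, so all difference quotients live in one ball
    of radius |R| + 1 and are bounded there by the Lipschitz constant.\<close>
  proof (rule integral_dominated_convergence[where w = "\<lambda>x. B * indicator (cball 0 (\<bar>R\<bar> + 1)) x"])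
    show "integrable lborel (\<lambda>x::real^'d. B * indicator (cball 0 (\<bar>R\<bar> + 1)) x)"
      using emeasure_lborel_cball_finite[of "0 :: real^'d" "\<bar>R\<bar> + 1"]
      by (intro integrable_mult_right integrable_real_indicator) auto
    show "AE x in lborel. (\<lambda>n. ?s n x) \<longlonglongrightarrow> partial i F x"
    proof (intro AE_I2)
      fix x
      have "((\<lambda>h. norm (F (x + h *\<^sub>R ?e) - F x - h *\<^sub>R partial i F x) / norm h) \<longlongrightarrow> 0) (at 0)"
        using partial_line_derivative[OF d, where x = x and t = 0 and i = i] by (simp add: has_derivative_at)
      then have "((\<lambda>h. norm ((F (x + h *\<^sub>R ?e) - F x) /\<^sub>R h - partial i F x)) \<longlongrightarrow> 0) (at 0)"
      proof (rule Lim_transform_eventually)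
        have "norm (F (x + h *\<^sub>R ?e) - F x - h *\<^sub>R partial i F x) / norm h = norm ((F (x + h *\<^sub>R ?e) - F x) /\<^sub>R h - partial i F x)"
          if "h \<noteq> 0" for h
        proof -
          have "(F (x + h *\<^sub>R ?e) - F x) /\<^sub>R h - partial i F x = (F (x + h *\<^sub>R ?e) - F x - h *\<^sub>R partial i F x) /\<^sub>R h"
            using that by (simp add: scaleR_diff_right)
          then show ?thesis by (simp add: divide_inverse mult.commute)
        qed
        then show "eventually (\<lambda>h. norm (F (x + h *\<^sub>R ?e) - F x - h *\<^sub>R partial i F x) / norm h
            = norm ((F (x + h *\<^sub>R ?e) - F x) /\<^sub>R h - partial i F x)) (at 0)"
          unfolding eventually_at_filter by (intro always_eventually) blast
      qed
      then have lim: "((\<lambda>h. (F (x + h *\<^sub>R ?e) - F x) /\<^sub>R h) \<longlongrightarrow> partial i F x) (at 0)"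
        by (subst LIM_zero_iff[symmetric]) (rule tendsto_norm_zero_cancel)
      have "filterlim (\<lambda>n. 1 / real (Suc n)) (at 0) sequentially"
        by (intro filterlim_atI LIMSEQ_Suc[OF lim_1_over_n]) auto
      from filterlim_compose[OF lim this] show "(\<lambda>n. ?s n x) \<longlonglongrightarrow> partial i F x" by simp
    qed
    show "AE x in lborel. norm (?s n x) \<le> B * indicator (cball 0 (\<bar>R\<bar> + 1)) x" for n
    proof (intro AE_I2)
      fix x
      show "norm (?s n x) \<le> B * indicator (cball 0 (\<bar>R\<bar> + 1)) x"
      proof (cases "norm x \<le> \<bar>R\<bar> + 1")
        case True
        have "norm (?s n x) \<le> real (Suc n) * (B * (1 / real (Suc n)))"
          using lip[of x "1 / real (Suc n)"] by (simp only: norm_scaleR) (intro mult_mono; simp)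
        then show ?thesis using True by simp
      next
        case False
        have "norm ((1 / real (Suc n)) *\<^sub>R ?e) \<le> 1" by simp
        moreover have "norm x \<le> norm (x + (1 / real (Suc n)) *\<^sub>R ?e) + norm ((1 / real (Suc n)) *\<^sub>R ?e)"
          using norm_triangle_ineq4[of "x + (1 / real (Suc n)) *\<^sub>R ?e" "(1 / real (Suc n)) *\<^sub>R ?e"] by simp
        ultimately have "norm (x + (1 / real (Suc n)) *\<^sub>R ?e) \<ge> R" using False by linarith
        then show ?thesis using R[of x] R[of "x + (1 / real (Suc n)) *\<^sub>R ?e"] False by simp
      qed
    qed
  qed measurable
  moreover have "(\<integral>x. ?s n x \<partial>lborel) = 0" for n
  proof -
    have "(\<integral>x. ?s n x \<partial>lborel) = real (Suc n) *\<^sub>R ((\<integral>x. F (x + (1 / real (Suc n)) *\<^sub>R ?e) \<partial>lborel) - (\<integral>x. F x \<partial>lborel))"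
      by (simp add: integrable_lborel_translate[OF Fint] Fint)
    then show ?thesis by (simp add: integral_lborel_translate)
  qed
  ultimately show ?thesis by (simp add: LIMSEQ_const_iff)
qed

lemma gauss_density_exp: "gauss_density z = (1 / sqrt (2 * pi)) ^ CARD('d) * exp (- (z \<bullet> z) / 2)"
  for z :: "real^'d"
proof -
  have "(\<Prod>b\<in>(Basis :: (real^'d) set). exp (- (z \<bullet> b)\<^sup>2 / 2)) = exp (\<Sum>b\<in>(Basis :: (real^'d) set). - (z \<bullet> b)\<^sup>2 / 2)"
    by (simp add: exp_sum)
  also have "(\<Sum>b\<in>(Basis :: (real^'d) set). - (z \<bullet> b)\<^sup>2 / 2) = - (z \<bullet> z) / 2"
    by (simp add: euclidean_inner[of z z] sum_negf[symmetric] sum_divide_distrib power2_eq_square)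
  finally show ?thesis by (simp add: gauss_density_def std_normal_density_def prod.distrib prod_dividef power_one_over)
qed

lemma gauss_density_le_1: "gauss_density z \<le> 1"
  unfolding gauss_density_def
proof (intro prod_le_1 conjI)
  fix b :: "real^'a"
  have "1 / sqrt (2 * pi) \<le> 1" using pi_ge_two by (simp add: real_le_rsqrt)
  moreover have "exp (- (z \<bullet> b)\<^sup>2 / 2) \<le> 1" by simp
  ultimately show "std_normal_density (z \<bullet> b) \<le> 1"
    unfolding std_normal_density_def using mult_mono[of "1 / sqrt (2 * pi)" 1 "exp (- (z \<bullet> b)\<^sup>2 / 2)" 1] by simp
qed simp

text \<open>Gaussian integration by parts: the i-th derivative of the density is - z_i times the
  density, and the i-th derivative of density times \<open>\<psi> (x + s *\<^sub>R z)\<close> has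
  integral zero.\<close>

lemma stein_identity:
  fixes \<psi> :: "real^'d \<Rightarrow> complex"
  assumes \<psi>: "\<psi> \<in> test_functions" and s: "s > 0"
  shows "(\<integral>z. (z $ i) *\<^sub>R \<psi> (x + s *\<^sub>R z) \<partial>gauss_measure) = s *\<^sub>R (\<integral>z. partial i \<psi> (x + s *\<^sub>R z) \<partial>gauss_measure)"
proof -
  let ?F = "\<lambda>z. gauss_density z *\<^sub>R \<psi> (x + s *\<^sub>R z)"
  let ?G = "\<lambda>z. gauss_density z *\<^sub>R (s *\<^sub>R partial i \<psi> (x + s *\<^sub>R z) - (z $ i) *\<^sub>R \<psi> (x + s *\<^sub>R z))"
  have p\<psi>: "partial i \<psi> \<in> test_functions" by (rule partial_test_function[OF \<psi>])
  note [measurable] = test_functionD(4)[OF \<psi>] test_functionD(4)[OF p\<psi>]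
  have DF: "(?F has_derivative (\<lambda>h. gauss_density z *\<^sub>R frechet_derivative \<psi> (at (x + s *\<^sub>R z)) (s *\<^sub>R h)
      + (- (z \<bullet> h) * gauss_density z) *\<^sub>R \<psi> (x + s *\<^sub>R z))) (at z)" for z
  proof (rule has_derivative_scaleR)
    show "((\<lambda>z. \<psi> (x + s *\<^sub>R z)) has_derivative (\<lambda>h. frechet_derivative \<psi> (at (x + s *\<^sub>R z)) (s *\<^sub>R h))) (at z)"
      by (rule has_derivative_compose[OF _ has_derivative_frechet[OF test_functionD(2)[OF \<psi>]]])
        (auto intro!: derivative_eq_intros)
    show "(gauss_density has_derivative (\<lambda>h. - (z \<bullet> h) * gauss_density z)) (at z)"
      unfolding gauss_density_exp[abs_def]
      by (auto intro!: derivative_eq_intros simp: fun_eq_iff inner_commute)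
  qed
  have pF: "partial i ?F = ?G"
  proof
    fix z
    have "frechet_derivative \<psi> (at (x + s *\<^sub>R z)) (s *\<^sub>R axis i 1) = s *\<^sub>R partial i \<psi> (x + s *\<^sub>R z)"
      using linear_scale[OF has_derivative_linear[OF has_derivative_frechet[OF test_functionD(2)[OF \<psi>]]]]
      by (simp add: partial_def)
    then show "partial i ?F z = ?G z"
      by (subst partial_eq[OF DF]) (simp add: inner_axis scaleR_diff_right algebra_simps)
  qed
  obtain R where R: "R > 0" "\<forall>x. norm x \<ge> R \<longrightarrow> \<psi> x = 0" using test_function_support[OF \<psi>] by blast
  obtain R' where R': "R' > 0" "\<forall>x. norm x \<ge> R' \<longrightarrow> partial i \<psi> x = 0" using test_function_support[OF p\<psi>] by blast
  obtain B where B: "B \<ge> 0" "\<forall>x. norm (\<psi> x) \<le> B" using test_function_bounded[OF \<psi>] by blast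
  obtain B' where B': "B' \<ge> 0" "\<forall>x. norm (partial i \<psi> x) \<le> B'" using test_function_bounded[OF p\<psi>] by blast
  \<comment> \<open>For z beyond this radius the point \<open>x + s *\<^sub>R z\<close> lies outside
    the supports of \<open>\<psi>\<close> and of its derivative, so all products with z stay
    bounded.\<close>
  define S where "S = (max R R' + norm x) / s"
  have far: "norm (x + s *\<^sub>R z) \<ge> max R R'" if "norm z \<ge> S" for z
  proof -
    have "s * norm z \<ge> max R R' + norm x" using that s by (simp add: S_def field_simps)
    then show ?thesis using norm_triangle_ineq4[of "x + s *\<^sub>R z" x] s by (simp del: max.bounded_iff)
  qed
  have far0: "\<psi> (x + s *\<^sub>R z) = 0" "partial i \<psi> (x + s *\<^sub>R z) = 0" if "norm z \<ge> S" for z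
    using far[OF that] R R' by auto
  have zpsi: "norm ((z $ i) *\<^sub>R \<psi> (x + s *\<^sub>R z)) \<le> \<bar>S\<bar> * B" for z
  proof (cases "norm z \<ge> S")
    case False
    have "\<bar>z $ i\<bar> \<le> \<bar>S\<bar>" using component_le_norm_cart[of z i] False by linarith
    then show ?thesis using B by (auto intro!: mult_mono)
  qed (use far0 B in simp)
  have "(\<integral>z. partial i ?F z \<partial>lborel) = 0"
  proof (rule integral_partial_eq_0[where R = S and B = "s * B' + \<bar>S\<bar> * B"])
    show "?F differentiable (at z)" for z using DF unfolding differentiable_def by blast
    show "partial i ?F \<in> borel_measurable borel" unfolding pF by measurable
    show "?F z = 0" if "norm z \<ge> S" for z using far0[OF that] by simp
    fix z
    have "norm (s *\<^sub>R partial i \<psi> (x + s *\<^sub>R z) - (z $ i) *\<^sub>R \<psi> (x + s *\<^sub>R z)) \<le> s * B' + \<bar>S\<bar> * B"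
    proof (rule order_trans[OF norm_triangle_ineq4 add_mono[OF _ zpsi]])
      show "norm (s *\<^sub>R partial i \<psi> (x + s *\<^sub>R z)) \<le> s * B'" using s B' by simp
    qed
    then have "gauss_density z * norm (s *\<^sub>R partial i \<psi> (x + s *\<^sub>R z) - (z $ i) *\<^sub>R \<psi> (x + s *\<^sub>R z)) \<le> 1 * (s * B' + \<bar>S\<bar> * B)"
      by (intro mult_mono gauss_density_le_1) auto
    then show "norm (partial i ?F z) \<le> s * B' + \<bar>S\<bar> * B" unfolding pF by simp
  qed
  then have "(\<integral>z. s *\<^sub>R partial i \<psi> (x + s *\<^sub>R z) - (z $ i) *\<^sub>R \<psi> (x + s *\<^sub>R z) \<partial>gauss_measure) = 0"
    unfolding pF gauss_measure_def by (subst integral_density) auto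
  moreover
  interpret G: prob_space "gauss_measure :: (real^'d) measure" by (rule prob_space_gauss)
  have "integrable gauss_measure (\<lambda>z. s *\<^sub>R partial i \<psi> (x + s *\<^sub>R z))"
    by (rule G.integrable_const_bound[where B = "s * B'"]) (use s B' in auto)
  moreover have "integrable gauss_measure (\<lambda>z. (z $ i) *\<^sub>R \<psi> (x + s *\<^sub>R z))"
    by (rule G.integrable_const_bound[where B = "\<bar>S\<bar> * B"]) (use zpsi in auto)
  ultimately show ?thesis by simp
qed

lemma frechet_derivative_partials:
  assumes "f differentiable (at y)"
  shows "frechet_derivative f (at y) z = (\<Sum>i\<in>UNIV. (z $ i) *\<^sub>R partial i f y)"
proof -
  have l: "linear (frechet_derivative f (at y))" by (rule has_derivative_linear[OF has_derivative_frechet[OF assms]])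
  have "frechet_derivative f (at y) z = frechet_derivative f (at y) (\<Sum>i\<in>UNIV. (z $ i) *\<^sub>R axis i 1)"
    using basis_expansion[of z] by (simp add: scalar_mult_eq_scaleR)
  then show ?thesis by (simp add: linear_sum[OF l] linear_scale[OF l] partial_def)
qed

text \<open>A crude bound is enough for integrability of the first moment. From t^2/2 + 2 \<ge> 2
  |t| the one-dimensional density is at most exp 2 times exp (-|t|) squared; one factor exp (-|t|)
  absorbs the moment, the other yields the weight.\<close>

lemma gauss_moment_le:
  fixes z :: "real^'d"
  shows "gauss_density z * \<bar>z $ i\<bar> \<le> exp (2 * real CARD('d)) * laplace_weight z"
proof -
  let ?e = "axis i 1 :: real^'d"
  have e: "?e \<in> Basis" by (auto simp: Basis_vec_def)
  have dens: "std_normal_density t \<le> exp 2 * exp (- \<bar>t\<bar>) * exp (- \<bar>t\<bar>)" for t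
  proof -
    have "0 \<le> (\<bar>t\<bar> - 2)\<^sup>2" by simp
    then have "2 * \<bar>t\<bar> \<le> t\<^sup>2 / 2 + 2" by (simp add: power2_diff)
    then have "exp (- t\<^sup>2 / 2) \<le> exp 2 * exp (- \<bar>t\<bar>) * exp (- \<bar>t\<bar>)" unfolding exp_add[symmetric] by simp
    moreover have "1 / sqrt (2 * pi) \<le> 1" using pi_ge_two by (simp add: real_le_rsqrt)
    from mult_right_mono[OF this exp_ge_zero] have "std_normal_density t \<le> exp (- t\<^sup>2 / 2)"
      unfolding std_normal_density_def by (simp only: mult_1_left)
    ultimately show ?thesis by linarith
  qed
  have te: "\<bar>t\<bar> * exp (- \<bar>t\<bar>) \<le> 1" for t :: real
  proof -
    have "\<bar>t\<bar> \<le> exp \<bar>t\<bar>" using exp_ge_add_one_self[of "\<bar>t\<bar>"] by linarith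
    then show ?thesis by (simp add: exp_minus field_simps)
  qed
  have "gauss_density z * \<bar>z $ i\<bar> = (\<Prod>b\<in>Basis. std_normal_density (z \<bullet> b)) * (\<Prod>b\<in>Basis. if b = ?e then \<bar>z \<bullet> b\<bar> else 1)"
    using e by (simp add: gauss_density_def prod.delta' inner_axis)
  also have "\<dots> = (\<Prod>b\<in>Basis. std_normal_density (z \<bullet> b) * (if b = ?e then \<bar>z \<bullet> b\<bar> else 1))"
    by (rule prod.distrib[symmetric])
  also have "\<dots> \<le> (\<Prod>b\<in>(Basis :: (real^'d) set). exp 2 * exp (- \<bar>z \<bullet> b\<bar>))"
  proof (intro prod_mono conjI)
    fix b :: "real^'d"
    let ?t = "z \<bullet> b"
    let ?k = "if b = ?e then \<bar>?t\<bar> else 1" and ?E = "exp (- \<bar>?t\<bar>)"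
    have "?k * ?E \<le> 1" using te[of ?t] by (cases "b = ?e") auto
    have "std_normal_density ?t * ?k \<le> (exp 2 * ?E * ?E) * ?k"
      by (intro mult_right_mono dens) auto
    also have "\<dots> = exp 2 * ?E * (?k * ?E)" by (simp only: ac_simps)
    also have "\<dots> \<le> exp 2 * ?E * 1" using \<open>?k * ?E \<le> 1\<close> by (intro mult_left_mono) auto
    finally show "std_normal_density ?t * ?k \<le> exp 2 * ?E" by simp
  qed auto
  also have "\<dots> = exp (2 * real CARD('d)) * laplace_weight z"
    by (simp add: prod.distrib laplace_weight_def exp_of_nat_mult[symmetric] mult.commute)
  finally show ?thesis .
qed

lemma integrable_gauss_moment: "integrable gauss_measure (\<lambda>z :: real^'d. \<bar>z $ i\<bar>)"
proof -
  have "(\<integral>\<^sup>+z. ennreal (gauss_density z) * ennreal \<bar>z $ i\<bar> \<partial>(lborel :: (real^'d) measure))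
    \<le> (\<integral>\<^sup>+z. ennreal (exp (2 * real CARD('d))) * ennreal (laplace_weight z) \<partial>(lborel :: (real^'d) measure))"
    using gauss_moment_le[of _ i] less_imp_le[OF laplace_weight_pos]
    by (intro nn_integral_mono) (simp add: ennreal_mult'[symmetric] ennreal_leI)
  also have "\<dots> = ennreal (exp (2 * real CARD('d))) * (\<integral>\<^sup>+z. ennreal (laplace_weight z) \<partial>(lborel :: (real^'d) measure))"
    by (intro nn_integral_cmult) measurable
  also have "\<dots> < \<infinity>"
  proof -
    have "(\<integral>\<^sup>+z. ennreal (laplace_weight z) \<partial>(lborel :: (real^'d) measure)) < \<infinity>"
      by (rule le_less_trans[OF nn_integral_laplace_weight]) simp
    then show ?thesis by (simp add: ennreal_mult_less_top)
  qed
  finally show ?thesis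
    unfolding gauss_measure_def by (subst integrable_iff_bounded) (auto simp: nn_integral_density)
qed

lemma resolvent_eq:
  fixes a :: "real^'d \<Rightarrow> complex"
  assumes c: "c > 0" and a [measurable]: "a \<in> borel_measurable borel" and B: "\<And>x. norm (a x) \<le> B"
  shows "resolvent c a x = (\<integral>s. rayleigh c s *\<^sub>R (\<integral>z. a (x + s *\<^sub>R z) \<partial>gauss_measure) \<partial>lborel)"
proof -
  interpret averaging "heat_measure c" "shift :: _ \<Rightarrow> real^'d" by (rule averaging_heat[OF c])
  interpret T: finite_measure "time_measure c" by (rule finite_measure_time[OF c])
  interpret G: prob_space "gauss_measure :: (real^'d) measure" by (rule prob_space_gauss)
  interpret TG: pair_sigma_finite "time_measure c" "gauss_measure :: (real^'d) measure" ..
  have "integrable (time_measure c \<Otimes>\<^sub>M gauss_measure) (\<lambda>n. a (x + shift n))"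
    unfolding heat_measure_def[symmetric] by (rule integrable_const_bound[where B = B]) (use B in auto)
  then have "(\<integral>n. a (x + shift n) \<partial>(time_measure c \<Otimes>\<^sub>M gauss_measure)) = (\<integral>s. (\<integral>z. a (x + shift (s, z)) \<partial>gauss_measure) \<partial>time_measure c)"
    by (rule TG.integral_fst'[symmetric])
  then have "resolvent c a x = (\<integral>s. (\<integral>z. a (x + s *\<^sub>R z) \<partial>gauss_measure) \<partial>time_measure c)"
    unfolding avg_def by (simp add: heat_measure_def shift_def)
  then show ?thesis unfolding time_measure_def by (subst (asm) integral_density) auto
qed

text \<open>
  Along each ray \<open>x + s z\<close> the integrand is the derivative of \<open>- exp (- c s\<^sup>2 / 2) \<phi> (x + s z)\<close>; integration by
  parts in \<open>z\<close> turns the radial derivative into the Laplacian.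
\<close>

theorem resolvent_test_function:
  fixes \<phi> :: "real^'d \<Rightarrow> complex"
  assumes \<phi>: "\<phi> \<in> test_functions" and c: "c > 0"
  shows "resolvent c (\<lambda>x. c * \<phi> x - lap \<phi> x) x = \<phi> x"
proof -
  interpret G: prob_space "gauss_measure :: (real^'d) measure" by (rule prob_space_gauss)
  interpret LG: pair_sigma_finite lborel "gauss_measure :: (real^'d) measure" ..
  have p\<phi>: "partial i \<phi> \<in> test_functions" for i by (rule partial_test_function[OF \<phi>])
  have pp\<phi>: "partial i (partial i \<phi>) \<in> test_functions" for i by (intro partial_test_function \<phi>)
  have l\<phi>: "lap \<phi> \<in> test_functions" by (rule lap_test_function[OF \<phi>])
  note [measurable] = test_functionD(4)[OF \<phi>] test_functionD(4)[OF p\<phi>] test_functionD(4)[OF pp\<phi>] test_functionD(4)[OF l\<phi>]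
  obtain B where B: "B \<ge> 0" "\<forall>x. norm (\<phi> x) \<le> B" using test_function_bounded[OF \<phi>] by blast
  have "\<forall>i. \<exists>b\<ge>0. \<forall>x. norm (partial i \<phi> x) \<le> b" using test_function_bounded[OF p\<phi>] by blast
  from choice[OF this] obtain b where b: "\<forall>i. b i \<ge> 0 \<and> (\<forall>x. norm (partial i \<phi> x) \<le> b i)" by blast
  obtain Bl where Bl: "Bl \<ge> 0" "\<forall>x. norm (lap \<phi> x) \<le> Bl" using test_function_bounded[OF l\<phi>] by blast
  define E where "E s = exp (- c * s\<^sup>2 / 2)" for s
  have [measurable]: "E \<in> borel_measurable borel" unfolding E_def by measurable
  have Epos: "E s > 0" for s by (simp add: E_def)
  define D where "D s z = (\<Sum>i\<in>UNIV. (z $ i) *\<^sub>R partial i \<phi> (x + s *\<^sub>R z))" for s z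
  define f where "f s z = (c * s * E s) *\<^sub>R \<phi> (x + s *\<^sub>R z) - E s *\<^sub>R D s z" for s z
  define Z where "Z z = c * B + (\<Sum>i\<in>UNIV. b i * \<bar>z $ i\<bar>)" for z
  have Z0: "Z z \<ge> 0" for z using b B c by (auto simp: Z_def intro!: add_nonneg_nonneg sum_nonneg)
  \<comment> \<open>Together with \<open>Z\<close> an integrable majorant of \<open>f\<close> in
    product form: \<open>(1 + s) * E s\<close> is at most 2 for s in (0, 1], and at most
    \<open>2 * s * E s\<close>, twice the time density, beyond 1.\<close>
  define \<alpha> where "\<alpha> s = 2 * indicator {0..1} s + 2 * rayleigh c s" for s :: real
  have \<alpha>0: "\<alpha> s \<ge> 0" for s by (simp add: \<alpha>_def)
  have \<alpha>int: "integrable lborel \<alpha>"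
  proof -
    have "(\<integral>\<^sup>+s. ennreal (rayleigh c s) \<partial>lborel) < \<infinity>"
      using emeasure_time[OF c] by (simp add: time_measure_def emeasure_density)
    then have "integrable lborel (rayleigh c)" by (subst integrable_iff_bounded) simp
    then show ?thesis unfolding \<alpha>_def[abs_def]
      by (intro Bochner_Integration.integrable_add integrable_mult_right integrable_real_indicator) auto
  qed
  have Zint: "integrable gauss_measure Z"
    unfolding Z_def[abs_def] using integrable_gauss_moment
    by (intro Bochner_Integration.integrable_add Bochner_Integration.integrable_sum integrable_mult_right) auto
  have Dbound: "norm (D s z) \<le> (\<Sum>i\<in>UNIV. b i * \<bar>z $ i\<bar>)" for s z
    unfolding D_def
  proof (rule order_trans[OF norm_sum], intro sum_mono)
    fix i
    have "\<bar>z $ i\<bar> * norm (partial i \<phi> (x + s *\<^sub>R z)) \<le> \<bar>z $ i\<bar> * b i" using b by (intro mult_left_mono) auto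
    then show "norm ((z $ i) *\<^sub>R partial i \<phi> (x + s *\<^sub>R z)) \<le> b i * \<bar>z $ i\<bar>" by (simp add: mult.commute)
  qed
  have fbound: "norm (indicator {0<..} s *\<^sub>R f s z) \<le> \<alpha> s * Z z" for s z
  proof (cases "s > 0")
    case True
    have "norm (f s z) \<le> norm ((c * s * E s) *\<^sub>R \<phi> (x + s *\<^sub>R z)) + norm (E s *\<^sub>R D s z)"
      unfolding f_def by (rule norm_triangle_ineq4)
    also have "\<dots> \<le> (c * s * E s) * B + E s * (\<Sum>i\<in>UNIV. b i * \<bar>z $ i\<bar>)"
      using True c B Dbound Epos[of s] by (intro add_mono) (auto intro!: mult_left_mono simp: less_imp_le)
    also have "\<dots> \<le> (1 + s) * E s * Z z"
    proof -
      have "0 \<le> E s * (c * B)" "0 \<le> s * E s * (\<Sum>i\<in>UNIV. b i * \<bar>z $ i\<bar>)"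
        using True c B b Epos[of s] by (auto intro!: mult_nonneg_nonneg sum_nonneg)
      then show ?thesis by (simp add: Z_def algebra_simps)
    qed
    also have "\<dots> \<le> \<alpha> s * Z z"
    proof (intro mult_right_mono Z0)
      show "(1 + s) * E s \<le> \<alpha> s"
      proof (cases "s \<le> 1")
        case s1: True
        have "E s \<le> 1" using c by (simp add: E_def)
        then have "(1 + s) * E s \<le> 2 * 1" using True s1 Epos[of s] by (intro mult_mono) auto
        then show ?thesis using True s1 by (simp add: \<alpha>_def add_increasing2)
      next
        case False
        then have "(1 + s) * E s \<le> (2 * s) * E s" using Epos[of s] by (intro mult_right_mono) auto
        then show ?thesis using False by (simp add: \<alpha>_def rayleigh_def E_def)
      qed
    qed
    finally show ?thesis using True by simp
  qed (use \<alpha>0 Z0 in simp)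
  have fm [measurable]: "(\<lambda>(s, z). f s z) \<in> borel_measurable (lborel \<Otimes>\<^sub>M gauss_measure)"
  proof -
    have l [measurable]: "(\<lambda>n. x + fst n *\<^sub>R snd n) \<in> borel_measurable (lborel \<Otimes>\<^sub>M (gauss_measure :: (real^'d) measure))"
      by measurable
    have [measurable]: "(\<lambda>n. partial i \<phi> (x + fst n *\<^sub>R snd n)) \<in> borel_measurable (lborel \<Otimes>\<^sub>M gauss_measure)" for i
      by (rule measurable_compose[OF l test_functionD(4)[OF p\<phi>]])
    have [measurable]: "(\<lambda>n. snd n $ i) \<in> borel_measurable (lborel \<Otimes>\<^sub>M (gauss_measure :: (real^'d) measure))" for i
    proof -
      have "(\<lambda>n. snd n \<bullet> axis i 1) \<in> borel_measurable (lborel \<Otimes>\<^sub>M (gauss_measure :: (real^'d) measure))" by measurable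
      then show ?thesis by (simp add: inner_axis)
    qed
    show ?thesis
      unfolding f_def D_def case_prod_beta by measurable
  qed
  have fint: "integrable (lborel \<Otimes>\<^sub>M gauss_measure) (\<lambda>(s, z). indicator {0<..} s *\<^sub>R f s z)"
  proof (subst integrable_iff_bounded, intro conjI)
    have "(\<integral>\<^sup>+n. ennreal (norm (case n of (s, z) \<Rightarrow> indicator {0<..} s *\<^sub>R f s z)) \<partial>(lborel \<Otimes>\<^sub>M gauss_measure))
      = (\<integral>\<^sup>+s. (\<integral>\<^sup>+z. ennreal (norm (indicator {0<..} s *\<^sub>R f s z)) \<partial>gauss_measure) \<partial>lborel)"
      by (subst G.nn_integral_fst[symmetric]) auto
    also have "\<dots> \<le> (\<integral>\<^sup>+s. (\<integral>\<^sup>+z. ennreal (\<alpha> s) * ennreal (Z z) \<partial>gauss_measure) \<partial>lborel)"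
      using fbound \<alpha>0 Z0 by (intro nn_integral_mono) (simp only: ennreal_mult[symmetric] ennreal_leI)
    also have "\<dots> = (\<integral>\<^sup>+s. ennreal (\<alpha> s) * (\<integral>\<^sup>+z. ennreal (Z z) \<partial>gauss_measure) \<partial>lborel)"
      using Zint by (intro nn_integral_cong nn_integral_cmult) auto
    also have "\<dots> = (\<integral>\<^sup>+s. ennreal (\<alpha> s) \<partial>lborel) * (\<integral>\<^sup>+z. ennreal (Z z) \<partial>gauss_measure)"
      using \<alpha>int by (intro nn_integral_multc) auto
    also have "\<dots> < \<infinity>"
      using \<alpha>int Zint \<alpha>0 Z0 by (simp add: integrable_iff_bounded ennreal_mult_less_top)
    finally show "(\<integral>\<^sup>+n. ennreal (norm (case n of (s, z) \<Rightarrow> indicator {0<..} s *\<^sub>R f s z)) \<partial>(lborel \<Otimes>\<^sub>M gauss_measure)) < \<infinity>" .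
  qed measurable
  have ftc: "(\<integral>s. indicator {0<..} s *\<^sub>R f s z \<partial>lborel) = \<phi> x" for z
  proof -
    let ?F = "\<lambda>s. - (E s *\<^sub>R \<phi> (x + s *\<^sub>R z))"
    have DE: "(E has_real_derivative - (c * s * E s)) (at s)" for s
      unfolding E_def by (auto intro!: derivative_eq_intros)
    have D\<phi>: "((\<lambda>s. \<phi> (x + s *\<^sub>R z)) has_vector_derivative D s z) (at s)" for s
    proof -
      have "((\<lambda>s. x + s *\<^sub>R z) has_derivative (\<lambda>h. h *\<^sub>R z)) (at s)" by (auto intro!: derivative_eq_intros)
      from has_derivative_compose[OF this has_derivative_frechet[OF test_functionD(2)[OF \<phi>]]]
      show ?thesis
        unfolding has_vector_derivative_def D_def
        by (simp add: frechet_derivative_partials[OF test_functionD(2)[OF \<phi>]] scaleR_sum_right)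
    qed
    have DF: "(?F has_vector_derivative f s z) (at s)" for s
      using has_vector_derivative_minus[OF has_vector_derivative_scaleR[OF DE D\<phi>, of s]]
      by (simp add: f_def algebra_simps)
    have fc: "isCont (\<lambda>s. f s z) s" for s
    proof -
      have c1: "isCont (\<lambda>s. g (x + s *\<^sub>R z)) s" if "g \<in> test_functions" for g :: "real^'d \<Rightarrow> complex"
        using test_functionD(1)[OF that]
        by (intro continuous_at_compose[where g = g and f = "\<lambda>s. x + s *\<^sub>R z", unfolded o_def])
          (auto intro!: continuous_intros simp: continuous_on_eq_continuous_at)
      show ?thesis unfolding f_def D_def E_def
        by (intro continuous_intros c1 \<phi> p\<phi>) auto
    qed
    \<comment> \<open>At time 0 the primitive equals \<open>- \<phi> x\<close>, and it vanishes at
      infinity because \<open>E\<close> decays while \<open>\<phi>\<close> is bounded; hence the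
      same value for every direction \<open>z\<close>.\<close>
    have "(LBINT s=0..\<infinity>. f s z) = 0 - (- \<phi> x)"
    proof (rule interval_integral_FTC_integrable[where F = ?F])
      have "integrable lborel (\<lambda>s. indicator {0<..} s *\<^sub>R f s z)"
      proof (rule Bochner_Integration.integrable_bound)
        show "integrable lborel (\<lambda>s. \<alpha> s * Z z)" using \<alpha>int by simp
        show "(\<lambda>s. indicator {0<..} s *\<^sub>R f s z) \<in> borel_measurable lborel"
          unfolding f_def D_def by measurable
        show "AE s in lborel. norm (indicator {0<..} s *\<^sub>R f s z) \<le> norm (\<alpha> s * Z z)"
          using fbound[of _ z] \<alpha>0 Z0 by (intro AE_I2) (simp add: abs_mult)
      qed
      then show "set_integrable lborel (einterval 0 \<infinity>) (\<lambda>s. f s z)"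
        by (simp add: set_integrable_def zero_ereal_def)
      have "isCont ?F 0" using DF has_vector_derivative_continuous by blast
      then have "(?F \<longlongrightarrow> - \<phi> x) (at_right 0)"
        using filterlim_at_split[of ?F "nhds (?F 0)" 0] by (simp add: isCont_def E_def)
      then show "((?F \<circ> real_of_ereal) \<longlongrightarrow> - \<phi> x) (at_right 0)"
        by (simp add: zero_ereal_def ereal_tendsto_simps)
      have "(?F \<longlongrightarrow> 0) at_top"
      proof (rule Lim_null_comparison)
        show "eventually (\<lambda>s. norm (?F s) \<le> E s * B) at_top"
          using B Epos by (intro always_eventually) (simp add: less_imp_le mult_left_mono)
        have "(E \<longlongrightarrow> 0) at_top" unfolding E_def using c by real_asymp
        then show "((\<lambda>s. E s * B) \<longlongrightarrow> 0) at_top" by (rule tendsto_mult_left_zero)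
      qed
      then show "((?F \<circ> real_of_ereal) \<longlongrightarrow> 0) (at_left \<infinity>)" by (simp add: ereal_tendsto_simps)
    qed (use DF fc in auto)
    then show ?thesis by (simp add: interval_lebesgue_integral_0_infty set_lebesgue_integral_def)
  qed
  have inner: "rayleigh c s *\<^sub>R (\<integral>z. c * \<phi> (x + s *\<^sub>R z) - lap \<phi> (x + s *\<^sub>R z) \<partial>gauss_measure)
    = (\<integral>z. indicator {0<..} s *\<^sub>R f s z \<partial>gauss_measure)" for s
  proof (cases "s > 0")
    case True
    have i1: "integrable gauss_measure (\<lambda>z. \<phi> (x + s *\<^sub>R z))"
      by (rule G.integrable_const_bound[where B = B]) (use B in auto)
    have i2: "integrable gauss_measure (\<lambda>z. lap \<phi> (x + s *\<^sub>R z))"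
      by (rule G.integrable_const_bound[where B = Bl]) (use Bl in auto)
    have i3: "integrable gauss_measure (\<lambda>z. partial i (partial i \<phi>) (x + s *\<^sub>R z))" for i
    proof -
      obtain B' where "\<forall>x. norm (partial i (partial i \<phi>) x) \<le> B'" using test_function_bounded[OF pp\<phi>] by blast
      then show ?thesis by (intro G.integrable_const_bound[where B = B']) auto
    qed
    have i4: "integrable gauss_measure (\<lambda>z. (z $ i) *\<^sub>R partial i \<phi> (x + s *\<^sub>R z))" for i
    proof (rule Bochner_Integration.integrable_bound)
      show "integrable gauss_measure (\<lambda>z :: real^'d. b i * \<bar>z $ i\<bar>)" by (intro integrable_mult_right integrable_gauss_moment)
      show "AE z in gauss_measure. norm ((z $ i) *\<^sub>R partial i \<phi> (x + s *\<^sub>R z)) \<le> norm (b i * \<bar>z $ i\<bar>)"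
      proof (intro AE_I2)
        fix z :: "real^'d"
        have "\<bar>z $ i\<bar> * norm (partial i \<phi> (x + s *\<^sub>R z)) \<le> \<bar>z $ i\<bar> * b i" using b by (intro mult_left_mono) auto
        then show "norm ((z $ i) *\<^sub>R partial i \<phi> (x + s *\<^sub>R z)) \<le> norm (b i * \<bar>z $ i\<bar>)"
          using b by (simp add: abs_mult mult.commute)
      qed
    qed measurable
    have "(\<integral>z. D s z \<partial>gauss_measure) = (\<Sum>i\<in>UNIV. (\<integral>z. (z $ i) *\<^sub>R partial i \<phi> (x + s *\<^sub>R z) \<partial>gauss_measure))"
      unfolding D_def by (rule Bochner_Integration.integral_sum) (rule i4)
    also have "\<dots> = (\<Sum>i\<in>UNIV. s *\<^sub>R (\<integral>z. partial i (partial i \<phi>) (x + s *\<^sub>R z) \<partial>gauss_measure))"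
      by (intro sum.cong refl stein_identity p\<phi> True)
    also have "\<dots> = s *\<^sub>R (\<integral>z. lap \<phi> (x + s *\<^sub>R z) \<partial>gauss_measure)"
      unfolding lap_def by (subst Bochner_Integration.integral_sum) (auto simp: i3 scaleR_sum_right)
    finally have D: "(\<integral>z. D s z \<partial>gauss_measure) = s *\<^sub>R (\<integral>z. lap \<phi> (x + s *\<^sub>R z) \<partial>gauss_measure)" .
    have iD: "integrable gauss_measure (D s)" unfolding D_def[abs_def] by (intro Bochner_Integration.integrable_sum i4)
    have "(\<integral>z. f s z \<partial>gauss_measure) = (c * s * E s) *\<^sub>R (\<integral>z. \<phi> (x + s *\<^sub>R z) \<partial>gauss_measure) - E s *\<^sub>R (\<integral>z. D s z \<partial>gauss_measure)"
      unfolding f_def using i1 iD by simp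
    also have "\<dots> = (s * E s) *\<^sub>R (\<integral>z. c * \<phi> (x + s *\<^sub>R z) - lap \<phi> (x + s *\<^sub>R z) \<partial>gauss_measure)"
      using i1 i2 unfolding D by (simp add: scaleR_conv_of_real algebra_simps)
    finally show ?thesis using True by (simp add: rayleigh_def E_def)
  qed (simp add: rayleigh_def)
  have bnd: "norm (c * \<phi> y - lap \<phi> y) \<le> c * B + Bl" for y
    using norm_triangle_ineq4[of "c * \<phi> y" "lap \<phi> y"] B Bl c mult_left_mono[of "norm (\<phi> y)" B c]
    by (smt (verit) norm_mult norm_of_real)
  have "resolvent c (\<lambda>x. c * \<phi> x - lap \<phi> x) x
    = (\<integral>s. rayleigh c s *\<^sub>R (\<integral>z. c * \<phi> (x + s *\<^sub>R z) - lap \<phi> (x + s *\<^sub>R z) \<partial>gauss_measure) \<partial>lborel)"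
    by (rule resolvent_eq[OF c _ bnd]) measurable
  \<comment> \<open>The two orders of integration see different things: for fixed s the integral
    over z produces the resolvent by Stein's identity, for fixed z the integral over s collapses to
    \<open>\<phi> x\<close>.\<close>
  also have "\<dots> = (\<integral>s. (\<integral>z. indicator {0<..} s *\<^sub>R f s z \<partial>gauss_measure) \<partial>lborel)" by (simp only: inner)
  also have "\<dots> = (\<integral>z. (\<integral>s. indicator {0<..} s *\<^sub>R f s z \<partial>lborel) \<partial>gauss_measure)"
    by (rule LG.Fubini_integral[OF fint, symmetric])
  also have "\<dots> = \<phi> x" by (simp add: ftc G.prob_space)
  finally show ?thesis .
qed

section \<open>Identification of the distributional Laplacian with the Gaussian resolvent\<close>

lemma integral_cong_AE_lebesgue:
  fixes f g :: "real^'d \<Rightarrow> complex"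
  assumes f: "f \<in> L2" and g: "AE x in lebesgue. f x = g x" and h: "h \<in> L2"
  shows "(\<integral>x. f x * h x \<partial>lebesgue) = (\<integral>x. g x * h x \<partial>lebesgue)"
proof (rule integral_cong_AE)
  have "g \<in> L2" by (rule L2_cong_AE[OF f]) (use g in auto)
  then show "(\<lambda>x. f x * h x) \<in> borel_measurable lebesgue" "(\<lambda>x. g x * h x) \<in> borel_measurable lebesgue"
    using f h by (simp_all add: borel_measurable_times[OF L2_measurable L2_measurable])
  show "AE x in lebesgue. f x * h x = g x * h x" using g by eventually_elim simp
qed

lemma lap_translate:
  assumes \<psi>: "\<psi> \<in> test_functions"
  shows "lap (\<lambda>x. \<psi> (x + y)) x = lap \<psi> (x + y)"
proof -
  have "partial i (\<lambda>x. \<psi> (x + y)) = (\<lambda>x. partial i \<psi> (x + y))" for i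
    by (rule ext, rule partial_translate) (rule test_functionD(2)[OF \<psi>])
  then show ?thesis
    unfolding lap_def by (simp add: partial_translate[OF test_functionD(2)[OF partial_test_function[OF \<psi>]]])
qed

lemma laplacian_iff_lap:
  "(f, h) \<in> laplacian \<longleftrightarrow> f \<in> L2 \<and> h \<in> L2 \<and>
    (\<forall>\<phi>\<in>test_functions. (\<integral>x. f x * lap \<phi> x \<partial>lebesgue) = (\<integral>x. h x * \<phi> x \<partial>lebesgue))"
  by (simp add: laplacian_def lap_def)

text \<open>Testing with all translates of one test function and averaging them recovers \<open>f\<close>.\<close>

lemma laplacian_imp_resolvent:
  fixes f h a :: "real^'d \<Rightarrow> complex"
  assumes fh: "(f, h) \<in> laplacian" and c: "c > 0"
    and a [measurable]: "a \<in> borel_measurable borel" and afh: "AE x in lebesgue. a x = c * f x - h x"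
  shows "AE x in lebesgue. f x = resolvent c a x"
proof -
  interpret averaging "heat_measure c" "shift :: _ \<Rightarrow> real^'d" by (rule averaging_heat[OF c])
  have f: "f \<in> L2" and h: "h \<in> L2" using fh by (auto simp: laplacian_iff_lap)
  have a2: "a \<in> L2" by (rule L2_cong_AE[OF _ afh]) (use f h in auto)
  obtain fb where fb [measurable]: "fb \<in> borel_measurable borel" and ffb: "AE x in lebesgue. f x = fb x"
    using lebesgue_borel_version[OF L2_measurable[OF f]] by blast
  have fb2: "fb \<in> L2" by (rule L2_cong_AE[OF f]) (use ffb in auto)
  have ga2: "resolvent c a \<in> L2" by (rule avg_L2(1)[OF a a2])
  have "AE x in lebesgue. fb x - resolvent c a x = 0"
  proof (rule AE_zero_if_test_functions)
    show "(\<lambda>x. fb x - resolvent c a x) \<in> L2" using fb2 ga2 by simp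
    fix \<psi> :: "real^'d \<Rightarrow> complex" assume \<psi>: "\<psi> \<in> test_functions"
    define \<Psi> where "\<Psi> x = c * \<psi> x - lap \<psi> x" for x
    have l\<psi>: "lap \<psi> \<in> test_functions" by (rule lap_test_function[OF \<psi>])
    note [measurable] = test_functionD(4)[OF \<psi>] test_functionD(4)[OF l\<psi>]
    have \<Psi>m [measurable]: "\<Psi> \<in> borel_measurable borel" unfolding \<Psi>_def by measurable
    have \<psi>2: "\<psi> \<in> L2" by (rule test_function_L2[OF \<psi>])
    have \<Psi>2: "\<Psi> \<in> L2" unfolding \<Psi>_def using \<psi>2 test_function_L2[OF l\<psi>] by simp
    have tr: "(\<integral>x. \<Psi> (x + y) * fb x \<partial>lebesgue) = (\<integral>x. \<psi> (x + y) * a x \<partial>lebesgue)" for y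
    proof -
      have t: "(\<lambda>x. \<psi> (x + y)) \<in> test_functions" by (rule test_function_translate[OF \<psi>])
      have t2: "(\<lambda>x. \<psi> (x + y)) \<in> L2" "(\<lambda>x. lap \<psi> (x + y)) \<in> L2"
        by (intro test_function_L2 test_function_translate \<psi> l\<psi>)+
      have "(\<integral>x. \<Psi> (x + y) * fb x \<partial>lebesgue) = (\<integral>x. fb x * (c * \<psi> (x + y) - lap \<psi> (x + y)) \<partial>lebesgue)"
        by (simp add: \<Psi>_def mult.commute)
      also have "\<dots> = (\<integral>x. f x * (c * \<psi> (x + y) - lap \<psi> (x + y)) \<partial>lebesgue)"
        using t2 by (intro integral_cong_AE_lebesgue[symmetric] f ffb) simp
      also have "\<dots> = (\<integral>x. f x * (c * \<psi> (x + y)) \<partial>lebesgue) - (\<integral>x. f x * lap \<psi> (x + y) \<partial>lebesgue)"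
        using t2 f by (simp add: right_diff_distrib integrable_mult_L2)
      also have "(\<integral>x. f x * lap \<psi> (x + y) \<partial>lebesgue) = (\<integral>x. h x * \<psi> (x + y) \<partial>lebesgue)"
      proof -
        have "\<forall>\<phi>\<in>test_functions. (\<integral>x. f x * lap \<phi> x \<partial>lebesgue) = (\<integral>x. h x * \<phi> x \<partial>lebesgue)"
          using fh by (simp add: laplacian_iff_lap)
        from bspec[OF this t] show ?thesis by (simp only: lap_translate[OF \<psi>])
      qed
      also have "(\<integral>x. f x * (c * \<psi> (x + y)) \<partial>lebesgue) - (\<integral>x. h x * \<psi> (x + y) \<partial>lebesgue)
        = (\<integral>x. f x * (c * \<psi> (x + y)) - h x * \<psi> (x + y) \<partial>lebesgue)"
        using t2 f h by (intro Bochner_Integration.integral_diff[symmetric] integrable_mult_L2) auto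
      also have "\<dots> = (\<integral>x. (c * f x - h x) * \<psi> (x + y) \<partial>lebesgue)" by (simp add: algebra_simps)
      also have "\<dots> = (\<integral>x. a x * \<psi> (x + y) \<partial>lebesgue)"
        using afh t2 f h by (intro integral_cong_AE_lebesgue) auto
      finally show ?thesis by (simp add: mult.commute)
    qed
    \<comment> \<open>Averaging \<open>tr\<close> over the shifts turns \<open>\<Psi>\<close> into
      its resolvent, which is \<open>\<psi>\<close> again; on the right the resolvent passes from
      \<open>\<psi>\<close> to \<open>a\<close> by symmetry.\<close>
    have "(\<integral>x. resolvent c \<Psi> x * fb x \<partial>lebesgue) = (\<integral>x. resolvent c \<psi> x * a x \<partial>lebesgue)"
      using integral_avg_mult(2)[OF \<Psi>m fb \<Psi>2 fb2] integral_avg_mult(2)[OF test_functionD(4)[OF \<psi>] a \<psi>2 a2]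
      by (simp add: tr)
    moreover have "resolvent c \<Psi> = \<psi>"
      unfolding \<Psi>_def[abs_def] by (rule ext) (rule resolvent_test_function[OF \<psi> c])
    moreover have "(\<integral>x. resolvent c \<psi> x * a x \<partial>lebesgue) = (\<integral>x. \<psi> x * resolvent c a x \<partial>lebesgue)"
      by (rule integral_avg_mult(1)) (use \<psi>2 a2 in auto)
    ultimately have "(\<integral>x. \<psi> x * fb x \<partial>lebesgue) = (\<integral>x. \<psi> x * resolvent c a x \<partial>lebesgue)" by simp
    then have "(\<integral>x. \<psi> x * (fb x - resolvent c a x) \<partial>lebesgue) = 0"
      using fb2 ga2 \<psi>2 by (simp add: right_diff_distrib integrable_mult_L2)
    then show "(\<integral>x. (fb x - resolvent c a x) * \<psi> x \<partial>lebesgue) = 0"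
      by (simp add: mult.commute)
  qed
  with ffb show ?thesis by eventually_elim simp
qed

text \<open>In the pairing with \<open>c \<phi> - lap \<phi>\<close> the resolvent is moved onto
  this test function, where it gives back \<open>\<phi>\<close>.\<close>

lemma resolvent_in_laplacian:
  fixes a :: "real^'d \<Rightarrow> complex"
  assumes c: "c > 0" and a [measurable]: "a \<in> borel_measurable borel" and a2: "a \<in> L2"
  shows "(resolvent c a, \<lambda>x. c * resolvent c a x - a x) \<in> laplacian"
proof -
  interpret averaging "heat_measure c" "shift :: _ \<Rightarrow> real^'d" by (rule averaging_heat[OF c])
  have ga2: "resolvent c a \<in> L2" by (rule avg_L2(1)[OF a a2])
  show ?thesis
    unfolding laplacian_iff_lap
  proof (intro conjI ballI)
    show "resolvent c a \<in> L2" "(\<lambda>x. c * resolvent c a x - a x) \<in> L2" using ga2 a2 by auto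
    fix \<phi> :: "real^'d \<Rightarrow> complex" assume \<phi>: "\<phi> \<in> test_functions"
    have l\<phi>: "lap \<phi> \<in> test_functions" by (rule lap_test_function[OF \<phi>])
    note [measurable] = test_functionD(4)[OF \<phi>] test_functionD(4)[OF l\<phi>]
    have 2: "\<phi> \<in> L2" "lap \<phi> \<in> L2" by (intro test_function_L2 \<phi> l\<phi>)+
    have "(\<integral>x. resolvent c a x * (c * \<phi> x - lap \<phi> x) \<partial>lebesgue) = (\<integral>x. a x * resolvent c (\<lambda>x. c * \<phi> x - lap \<phi> x) x \<partial>lebesgue)"
      by (rule integral_avg_mult(1)) (use 2 a2 in auto)
    also have "\<dots> = (\<integral>x. a x * \<phi> x \<partial>lebesgue)" by (simp add: resolvent_test_function[OF \<phi> c])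
    also have "(\<integral>x. resolvent c a x * (c * \<phi> x - lap \<phi> x) \<partial>lebesgue)
      = c * (\<integral>x. resolvent c a x * \<phi> x \<partial>lebesgue) - (\<integral>x. resolvent c a x * lap \<phi> x \<partial>lebesgue)"
      using 2 ga2 by (simp add: right_diff_distrib integrable_mult_L2 mult.left_commute)
    finally have e: "c * (\<integral>x. resolvent c a x * \<phi> x \<partial>lebesgue) - (\<integral>x. resolvent c a x * lap \<phi> x \<partial>lebesgue)
      = (\<integral>x. a x * \<phi> x \<partial>lebesgue)" .
    have "(\<integral>x. (c * resolvent c a x - a x) * \<phi> x \<partial>lebesgue) = c * (\<integral>x. resolvent c a x * \<phi> x \<partial>lebesgue) - (\<integral>x. a x * \<phi> x \<partial>lebesgue)"
      using 2 ga2 a2 by (simp add: left_diff_distrib integrable_mult_L2 mult.assoc)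
    then show "(\<integral>x. resolvent c a x * lap \<phi> x \<partial>lebesgue) = (\<integral>x. (c * resolvent c a x - a x) * \<phi> x \<partial>lebesgue)"
      by (simp add: e[symmetric])
  qed
qed

lemma borel_measurable_cnj: "f \<in> borel_measurable M \<Longrightarrow> (\<lambda>x. cnj (f x)) \<in> borel_measurable M"
  by (rule measurable_compose[OF _ borel_measurable_continuous_onI]) (auto intro!: continuous_intros)

lemma L2_cnj: "f \<in> L2 \<Longrightarrow> (\<lambda>x. cnj (f x)) \<in> L2"
  unfolding L2_def by (simp add: borel_measurable_cnj)

text \<open>A chosen Borel representative, so that the pointwise average can be applied to classes.
  By \<open>avg_cong_AE\<close> the class of the result does not depend on the choice.\<close>

definition brep :: "'d::finite l2 \<Rightarrow> real^'d \<Rightarrow> complex" where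
  "brep A = (SOME a. a \<in> L2 \<and> a \<in> borel_measurable borel \<and> A = mk_l2 a)"

lemma brep: "brep A \<in> L2" "brep A \<in> borel_measurable borel" "mk_l2 (brep A) = A"
proof -
  have "\<exists>a. a \<in> L2 \<and> a \<in> borel_measurable borel \<and> A = mk_l2 a" by (rule mk_l2_exhaust[of A]) blast
  from someI_ex[OF this] show "brep A \<in> L2" "brep A \<in> borel_measurable borel" "mk_l2 (brep A) = A"
    unfolding brep_def[symmetric] by simp_all
qed

definition gop :: "real \<Rightarrow> 'd::finite l2 \<Rightarrow> ('d::finite) l2" where
  "gop c A = mk_l2 (resolvent c (brep A))"

context
  fixes c :: real
  assumes c: "c > 0"
begin

interpretation averaging "heat_measure c" "shift :: _ \<Rightarrow> real^'d" by (rule averaging_heat[OF c])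

lemma resolvent_L2: "a \<in> borel_measurable borel \<Longrightarrow> a \<in> L2 \<Longrightarrow> resolvent c a \<in> (L2 :: (real^'d \<Rightarrow> _) set)"
  by (rule avg_L2(1))

lemma gop_mk:
  fixes a :: "real^'d \<Rightarrow> complex"
  assumes a: "a \<in> borel_measurable borel" and a2: "a \<in> L2"
  shows "gop c (mk_l2 a) = mk_l2 (resolvent c a)"
proof -
  have "mk_l2 (brep (mk_l2 a)) = mk_l2 a" by (rule brep)
  then have "AE x in lebesgue. brep (mk_l2 a) x = a x" using mk_l2_eq_iff[OF brep(1) a2] by blast
  from avg_cong_AE[OF brep(2) a this] show ?thesis
    unfolding gop_def by (subst mk_l2_eq_iff) (simp_all add: resolvent_L2 brep a a2)
qed

lemma resolvent_brep_add:
  fixes A B :: "('d::finite) l2"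
  shows "AE x in lebesgue. resolvent c (brep (A + B)) x = resolvent c (brep A) x + resolvent c (brep B) x"
proof -
  have "mk_l2 (brep (A + B)) = mk_l2 (brep A) + mk_l2 (brep B)" by (simp only: brep(3))
  also have "\<dots> = mk_l2 (\<lambda>x. brep A x + brep B x)" by (rule mk_l2_add; rule brep)
  finally have ae: "AE x in lebesgue. brep (A + B) x = brep A x + brep B x"
    by (subst (asm) mk_l2_eq_iff) (simp_all add: brep)
  have "AE x in lebesgue. resolvent c (brep (A + B)) x = resolvent c (\<lambda>x. brep A x + brep B x) x"
    using brep(2)[of A] brep(2)[of B] by (intro avg_cong_AE ae brep borel_measurable_add)
  moreover have "AE x in lebesgue. resolvent c (\<lambda>x. brep A x + brep B x) x = resolvent c (brep A) x + resolvent c (brep B) x"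
    by (intro avg_add_AE brep)
  ultimately show ?thesis by eventually_elim simp
qed

lemma resolvent_brep_scaleR:
  fixes A :: "('d::finite) l2"
  shows "AE x in lebesgue. resolvent c (brep (r *\<^sub>R A)) x = r *\<^sub>R resolvent c (brep A) x"
proof -
  have "mk_l2 (brep (r *\<^sub>R A)) = r *\<^sub>R mk_l2 (brep A)" by (simp only: brep(3))
  also have "\<dots> = mk_l2 (\<lambda>x. r *\<^sub>R brep A x)" by (rule mk_l2_scaleR; rule brep)
  finally have ae: "AE x in lebesgue. brep (r *\<^sub>R A) x = r *\<^sub>R brep A x"
    by (subst (asm) mk_l2_eq_iff) (simp_all add: brep)
  have "AE x in lebesgue. resolvent c (brep (r *\<^sub>R A)) x = resolvent c (\<lambda>x. r *\<^sub>R brep A x) x"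
    using brep(2)[of A] by (intro avg_cong_AE ae brep borel_measurable_scaleR borel_measurable_const)
  then show ?thesis by (simp add: avg_scaleR)
qed

lemma linear_gop: "linear (gop c :: ('d::finite) l2 \<Rightarrow> _)"
proof (rule linearI)
  fix A B :: "('d::finite) l2"
  show "gop c (A + B) = gop c A + gop c B"
    unfolding gop_def using resolvent_brep_add[of A B]
    by (subst mk_l2_add, (intro resolvent_L2 brep)+, subst mk_l2_eq_iff) (simp_all add: resolvent_L2 brep)
next
  fix r and A :: "('d::finite) l2"
  show "gop c (r *\<^sub>R A) = r *\<^sub>R gop c A"
    unfolding gop_def using resolvent_brep_scaleR[of r A]
    by (subst mk_l2_scaleR, (intro resolvent_L2 brep)+, subst mk_l2_eq_iff) (simp_all add: resolvent_L2 brep)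
qed

lemma norm_gop_le: "norm (gop c (A :: ('d::finite) l2)) \<le> norm A / c"
proof -
  have "norm (gop c A) \<le> measure (heat_measure c :: (real \<times> (real^'d)) measure) (space (heat_measure c)) * L2_norm (brep A)"
    unfolding gop_def using avg_L2[OF brep(2,1), of A] by (simp add: norm_mk_l2)
  also have "L2_norm (brep A) = norm A" using norm_mk_l2[OF brep(1)[of A]] by (simp add: brep(3))
  finally show ?thesis by (simp add: measure_heat[OF c])
qed

lemma bounded_linear_gop: "bounded_linear (gop c :: ('d::finite) l2 \<Rightarrow> _)"
  using norm_gop_le linear_gop
  by (intro bounded_linear_intro[where K = "1 / c"]) (auto simp: linear_add[OF linear_gop] linear_scale[OF linear_gop] field_simps)

text \<open>The symmetry in \<open>integral_avg_mult\<close> is bilinear, whereas the inner product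
  conjugates one argument. The average commutes with conjugation because the underlying measure is
  real.\<close>

lemma gop_symmetric: "gop c A \<bullet> B = A \<bullet> gop c (B :: ('d::finite) l2)"
proof -
  let ?a = "brep A" and ?b = "brep B"
  have cb: "(\<lambda>x. cnj (?b x)) \<in> borel_measurable borel" by (rule borel_measurable_cnj[OF brep(2)])
  have cb2: "(\<lambda>x. cnj (?b x)) \<in> L2" by (rule L2_cnj[OF brep(1)])
  have inner: "(\<integral>x. u x \<bullet> v x \<partial>lebesgue) = Re (\<integral>x. u x * cnj (v x) \<partial>lebesgue)" if "u \<in> L2" "v \<in> L2"
    for u v :: "real^'d \<Rightarrow> complex"
  proof -
    have "(\<lambda>x. cnj (v x)) \<in> L2" by (rule L2_cnj[OF that(2)])
    from integrable_mult_L2[OF that(1) this] show ?thesis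
      by (simp add: integral_Re[symmetric] inner_complex_def)
  qed
  have "gop c A \<bullet> B = mk_l2 (resolvent c ?a) \<bullet> mk_l2 ?b" by (simp add: gop_def brep(3))
  also have "\<dots> = Re (\<integral>x. resolvent c ?a x * cnj (?b x) \<partial>lebesgue)"
    by (simp only: inner_mk_l2[OF resolvent_L2[OF brep(2) brep(1)] brep(1)] inner[OF resolvent_L2[OF brep(2) brep(1)] brep(1)])
  also have "(\<integral>x. resolvent c ?a x * cnj (?b x) \<partial>lebesgue) = (\<integral>x. ?a x * cnj (resolvent c ?b x) \<partial>lebesgue)"
    using integral_avg_mult(1)[OF brep(2) cb brep(1) cb2, of A] by (simp add: avg_cnj)
  also have "Re \<dots> = mk_l2 ?a \<bullet> mk_l2 (resolvent c ?b)"
    by (simp only: inner_mk_l2[OF brep(1) resolvent_L2[OF brep(2) brep(1)]] inner[OF brep(1) resolvent_L2[OF brep(2) brep(1)]])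
  also have "\<dots> = A \<bullet> gop c B" by (simp add: gop_def brep(3))
  finally show ?thesis .
qed

text \<open>Turns the distributional condition into one equation in the Hilbert space, valid for
  each positive \<open>c\<close>. One direction is \<open>laplacian_imp_resolvent\<close>, the other
  \<open>resolvent_in_laplacian\<close> with both components adjusted on null sets.\<close>

lemma laplacian_iff_gop:
  fixes f h :: "real^'d \<Rightarrow> complex"
  assumes f: "f \<in> L2" and h: "h \<in> L2"
  shows "(f, h) \<in> laplacian \<longleftrightarrow> mk_l2 f = gop c (c *\<^sub>R mk_l2 f - mk_l2 h)"
proof -
  define A where "A = c *\<^sub>R mk_l2 f - mk_l2 h"
  have "mk_l2 (brep A) = mk_l2 (\<lambda>x. c * f x - h x)"
    using f h by (simp add: brep(3) A_def mk_l2_scaleR mk_l2_diff scaleR_conv_of_real)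
  then have ae: "AE x in lebesgue. brep A x = c * f x - h x"
    using f h by (subst (asm) mk_l2_eq_iff) (simp_all add: brep)
  have r2: "resolvent c (brep A) \<in> L2" by (intro resolvent_L2 brep)
  show ?thesis
  proof
    assume "(f, h) \<in> laplacian"
    from laplacian_imp_resolvent[OF this c brep(2) ae] show "mk_l2 f = gop c (c *\<^sub>R mk_l2 f - mk_l2 h)"
      unfolding A_def[symmetric] gop_def using f r2 by (simp add: mk_l2_eq_iff)
  next
    assume "mk_l2 f = gop c (c *\<^sub>R mk_l2 f - mk_l2 h)"
    then have fr: "AE x in lebesgue. resolvent c (brep A) x = f x"
      unfolding A_def[symmetric] gop_def using f r2 by (simp add: mk_l2_eq_iff eq_commute)
    have "(resolvent c (brep A), \<lambda>x. c * resolvent c (brep A) x - brep A x) \<in> laplacian"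
      by (intro resolvent_in_laplacian c brep)
    then have L: "(\<integral>x. resolvent c (brep A) x * lap \<phi> x \<partial>lebesgue) = (\<integral>x. (c * resolvent c (brep A) x - brep A x) * \<phi> x \<partial>lebesgue)"
      if "\<phi> \<in> test_functions" for \<phi> using that by (simp add: laplacian_iff_lap)
    have hr: "AE x in lebesgue. c * resolvent c (brep A) x - brep A x = h x"
      using fr ae by eventually_elim simp
    show "(f, h) \<in> laplacian"
      unfolding laplacian_iff_lap
    proof (intro conjI ballI f h)
      fix \<phi> :: "real^'d \<Rightarrow> complex" assume \<phi>: "\<phi> \<in> test_functions"
      have "(\<integral>x. f x * lap \<phi> x \<partial>lebesgue) = (\<integral>x. resolvent c (brep A) x * lap \<phi> x \<partial>lebesgue)"
        by (rule integral_cong_AE_lebesgue[OF r2 fr test_function_L2[OF lap_test_function[OF \<phi>]], symmetric])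
      also have "\<dots> = (\<integral>x. h x * \<phi> x \<partial>lebesgue)"
        unfolding L[OF \<phi>]
        by (rule integral_cong_AE_lebesgue[OF _ hr test_function_L2[OF \<phi>]]) (use r2 brep(1)[of A] in simp)
      finally show "(\<integral>x. f x * lap \<phi> x \<partial>lebesgue) = (\<integral>x. h x * \<phi> x \<partial>lebesgue)" .
    qed
  qed
qed

end

text \<open>The bound \<open>c \<parallel>f\<parallel> \<le> \<parallel>c f - \<Delta> f\<parallel>\<close> for all \<open>c\<close> forces \<open>\<langle>f, \<Delta> f\<rangle> \<le> 0\<close>.\<close>

lemma laplacian_nonpos:
  fixes f h :: "real^'d \<Rightarrow> complex"
  assumes fh: "(f, h) \<in> laplacian"
  shows "mk_l2 f \<bullet> mk_l2 h \<le> 0"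
proof -
  let ?F = "mk_l2 f" and ?H = "mk_l2 h"
  have f: "f \<in> L2" and h: "h \<in> L2" using fh by (auto simp: laplacian_iff_lap)
  have "2 * c * (?F \<bullet> ?H) \<le> (norm ?H)\<^sup>2" if c: "c > 0" for c
  proof -
    have "norm ?F \<le> norm (c *\<^sub>R ?F - ?H) / c"
      using norm_gop_le[OF c, of "c *\<^sub>R ?F - ?H"] laplacian_iff_gop[OF c f h] fh by simp
    then have "(c * norm ?F)\<^sup>2 \<le> (norm (c *\<^sub>R ?F - ?H))\<^sup>2"
      using c by (intro power_mono) (auto simp: field_simps)
    also have "\<dots> = (c * norm ?F)\<^sup>2 - 2 * c * (?F \<bullet> ?H) + (norm ?H)\<^sup>2"
      unfolding power_mult_distrib power2_norm_eq_inner
      by (simp add: inner_diff_left inner_diff_right inner_commute power2_eq_square)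
    finally show ?thesis by simp
  qed
  then have b: "?F \<bullet> ?H \<le> (norm ?H)\<^sup>2 / 2 * (1 / c)" if "c > 0" for c using that by (simp add: field_simps)
  have "((\<lambda>c. (norm ?H)\<^sup>2 / 2 * (1 / c)) \<longlongrightarrow> (norm ?H)\<^sup>2 / 2 * 0) at_top"
    by (intro tendsto_mult tendsto_const) real_asymp
  moreover have "eventually (\<lambda>c. ?F \<bullet> ?H \<le> (norm ?H)\<^sup>2 / 2 * (1 / c)) at_top"
    using eventually_gt_at_top[of "0::real"] by eventually_elim (rule b)
  ultimately have "?F \<bullet> ?H \<le> (norm ?H)\<^sup>2 / 2 * 0" by (rule tendsto_lowerbound) simp
  then show ?thesis by simp
qed

section \<open>The bottom of the spectrum\<close>

text \<open>The potential times the resolvent, as an operator. It is meaningful only where the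
  product is square integrable, which \<open>vop_L2\<close> gives for large parameters.\<close>

definition vop :: "(real^('d::finite) \<Rightarrow> real) \<Rightarrow> real \<Rightarrow> 'd l2 \<Rightarrow> 'd l2" where
  "vop V c A = mk_l2 (\<lambda>x. complex_of_real (V x) * resolvent c (brep A) x)"

definition schroedinger_graph :: "(real^('d::finite) \<Rightarrow> real) \<Rightarrow> ('d l2 \<times> 'd l2) set" where
  "schroedinger_graph V = (\<lambda>(f, g). (mk_l2 f, mk_l2 g)) ` schroedinger V"

text \<open>A real infimum, with a value that means something only for a nonempty set that is
  bounded below; \<open>rayleigh_set_nonempty\<close> and \<open>rayleigh_set_bdd\<close> supply
  both.\<close>

definition rayleigh_inf :: "(real^('d::finite) \<Rightarrow> real) \<Rightarrow> real" where
  "rayleigh_inf V = Inf {F \<bullet> G / (norm F)\<^sup>2 | F G. (F, G) \<in> schroedinger_graph V \<and> F \<noteq> 0}"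

text \<open>The constants depend on the potential only through \<open>K\<close> and the lower bound,
  so one choice can serve all realisations. By \<open>small\<close> the potential times any
  resolvent with parameter at least \<open>c\<close> has norm at most 1/2; \<open>B\<close> keeps
  the Rayleigh quotients bounded below.\<close>

locale form_small =
  fixes V :: "real^'d \<Rightarrow> real" and p K c \<eta> B :: real
  assumes V [measurable]: "V \<in> borel_measurable borel"
    and p: "p > 2" and K: "K \<ge> 0" and cell: "cell_bound p K V"
    and c: "c > 0" and \<eta>: "\<eta> \<ge> 0"
    and I: "\<And>c'. c' \<ge> c \<Longrightarrow>
      (\<integral>\<^sup>+s. ennreal (rayleigh c' s) * ennreal (theta (real CARD('d) / p) (real CARD('d) / 4) s) \<partial>lborel) \<le> ennreal \<eta>"
    and small: "cell_const TYPE('d) K * \<eta>\<^sup>2 \<le> 1 / 4"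
    and lower: "AE x in lebesgue. - B \<le> V x"
begin

lemma vop_L2:
  assumes "c' \<ge> c"
  shows "(\<lambda>x. complex_of_real (V x) * resolvent c' (brep A) x) \<in> L2"
  by (rule potential_resolvent_bound(1)[OF V p K cell _ I[OF assms] \<eta> brep(2) brep(1)]) (use assms c in simp)

lemma norm_vop_le:
  assumes c': "c' \<ge> c"
  shows "norm (vop V c' A) \<le> 1 / 2 * norm A"
proof -
  have "(norm (vop V c' A))\<^sup>2 \<le> cell_const TYPE('d) K * \<eta>\<^sup>2 * (L2_norm (brep A))\<^sup>2"
    unfolding vop_def norm_mk_l2[OF vop_L2[OF c']]
    by (rule potential_resolvent_bound(2)[OF V p K cell _ I[OF c'] \<eta> brep(2) brep(1)]) (use c' c in simp)
  also have "L2_norm (brep A) = norm A" using norm_mk_l2[OF brep(1)[of A]] by (simp add: brep(3))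
  also have "cell_const TYPE('d) K * \<eta>\<^sup>2 * (norm A)\<^sup>2 \<le> 1 / 4 * (norm A)\<^sup>2"
    by (intro mult_right_mono small) simp
  also have "\<dots> = (1 / 2 * norm A)\<^sup>2" by (simp add: power2_eq_square)
  finally show ?thesis by (rule power2_le_imp_le) simp
qed

lemma linear_vop:
  assumes c': "c' \<ge> c"
  shows "linear (vop V c')"
proof (rule linearI)
  have c'0: "c' > 0" using c' c by simp
  fix A B :: "'d l2"
  have "AE x in lebesgue. complex_of_real (V x) * resolvent c' (brep (A + B)) x
    = complex_of_real (V x) * resolvent c' (brep A) x + complex_of_real (V x) * resolvent c' (brep B) x"
    using resolvent_brep_add[OF c'0, of A B] by eventually_elim (simp add: distrib_left)
  then show "vop V c' (A + B) = vop V c' A + vop V c' B"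
    unfolding vop_def using vop_L2[OF c', of A] vop_L2[OF c', of B] vop_L2[OF c', of "A + B"]
    by (simp add: mk_l2_add mk_l2_eq_iff)
  fix r
  have "AE x in lebesgue. complex_of_real (V x) * resolvent c' (brep (r *\<^sub>R A)) x
    = r *\<^sub>R (complex_of_real (V x) * resolvent c' (brep A) x)"
    using resolvent_brep_scaleR[OF c'0, of r A] by eventually_elim simp
  then show "vop V c' (r *\<^sub>R A) = r *\<^sub>R vop V c' A"
    unfolding vop_def using vop_L2[OF c', of A] vop_L2[OF c', of "r *\<^sub>R A"]
    by (simp only: mk_l2_scaleR mk_l2_eq_iff L2_scaleR)
qed

text \<open>With f the resolvent of A the Laplacian of f is c' f - A, so - \<Delta> f + V f is A -
  c' f + V f. The domain is thus the range of the resolvent whatever the potential, and the same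
  graph is described by every admissible c'.\<close>

lemma graph_eq:
  assumes c': "c' \<ge> c"
  shows "schroedinger_graph V = range (\<lambda>A. (gop c' A, A - c' *\<^sub>R gop c' A + vop V c' A))"
proof (intro subset_antisym subsetI)
  have c'0: "c' > 0" using c' c by simp
  fix P assume "P \<in> schroedinger_graph V"
  then obtain f g where P: "P = (mk_l2 f, mk_l2 g)" and fg: "(f, g) \<in> schroedinger V"
    unfolding schroedinger_graph_def by auto
  then obtain h where f: "f \<in> L2" and g: "g \<in> L2" and fh: "(f, h) \<in> laplacian"
    and gh: "AE x in lebesgue. g x = - h x + complex_of_real (V x) * f x"
    unfolding schroedinger_def by auto
  have h: "h \<in> L2" using fh by (simp add: laplacian_iff_lap)
  define A where "A = c' *\<^sub>R mk_l2 f - mk_l2 h"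
  have fA: "mk_l2 f = gop c' A" using laplacian_iff_gop[OF c'0 f h] fh by (simp add: A_def)
  then have fr: "AE x in lebesgue. f x = resolvent c' (brep A) x"
    using mk_l2_eq_iff[OF f resolvent_L2[OF c'0 brep(2) brep(1)], of A] by (simp add: gop_def)
  have "AE x in lebesgue. g x = - h x + complex_of_real (V x) * resolvent c' (brep A) x"
    using gh fr by eventually_elim simp
  then have "mk_l2 g = mk_l2 (\<lambda>x. - h x + complex_of_real (V x) * resolvent c' (brep A) x)"
    using g h vop_L2[OF c', of A] by (subst mk_l2_eq_iff) auto
  also have "\<dots> = mk_l2 (\<lambda>x. - h x) + vop V c' A"
    unfolding vop_def by (rule mk_l2_add[symmetric]) (use h vop_L2[OF c'] in auto)
  also have "mk_l2 (\<lambda>x. - h x) = - mk_l2 h" using mk_l2_scaleR[OF h, of "- 1"] by simp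
  also have "- mk_l2 h = A - c' *\<^sub>R gop c' A" unfolding fA[symmetric] by (simp add: A_def)
  finally show "P \<in> range (\<lambda>A. (gop c' A, A - c' *\<^sub>R gop c' A + vop V c' A))" unfolding P fA by blast
next
  have c'0: "c' > 0" using c' c by simp
  fix P assume "P \<in> range (\<lambda>A. (gop c' A, A - c' *\<^sub>R gop c' A + vop V c' A))"
  then obtain A where P: "P = (gop c' A, A - c' *\<^sub>R gop c' A + vop V c' A)" by blast
  let ?f = "resolvent c' (brep A)"
  let ?h = "\<lambda>x. c' * ?f x - brep A x"
  let ?g = "\<lambda>x. - ?h x + complex_of_real (V x) * ?f x"
  have f2: "?f \<in> L2" by (rule resolvent_L2[OF c'0 brep(2) brep(1)])
  have h2: "?h \<in> L2" using f2 brep(1)[of A] by simp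
  have g2: "?g \<in> L2" using h2 vop_L2[OF c', of A] by (intro L2_add L2_uminus)
  have "(?f, ?g) \<in> schroedinger V"
    unfolding schroedinger_def using f2 g2 resolvent_in_laplacian[OF c'0 brep(2) brep(1), of A] by auto
  moreover have "mk_l2 ?g = A - c' *\<^sub>R gop c' A + vop V c' A"
  proof -
    have "A - c' *\<^sub>R gop c' A + vop V c' A = mk_l2 (brep A) - c' *\<^sub>R gop c' A + vop V c' A" by (simp only: brep(3))
    also have "\<dots> = mk_l2 (\<lambda>x. brep A x - c' *\<^sub>R ?f x + complex_of_real (V x) * ?f x)"
      unfolding gop_def vop_def mk_l2_scaleR[OF f2]
      by (subst mk_l2_diff, rule brep(1), rule L2_scaleR[OF f2], rule mk_l2_add,
        rule L2_diff[OF brep(1) L2_scaleR[OF f2]], rule vop_L2[OF c'])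
    finally show ?thesis by (simp add: scaleR_conv_of_real)
  qed
  ultimately show "P \<in> schroedinger_graph V"
    unfolding P schroedinger_graph_def gop_def by (intro image_eqI[of _ _ "(?f, ?g)"]) auto
qed

text \<open>The quadratic form of the operator at \<open>gop c A\<close>. As a function of
  \<open>A\<close> instead of the trial function it is continuous for the norm of the Hilbert space,
  and different potentials can be compared at the same \<open>A\<close>.\<close>

definition quad :: "'d l2 \<Rightarrow> real" where
  "quad A = gop c A \<bullet> (A - c *\<^sub>R gop c A + vop V c A)"

lemma gop_inner_vop:
  assumes c': "c' \<ge> c"
  shows "gop c' A \<bullet> vop V c' A' = (\<integral>x. V x * (resolvent c' (brep A) x \<bullet> resolvent c' (brep A') x) \<partial>lebesgue)"
proof -
  have c'0: "c' > 0" using c' c by simp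
  have "gop c' A \<bullet> vop V c' A' = (\<integral>x. resolvent c' (brep A) x \<bullet> (complex_of_real (V x) * resolvent c' (brep A') x) \<partial>lebesgue)"
    unfolding gop_def vop_def by (rule inner_mk_l2[OF resolvent_L2[OF c'0 brep(2) brep(1)] vop_L2[OF c']])
  also have "\<dots> = (\<integral>x. V x * (resolvent c' (brep A) x \<bullet> resolvent c' (brep A') x) \<partial>lebesgue)"
    by (simp add: scaleR_conv_of_real[symmetric])
  finally show ?thesis .
qed

text \<open>The kinetic part is nonnegative by \<open>laplacian_nonpos\<close>, and the potential
  part is bounded pointwise.\<close>

lemma graph_lower:
  assumes "(F, G) \<in> schroedinger_graph V"
  shows "- B * (norm F)\<^sup>2 \<le> F \<bullet> G"
proof -
  obtain A where F: "F = gop c A" and G: "G = A - c *\<^sub>R gop c A + vop V c A"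
    using assms unfolding graph_eq[OF order_refl] by blast
  let ?f = "resolvent c (brep A)"
  have f2: "?f \<in> L2" by (rule resolvent_L2[OF c brep(2) brep(1)])
  have "mk_l2 ?f \<bullet> mk_l2 (\<lambda>x. c * ?f x - brep A x) \<le> 0"
    by (rule laplacian_nonpos[OF resolvent_in_laplacian[OF c brep(2) brep(1)]])
  also have "mk_l2 (\<lambda>x. c * ?f x - brep A x) = c *\<^sub>R gop c A - A"
  proof -
    have "c *\<^sub>R gop c A - A = c *\<^sub>R mk_l2 ?f - mk_l2 (brep A)" by (simp only: brep(3) gop_def)
    also have "\<dots> = mk_l2 (\<lambda>x. c * ?f x - brep A x)"
      unfolding mk_l2_scaleR[OF f2] by (subst mk_l2_diff[OF L2_scaleR[OF f2] brep(1)]) (simp add: scaleR_conv_of_real)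
    finally show ?thesis by simp
  qed
  finally have kin: "0 \<le> F \<bullet> (A - c *\<^sub>R gop c A)"
    unfolding F gop_def[symmetric] by (simp add: inner_diff_right)
  have "- B * (norm F)\<^sup>2 \<le> gop c A \<bullet> vop V c A"
  proof -
    have "- B * (norm F)\<^sup>2 = (\<integral>x. - B * (norm (?f x))\<^sup>2 \<partial>lebesgue)"
      unfolding F gop_def by (simp add: norm_mk_l2[OF f2] L2_norm_def)
    also have "\<dots> \<le> (\<integral>x. V x * (?f x \<bullet> ?f x) \<partial>lebesgue)"
    proof (rule integral_mono_AE)
      show "integrable lebesgue (\<lambda>x. - B * (norm (?f x))\<^sup>2)" using f2 by (simp add: L2_def)
      have "integrable lebesgue (\<lambda>x. ?f x \<bullet> (complex_of_real (V x) * ?f x))"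
        by (rule integrable_inner_L2[OF f2 vop_L2[OF order_refl]])
      then show "integrable lebesgue (\<lambda>x. V x * (?f x \<bullet> ?f x))" by (simp add: scaleR_conv_of_real[symmetric])
      show "AE x in lebesgue. - B * (norm (?f x))\<^sup>2 \<le> V x * (?f x \<bullet> ?f x)"
        using lower
      proof eventually_elim
        case (elim x)
        from mult_right_mono[OF this inner_ge_zero[of "?f x"]] show ?case by (simp add: power2_norm_eq_inner)
      qed
    qed
    finally show ?thesis by (simp add: gop_inner_vop)
  qed
  with kin show ?thesis unfolding F G by (simp add: inner_add_right)
qed

text \<open>Every test function is a resolvent. If all resolvents were zero, all test functions
  would vanish almost everywhere, and then the indicator of a unit cube would be orthogonal to all
  of them and hence zero.\<close>

lemma ex_gop_nonzero: "\<exists>A :: 'd l2. gop c A \<noteq> 0"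
proof (rule ccontr)
  assume "\<not> ?thesis"
  then have 0: "gop c A = 0" for A :: "'d l2" by blast
  have "AE x in lebesgue. (indicator (box 0 (\<chi> i. 1) :: (real^'d) set) x :: complex) = 0"
  proof (rule AE_zero_if_test_functions[OF indicator_box_L2])
    fix \<psi> :: "real^'d \<Rightarrow> complex" assume \<psi>: "\<psi> \<in> test_functions"
    let ?\<Psi> = "\<lambda>x. c * \<psi> x - lap \<psi> x"
    have l\<psi>: "lap \<psi> \<in> test_functions" by (rule lap_test_function[OF \<psi>])
    have m: "?\<Psi> \<in> borel_measurable borel"
      using test_functionD(4)[OF \<psi>] test_functionD(4)[OF l\<psi>] by measurable
    have "?\<Psi> \<in> L2" using test_function_L2[OF \<psi>] test_function_L2[OF l\<psi>] by simp
    from gop_mk[OF c m this] have "mk_l2 (resolvent c ?\<Psi>) = 0" using 0 by simp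
    then have "mk_l2 \<psi> = mk_l2 (\<lambda>x. 0)" by (simp add: resolvent_test_function[OF \<psi> c, abs_def] mk_l2_zero)
    then have "AE x in lebesgue. \<psi> x = 0" using test_function_L2[OF \<psi>] by (simp add: mk_l2_eq_iff)
    then have "AE x in lebesgue. indicator (box 0 (\<chi> i. 1)) x * \<psi> x = 0" by eventually_elim simp
    then show "(\<integral>x. indicator (box 0 (\<chi> i. 1)) x * \<psi> x \<partial>lebesgue) = 0" by (rule integral_eq_zero_AE)
  qed
  then have "AE x in lborel. x \<notin> (box 0 (\<chi> i. 1) :: (real^'d) set)"
    by (simp add: AE_completion_iff indicator_eq_0_iff)
  then have "emeasure lborel (box 0 (\<chi> i. 1) :: (real^'d) set) = 0"
    by (subst (asm) AE_iff_null_sets[symmetric]) (auto simp: null_sets_def)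
  moreover have "emeasure lborel (box 0 (\<chi> i. 1) :: (real^'d) set) = 1"
    by (subst emeasure_lborel_box) (auto simp: Basis_vec_def inner_axis intro!: prod.neutral)
  ultimately show False by simp
qed

lemma rayleigh_set_nonempty: "{F \<bullet> G / (norm F)\<^sup>2 | F G. (F, G) \<in> schroedinger_graph V \<and> F \<noteq> 0} \<noteq> {}"
  using ex_gop_nonzero unfolding graph_eq[OF order_refl] by blast

lemma rayleigh_set_bdd: "bdd_below {F \<bullet> G / (norm F)\<^sup>2 | F G. (F, G) \<in> schroedinger_graph V \<and> F \<noteq> 0}"
proof (rule bdd_belowI[of _ "- B"])
  fix t assume "t \<in> {F \<bullet> G / (norm F)\<^sup>2 | F G. (F, G) \<in> schroedinger_graph V \<and> F \<noteq> 0}"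
  then obtain F G where FG: "(F, G) \<in> schroedinger_graph V" "F \<noteq> 0" "t = F \<bullet> G / (norm F)\<^sup>2" by blast
  then show "- B \<le> t" using graph_lower[OF FG(1)] by (simp add: pos_le_divide_eq)
qed

lemma semibounded: "semibounded (schroedinger_graph V) (rayleigh_inf V) c"
proof
  let ?L = "\<lambda>A. (gop c A, A - c *\<^sub>R gop c A + vop V c A)"
  have lg: "linear (gop c :: 'd l2 \<Rightarrow> _)" by (rule linear_gop[OF c])
  have lv: "linear (vop V c)" by (rule linear_vop) simp
  have "linear ?L"
    by (rule linearI) (simp_all add: linear_add[OF lg] linear_add[OF lv] linear_scale[OF lg] linear_scale[OF lv] algebra_simps)
  then show "subspace (schroedinger_graph V)"
    unfolding graph_eq[OF order_refl] by (intro linear_subspace_image subspace_UNIV)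
next
  fix f g f' g' assume "(f, g) \<in> schroedinger_graph V" "(f', g') \<in> schroedinger_graph V"
  then obtain A A' where "f = gop c A" "g = A - c *\<^sub>R gop c A + vop V c A"
    "f' = gop c A'" "g' = A' - c *\<^sub>R gop c A' + vop V c A'" unfolding graph_eq[OF order_refl] by blast
  moreover have "gop c A \<bullet> vop V c A' = gop c A' \<bullet> vop V c A"
    by (simp add: gop_inner_vop inner_commute)
  moreover have "gop c A \<bullet> A' = gop c A' \<bullet> A" using gop_symmetric[OF c, of A A'] by (simp add: inner_commute)
  ultimately show "f \<bullet> g' = g \<bullet> f'"
    by (simp add: inner_add_right inner_diff_right inner_add_left inner_diff_left)
      (simp add: inner_commute)
next
  fix f g assume fg: "(f, g) \<in> schroedinger_graph V"
  show "rayleigh_inf V * (norm f)\<^sup>2 \<le> f \<bullet> g"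
  proof (cases "f = 0")
    case False
    have "rayleigh_inf V \<le> f \<bullet> g / (norm f)\<^sup>2"
      unfolding rayleigh_inf_def using fg False by (intro cInf_lower rayleigh_set_bdd) blast
    then show ?thesis using False by (simp add: pos_le_divide_eq)
  qed simp
next
  fix c' h assume c': "c' \<ge> c"
  \<comment> \<open>In the parametrisation by \<open>c'\<close>, adding \<open>c'\<close> times the
    first component to the second leaves exactly \<open>b + vop V c' b\<close>, a perturbation of
    the identity of norm at most 1/2.\<close>
  obtain b where b: "b + vop V c' b = h"
    using neumann_surj[OF linear_vop[OF c'] norm_vop_le[OF c']] by auto
  have "(gop c' b, b - c' *\<^sub>R gop c' b + vop V c' b) \<in> schroedinger_graph V" unfolding graph_eq[OF c'] by blast
  moreover have "b - c' *\<^sub>R gop c' b + vop V c' b + c' *\<^sub>R gop c' b = h" using b by simp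
  ultimately show "\<exists>f g. (f, g) \<in> schroedinger_graph V \<and> g + c' *\<^sub>R f = h" by blast
qed

lemma rayleigh_approx:
  assumes "\<delta> > 0"
  shows "\<exists>f g. (f, g) \<in> schroedinger_graph V \<and> f \<noteq> 0 \<and> f \<bullet> g < (rayleigh_inf V + \<delta>) * (norm f)\<^sup>2"
proof -
  have "rayleigh_inf V < rayleigh_inf V + \<delta>" using assms by simp
  then obtain t where "t \<in> {F \<bullet> G / (norm F)\<^sup>2 | F G. (F, G) \<in> schroedinger_graph V \<and> F \<noteq> 0}" "t < rayleigh_inf V + \<delta>"
    unfolding rayleigh_inf_def using cInf_less_iff[OF rayleigh_set_nonempty rayleigh_set_bdd] by blast
  then obtain F G where "(F, G) \<in> schroedinger_graph V" "F \<noteq> 0" "F \<bullet> G / (norm F)\<^sup>2 < rayleigh_inf V + \<delta>" by blast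
  then show ?thesis by (intro exI[of _ F] exI[of _ G]) (simp add: pos_divide_less_eq)
qed

section \<open>From the Hilbert space back to the spectrum of the statement\<close>

lemma resolvent_residual:
  assumes "(f, g) \<in> schroedinger V"
  shows "(mk_l2 f, mk_l2 g) \<in> schroedinger_graph V" "(\<lambda>x. g x - complex_of_real E * f x) \<in> L2"
    "mk_l2 g - E *\<^sub>R mk_l2 f = mk_l2 (\<lambda>x. g x - complex_of_real E * f x)"
proof -
  have f: "f \<in> L2" and g: "g \<in> L2" using assms by (auto simp: schroedinger_def)
  show "(mk_l2 f, mk_l2 g) \<in> schroedinger_graph V" using assms unfolding schroedinger_graph_def by force
  show "(\<lambda>x. g x - complex_of_real E * f x) \<in> L2" using f g by simp
  show "mk_l2 g - E *\<^sub>R mk_l2 f = mk_l2 (\<lambda>x. g x - complex_of_real E * f x)"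
    using f g by (simp add: mk_l2_scaleR mk_l2_diff scaleR_conv_of_real)
qed

lemma below_in_resolvent_set:
  assumes E: "E < rayleigh_inf V"
  shows "complex_of_real E \<in> resolvent_set (schroedinger V)"
proof -
  interpret S: semibounded "schroedinger_graph V" "rayleigh_inf V" c by (rule semibounded)
  have bd: "L2_norm f \<le> 1 / (rayleigh_inf V - E) * L2_norm (\<lambda>x. g x - complex_of_real E * f x)"
    if fg: "(f, g) \<in> schroedinger V" for f g
  proof -
    have f: "f \<in> L2" using fg by (auto simp: schroedinger_def)
    have "(rayleigh_inf V - E) * L2_norm f \<le> L2_norm (\<lambda>x. g x - complex_of_real E * f x)"
      using S.bounded_below[OF resolvent_residual(1)[OF fg], of E] resolvent_residual(2,3)[OF fg, of E]
      by (simp add: norm_mk_l2 f)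
    then show ?thesis using E by (simp add: field_simps)
  qed
  show ?thesis
    unfolding resolvent_set_def
  proof (intro CollectI conjI ballI)
    show "case P of (f, g) \<Rightarrow> (AE x in lebesgue. g x - complex_of_real E * f x = 0) \<longrightarrow> (AE x in lebesgue. f x = 0)"
      if "P \<in> schroedinger V" for P
    proof (cases P)
      case (Pair f g)
      with that have fg: "(f, g) \<in> schroedinger V" by simp
      have f: "f \<in> L2" using fg by (auto simp: schroedinger_def)
      have "AE x in lebesgue. f x = 0" if ae: "AE x in lebesgue. g x - complex_of_real E * f x = 0"
      proof -
        have "mk_l2 (\<lambda>x. g x - complex_of_real E * f x) = mk_l2 (\<lambda>x. 0)"
          using ae resolvent_residual(2)[OF fg, of E] by (simp add: mk_l2_eq_iff)
        then have "L2_norm (\<lambda>x. g x - complex_of_real E * f x) = 0"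
          using norm_mk_l2[OF resolvent_residual(2)[OF fg, of E]] by (simp add: mk_l2_zero)
        then have "norm (mk_l2 f) \<le> 0" using bd[OF fg] by (simp add: norm_mk_l2 f)
        then have "mk_l2 f = mk_l2 (\<lambda>x. 0)" by (simp add: mk_l2_zero)
        then show ?thesis using f by (simp add: mk_l2_eq_iff)
      qed
      then show ?thesis by (simp add: Pair)
    qed
    show "\<exists>(f, g)\<in>schroedinger V. AE x in lebesgue. g x - complex_of_real E * f x = h x" if h: "h \<in> L2" for h
    proof -
      obtain F G where FG: "(F, G) \<in> schroedinger_graph V" "G - E *\<^sub>R F = mk_l2 h" using S.surj_below[OF E] by blast
      then obtain f g where fg: "(f, g) \<in> schroedinger V" and "F = mk_l2 f" "G = mk_l2 g"
        unfolding schroedinger_graph_def by auto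
      with FG have "mk_l2 (\<lambda>x. g x - complex_of_real E * f x) = mk_l2 h"
        using resolvent_residual(3)[OF fg, of E] by simp
      then have "AE x in lebesgue. g x - complex_of_real E * f x = h x"
        using resolvent_residual(2)[OF fg, of E] h by (simp add: mk_l2_eq_iff)
      with fg show ?thesis by blast
    qed
    show "\<exists>C. \<forall>(f, g)\<in>schroedinger V. L2_norm f \<le> C * L2_norm (\<lambda>x. g x - complex_of_real E * f x)"
      using bd by blast
  qed
qed

text \<open>Regularity at the infimum would provide both surjectivity and a bounded inverse, which
  \<open>bottom_not_regular\<close> shows to be incompatible.\<close>

lemma bottom_in_spectrum: "complex_of_real (rayleigh_inf V) \<in> spectrum (schroedinger V)"
proof (rule ccontr)
  interpret S: semibounded "schroedinger_graph V" "rayleigh_inf V" c by (rule semibounded)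
  let ?m = "rayleigh_inf V"
  assume "\<not> ?thesis"
  then have res: "complex_of_real ?m \<in> resolvent_set (schroedinger V)" by (simp add: spectrum_def)
  obtain C where C: "\<And>f g. (f, g) \<in> schroedinger V \<Longrightarrow> L2_norm f \<le> C * L2_norm (\<lambda>x. g x - complex_of_real ?m * f x)"
    using res unfolding resolvent_set_def by blast
  have onto: "\<exists>F G. (F, G) \<in> schroedinger_graph V \<and> G - ?m *\<^sub>R F = H" for H
  proof -
    have "\<exists>(f, g)\<in>schroedinger V. AE x in lebesgue. g x - complex_of_real ?m * f x = brep H x"
      using res brep(1)[of H] unfolding resolvent_set_def by blast
    then obtain f g where fg: "(f, g) \<in> schroedinger V" and "AE x in lebesgue. g x - complex_of_real ?m * f x = brep H x"
      by blast
    then have "mk_l2 g - ?m *\<^sub>R mk_l2 f = mk_l2 (brep H)"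
      using resolvent_residual(2,3)[OF fg, of ?m] brep(1)[of H] by (simp only: mk_l2_eq_iff)
    then show ?thesis using resolvent_residual(1)[OF fg] by (metis brep(3))
  qed
  obtain F G where FG: "(F, G) \<in> schroedinger_graph V" "norm F > C * norm (G - ?m *\<^sub>R F)"
    using S.bottom_not_regular[OF rayleigh_approx onto] by blast
  then obtain f g where fg: "(f, g) \<in> schroedinger V" and FGe: "F = mk_l2 f" "G = mk_l2 g"
    unfolding schroedinger_graph_def by auto
  have f: "f \<in> L2" using fg by (auto simp: schroedinger_def)
  have "norm F \<le> C * norm (G - ?m *\<^sub>R F)"
    using C[OF fg] resolvent_residual(2,3)[OF fg, of ?m] by (simp add: FGe norm_mk_l2 f)
  with FG show False by simp
qed

theorem inf_spectrum_eq: "inf_spectrum (schroedinger V) = ereal (rayleigh_inf V)"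
  unfolding inf_spectrum_def
proof (rule antisym)
  show "(INF E\<in>{E. complex_of_real E \<in> spectrum (schroedinger V)}. ereal E) \<le> ereal (rayleigh_inf V)"
    by (rule INF_lower) (simp add: bottom_in_spectrum)
  show "ereal (rayleigh_inf V) \<le> (INF E\<in>{E. complex_of_real E \<in> spectrum (schroedinger V)}. ereal E)"
  proof (rule INF_greatest)
    fix E :: real assume "E \<in> {E. complex_of_real E \<in> spectrum (schroedinger V)}"
    then have "\<not> E < rayleigh_inf V" using below_in_resolvent_set by (auto simp: spectrum_def)
    then show "ereal (rayleigh_inf V) \<le> ereal E" by simp
  qed
qed

text \<open>Both sides of the strict inequality are continuous in \<open>A\<close>, so its solutions
  form an open set and, if there are any, one lies in the dense set \<open>D\<close>. A countable
  \<open>D\<close> serves measurability, the whole space serves the choice of a trial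
  function.\<close>

lemma rayleigh_inf_less_iff:
  assumes D: "closure D = (UNIV :: 'd l2 set)"
  shows "rayleigh_inf V < t \<longleftrightarrow> (\<exists>A\<in>D. gop c A \<noteq> 0 \<and> quad A < t * (norm (gop c A))\<^sup>2)"
proof
  assume "rayleigh_inf V < t"
  then obtain s where "s \<in> {F \<bullet> G / (norm F)\<^sup>2 | F G. (F, G) \<in> schroedinger_graph V \<and> F \<noteq> 0}" "s < t"
    unfolding rayleigh_inf_def using cInf_less_iff[OF rayleigh_set_nonempty rayleigh_set_bdd] by blast
  then obtain A where A: "gop c A \<noteq> 0" "quad A < t * (norm (gop c A))\<^sup>2"
    unfolding graph_eq[OF order_refl] quad_def by (auto simp: pos_divide_less_eq)
  have cg: "continuous_on UNIV (gop c :: 'd l2 \<Rightarrow> _)"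
    using bounded_linear_gop[OF c] by (rule linear_continuous_on)
  have "bounded_linear (vop V c)"
    using norm_vop_le[OF order_refl] linear_vop[OF order_refl]
    by (intro bounded_linear_intro[where K = "1/2"]) (auto simp: linear_add linear_scale)
  then have cv: "continuous_on UNIV (vop V c)" by (rule linear_continuous_on)
  have "open {A. gop c A \<noteq> (0 :: 'd l2)}"
    by (intro open_Collect_neq cg continuous_on_const)
  moreover have "open {A. quad A < t * (norm (gop c A))\<^sup>2}"
    unfolding quad_def by (intro open_Collect_less continuous_intros cg cv)
  ultimately have "open ({A. gop c A \<noteq> 0} \<inter> {A. quad A < t * (norm (gop c A))\<^sup>2})" by (rule open_Int)
  moreover have "A \<in> closure D" using D by simp
  ultimately show "\<exists>A\<in>D. gop c A \<noteq> 0 \<and> quad A < t * (norm (gop c A))\<^sup>2"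
    using A unfolding closure_iff_nhds_not_empty by blast
next
  assume "\<exists>A\<in>D. gop c A \<noteq> 0 \<and> quad A < t * (norm (gop c A))\<^sup>2"
  then obtain A where A: "gop c A \<noteq> 0" "quad A < t * (norm (gop c A))\<^sup>2" by blast
  have "rayleigh_inf V \<le> quad A / (norm (gop c A))\<^sup>2"
    unfolding rayleigh_inf_def quad_def
    by (rule cInf_lower[OF _ rayleigh_set_bdd]) (use A in \<open>auto simp: graph_eq[OF order_refl]\<close>)
  also have "\<dots> < t" using A by (simp add: pos_divide_less_eq)
  finally show "rayleigh_inf V < t" .
qed

end

section \<open>The breather potential\<close>

text \<open>Truncation of a Borel version at the essential bound makes the bound valid at every
  point.\<close>

lemma Linf_borel_version:
  fixes u :: "real^'d \<Rightarrow> real"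
  assumes "u \<in> Linf"
  shows "\<exists>v b. v \<in> borel_measurable borel \<and> 0 \<le> b \<and> (\<forall>x. \<bar>v x\<bar> \<le> b) \<and> (AE x in lborel. u x = v x)"
proof -
  obtain b where u: "u \<in> borel_measurable lebesgue" and b: "AE x in lebesgue. \<bar>u x\<bar> \<le> b"
    using assms by (auto simp: Linf_def)
  obtain g where g: "g \<in> borel_measurable lborel" "AE x in lborel. u x = g x"
    using completion_ex_borel_measurable_real[OF u] by blast
  have [measurable]: "g \<in> borel_measurable borel" using g(1) by simp
  define v where "v x = max (- \<bar>b\<bar>) (min \<bar>b\<bar> (g x))" for x
  have "v \<in> borel_measurable borel" unfolding v_def by measurable
  moreover have "\<bar>v x\<bar> \<le> \<bar>b\<bar>" for x unfolding v_def by linarith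
  moreover have "AE x in lborel. u x = v x"
    using g(2) b unfolding AE_completion_iff by eventually_elim (auto simp: v_def)
  ultimately show ?thesis by (intro exI[of _ v] exI[of _ "\<bar>b\<bar>"]) auto
qed

lemma AE_lborel_affine:
  fixes P :: "'a::euclidean_space \<Rightarrow> bool"
  assumes P: "AE y in lborel. P y" and c: "c \<noteq> 0"
  shows "AE x in lborel. P (t + c *\<^sub>R x)"
proof -
  obtain N where N: "{y \<in> space lborel. \<not> P y} \<subseteq> N" "emeasure lborel N = 0" "N \<in> sets lborel"
    using AE_E[OF P] by blast
  have [measurable]: "N \<in> sets borel" using N(3) by simp
  have "ennreal (\<bar>c\<bar> ^ DIM('a)) * (\<integral>\<^sup>+x. indicator N (t + c *\<^sub>R x) \<partial>lborel) = (\<integral>\<^sup>+x. indicator N x \<partial>lborel)"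
    by (rule nn_integral_lborel_scale[symmetric]) (use c in auto)
  then have "(\<integral>\<^sup>+x. indicator N (t + c *\<^sub>R x) \<partial>lborel) = 0" using N(2) c by simp
  then have "AE x in lborel. indicator N (t + c *\<^sub>R x) = (0 :: ennreal)"
    by (subst (asm) nn_integral_0_iff_AE) auto
  then show ?thesis by eventually_elim (use N(1) in \<open>auto simp: indicator_eq_0_iff\<close>)
qed

lemma AE_dilate_cong:
  fixes u v :: "real^'d \<Rightarrow> real"
  assumes "AE y in lborel. u y = v y"
  shows "AE x in lborel. dilate u l (x - t) = dilate v l (x - t)"
proof (cases "l = 0")
  case False
  have "AE x in lborel. u (- (t /\<^sub>R l) + (1 / l) *\<^sub>R x) = v (- (t /\<^sub>R l) + (1 / l) *\<^sub>R x)"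
    by (rule AE_lborel_affine[OF assms]) (use False in simp)
  then show ?thesis
    by eventually_elim (use False in \<open>simp add: dilate_def algebra_simps inverse_eq_divide\<close>)
qed (simp add: dilate_def)

text \<open>One null set is discarded for each of the countably many sites; at scale zero both
  dilations are zero by definition.\<close>

lemma breather_cong_AE:
  fixes u v :: "int^'d \<Rightarrow> real^'d \<Rightarrow> real"
  assumes "\<And>k. AE y in lborel. u k y = v k y"
  shows "AE x in lborel. breather u lam \<omega> x = breather v lam \<omega> x"
proof -
  have "AE x in lborel. \<forall>k. dilate (u k) (lam k \<omega>) (x - lattice_pt k) = dilate (v k) (lam k \<omega>) (x - lattice_pt k)"
    unfolding AE_all_countable by (intro allI AE_dilate_cong assms)
  then show ?thesis by eventually_elim (simp add: breather_def)
qed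

definition lattice_cube :: "nat \<Rightarrow> (int^'d) set" where
  "lattice_cube n = {k. \<forall>i. \<bar>k $ i\<bar> \<le> int n}"

lemma finite_lattice_cube: "finite (lattice_cube n :: (int^'d) set)"
proof (rule finite_subset)
  show "(lattice_cube n :: (int^'d) set) \<subseteq> vec_lambda ` (PiE UNIV (\<lambda>_. {- int n..int n}))"
  proof
    fix k :: "int^'d" assume "k \<in> lattice_cube n"
    then have "\<forall>i. - int n \<le> k $ i \<and> k $ i \<le> int n" unfolding lattice_cube_def by (simp add: abs_le_iff minus_le_iff)
    then have "($) k \<in> PiE UNIV (\<lambda>_. {- int n..int n})" by auto
    then show "k \<in> vec_lambda ` (PiE UNIV (\<lambda>_. {- int n..int n}))"
      by (intro image_eqI[of _ _ "($) k"]) auto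
  qed
qed (intro finite_imageI finite_PiE; simp)

lemma dilate_outside:
  assumes supp: "\<And>y. norm y > C \<Longrightarrow> u y = 0" and l: "0 \<le> l" and y: "norm y > C * l"
  shows "dilate u l y = 0"
proof (cases "l = 0")
  case False
  then have "norm (y /\<^sub>R l) > C" using l y by (simp add: field_simps)
  then show ?thesis by (simp add: dilate_def supp)
qed (simp add: dilate_def)

text \<open>The summand at site k lives within distance C \<lambda>, hence at most C * C, of k.
  Sites with a coordinate beyond \<open>norm x + C * C\<close> therefore contribute nothing at
  \<open>x\<close>.\<close>

lemma breather_eq_sum:
  fixes u :: "int^'d \<Rightarrow> real^'d \<Rightarrow> real"
  assumes supp: "\<And>k y. norm y > C \<Longrightarrow> u k y = 0" and C: "0 < C"
    and lam: "\<And>k. lam k \<omega> \<in> {0..C}" and n: "norm x + C * C \<le> real n"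
  shows "breather u lam \<omega> x = (\<Sum>k\<in>lattice_cube n. dilate (u k) (lam k \<omega>) (x - lattice_pt k))"
proof -
  have "dilate (u k) (lam k \<omega>) (x - lattice_pt k) = 0" if k: "k \<notin> lattice_cube n" for k
  proof (rule dilate_outside[where C = C])
    obtain i where i: "\<bar>k $ i\<bar> > int n" using k by (auto simp: lattice_cube_def not_le)
    have "real n < real_of_int \<bar>k $ i\<bar>" using i by linarith
    also have "\<dots> = \<bar>lattice_pt k $ i\<bar>" by (simp add: lattice_pt_def)
    also have "\<dots> \<le> norm (lattice_pt k)" by (rule component_le_norm_cart)
    finally have "norm (lattice_pt k) > norm x + C * C" using n by linarith
    then have "norm (x - lattice_pt k) > C * C"
      using norm_triangle_ineq2[of "lattice_pt k" x] by (simp add: norm_minus_commute)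
    moreover have "C * lam k \<omega> \<le> C * C" using lam[of k] C by simp
    ultimately show "norm (x - lattice_pt k) > C * lam k \<omega>" by linarith
  qed (use supp lam[of k] in auto)
  then have "breather u lam \<omega> x = (\<Sum>\<^sub>\<infinity>k\<in>lattice_cube n. dilate (u k) (lam k \<omega>) (x - lattice_pt k))"
    unfolding breather_def by (intro infsum_cong_neutral) auto
  then show ?thesis by (simp add: finite_lattice_cube)
qed

lemma dilate_measurable:
  assumes [measurable]: "u \<in> borel_measurable borel" "l \<in> borel_measurable M" "g \<in> borel_measurable M"
  shows "(\<lambda>z. dilate u (l z) (g z)) \<in> borel_measurable M"
  unfolding dilate_def by measurable

text \<open>At each point the sums over growing cubes are eventually constant. Measurability jointly
  in \<omega> and x is what makes integrals over x measurable in \<omega>.\<close>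

lemma breather_measurable:
  fixes u :: "int^'d \<Rightarrow> real^'d \<Rightarrow> real"
  assumes u: "\<And>k. u k \<in> borel_measurable borel" and supp: "\<And>k y. norm y > C \<Longrightarrow> u k y = 0" and C: "0 < C"
    and lam: "\<And>k \<omega>. \<omega> \<in> space M \<Longrightarrow> lam k \<omega> \<in> {0..C}" and lm: "\<And>k. lam k \<in> borel_measurable M"
  shows "(\<lambda>(\<omega>, x). breather u lam \<omega> x) \<in> borel_measurable (M \<Otimes>\<^sub>M lborel)"
proof (rule borel_measurable_LIMSEQ_real)
  fix z assume "z \<in> space (M \<Otimes>\<^sub>M (lborel :: (real^'d) measure))"
  then obtain \<omega> x where z: "z = (\<omega>, x)" and \<omega>: "\<omega> \<in> space M" by (auto simp: space_pair_measure)
  have "eventually (\<lambda>n. norm x + C * C \<le> real n) sequentially"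
    using real_nat_ceiling_ge eventually_sequentially by (meson eventually_at_top_linorder le_nat_floor nat_ceiling_le_eq)
  then have "eventually (\<lambda>n. (case z of (\<omega>, x) \<Rightarrow> breather u lam \<omega> x) = (\<Sum>k\<in>lattice_cube n. dilate (u k) (lam k (fst z)) (snd z - lattice_pt k))) sequentially"
    
    by eventually_elim (simp add: z breather_eq_sum[where C = C and u = u and lam = lam and \<omega> = \<omega>] supp C lam[OF \<omega>] del: atLeastAtMost_iff)
  then show "(\<lambda>n. \<Sum>k\<in>lattice_cube n. dilate (u k) (lam k (fst z)) (snd z - lattice_pt k)) \<longlonglongrightarrow> (case z of (\<omega>, x) \<Rightarrow> breather u lam \<omega> x)"
    by (rule Lim_transform_eventually[OF tendsto_const])
next
  fix n
  show "(\<lambda>z. \<Sum>k\<in>lattice_cube n. dilate (u k) (lam k (fst z)) (snd z - lattice_pt k)) \<in> borel_measurable (M \<Otimes>\<^sub>M lborel)"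
  proof (intro borel_measurable_sum dilate_measurable u)
    fix k
    show "(\<lambda>z. lam k (fst z)) \<in> borel_measurable (M \<Otimes>\<^sub>M lborel)" by (rule measurable_compose[OF measurable_fst lm])
    show "(\<lambda>z. snd z - lattice_pt k) \<in> borel_measurable (M \<Otimes>\<^sub>M lborel)" by measurable
  qed
qed

lemma breather_nonneg: "(\<And>k y. 0 \<le> u k y) \<Longrightarrow> 0 \<le> breather u lam \<omega> x"
  unfolding breather_def by (intro infsum_nonneg) (simp add: dilate_def)

lemma schroedinger_cong_AE:
  fixes V V' :: "real^'d \<Rightarrow> real"
  assumes "AE x in lborel. V x = V' x"
  shows "schroedinger V = schroedinger V'"
proof -
  have ae: "AE x in lebesgue. V x = V' x" using assms by (rule AE_completion)
  have "(AE x in lebesgue. g x = - h x + complex_of_real (V x) * f x) \<longleftrightarrow>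
    (AE x in lebesgue. g x = - h x + complex_of_real (V' x) * f x)" for f g h :: "real^'d \<Rightarrow> complex"
  proof
    assume "AE x in lebesgue. g x = - h x + complex_of_real (V x) * f x"
    with ae show "AE x in lebesgue. g x = - h x + complex_of_real (V' x) * f x" by eventually_elim simp
  next
    assume "AE x in lebesgue. g x = - h x + complex_of_real (V' x) * f x"
    with ae show "AE x in lebesgue. g x = - h x + complex_of_real (V x) * f x" by eventually_elim simp
  qed
  then show ?thesis unfolding schroedinger_def by simp
qed

text \<open>Continuity from above of the finite measure with density \<open>g\<close>. It is applied
  to complements of growing balls and to balls shrinking to a point.\<close>

lemma nn_integral_decseq_small:
  fixes g :: "real^'d \<Rightarrow> ennreal" and S :: "nat \<Rightarrow> (real^'d) set"
  assumes g [measurable]: "g \<in> borel_measurable borel" and fin: "(\<integral>\<^sup>+x. g x \<partial>lborel) < \<infinity>"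
    and S: "\<And>n. S n \<in> sets borel" and dec: "decseq S" and null: "emeasure lborel (\<Inter>n. S n) = 0" and e: "e > 0"
  shows "\<exists>N. \<forall>n\<ge>N. (\<integral>\<^sup>+x. g x * indicator (S n) x \<partial>lborel) < e"
proof -
  let ?\<nu> = "density lborel g"
  have em: "emeasure ?\<nu> A = (\<integral>\<^sup>+x. g x * indicator A x \<partial>lborel)" if "A \<in> sets borel" for A
    using that by (intro emeasure_density) auto
  have "(\<lambda>n. emeasure ?\<nu> (S n)) \<longlonglongrightarrow> emeasure ?\<nu> (\<Inter>n. S n)"
  proof (rule Lim_emeasure_decseq[OF _ dec])
    show "range S \<subseteq> sets ?\<nu>" using S by auto
    fix n
    have "emeasure ?\<nu> (S n) \<le> emeasure ?\<nu> UNIV" using S by (intro emeasure_mono) auto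
    also have "\<dots> < \<infinity>" using fin by (subst em) auto
    finally show "emeasure ?\<nu> (S n) \<noteq> \<infinity>" by simp
  qed
  also have "emeasure ?\<nu> (\<Inter>n. S n) = 0"
  proof -
    have "AE x in lborel. x \<notin> (\<Inter>n. S n)"
      using null S by (intro AE_not_in) (auto simp: null_sets_def)
    then have "(\<integral>\<^sup>+x. g x * indicator (\<Inter>n. S n) x \<partial>lborel) = (\<integral>\<^sup>+x. 0 \<partial>(lborel :: (real^'d) measure))"
    proof (intro nn_integral_cong_AE)
      show "AE x in lborel. g x * indicator (\<Inter>n. S n) x = 0"
        using \<open>AE x in lborel. x \<notin> (\<Inter>n. S n)\<close> by eventually_elim (subst indicator_simps(2), assumption, simp)
    qed
    then show ?thesis using S by (subst em) auto
  qed
  finally have "(\<lambda>n. emeasure ?\<nu> (S n)) \<longlonglongrightarrow> 0" .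
  then have "eventually (\<lambda>n. emeasure ?\<nu> (S n) < e) sequentially" using e by (rule order_tendstoD(2))
  then show ?thesis unfolding eventually_sequentially by (simp add: em S)
qed

section \<open>Norms of dilated profiles and local norm estimates\<close>

lemma nn_integral_dilate_powr:
  fixes u :: "real^'d \<Rightarrow> real"
  assumes u [measurable]: "u \<in> borel_measurable borel" and l: "l > 0"
  shows "(\<integral>\<^sup>+x. ennreal (\<bar>dilate u l x\<bar> powr p) \<partial>lborel) = ennreal (l ^ CARD('d)) * (\<integral>\<^sup>+x. ennreal (\<bar>u x\<bar> powr p) \<partial>lborel)"
proof -
  have "(\<integral>\<^sup>+x. ennreal (\<bar>u x\<bar> powr p) \<partial>lborel)
    = ennreal (\<bar>1 / l\<bar> ^ DIM(real^'d)) * (\<integral>\<^sup>+x. ennreal (\<bar>u (0 + (1 / l) *\<^sub>R x)\<bar> powr p) \<partial>lborel)"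
    by (rule nn_integral_lborel_scale) (use l in auto)
  also have "(\<integral>\<^sup>+x. ennreal (\<bar>u (0 + (1 / l) *\<^sub>R x)\<bar> powr p) \<partial>lborel) = (\<integral>\<^sup>+x. ennreal (\<bar>dilate u l x\<bar> powr p) \<partial>lborel)"
    using l by (simp add: dilate_def inverse_eq_divide)
  finally have e: "(\<integral>\<^sup>+x. ennreal (\<bar>u x\<bar> powr p) \<partial>lborel)
    = ennreal ((1 / l) ^ CARD('d)) * (\<integral>\<^sup>+x. ennreal (\<bar>dilate u l x\<bar> powr p) \<partial>lborel)" using l by simp
  have "ennreal (l ^ CARD('d)) * ennreal ((1 / l) ^ CARD('d)) = 1"
    using l by (simp add: ennreal_mult[symmetric] power_mult_distrib[symmetric])
  then show ?thesis unfolding e by (simp add: mult.assoc[symmetric])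
qed

text \<open>The p-th power of the norm of the dilated profile is \<open>l ^ d\<close> times that of
  the profile, which is positive. A scale beyond \<open>s\<close> thus keeps the norm away from
  zero.\<close>

lemma small_dilate_norm_imp_small_scale:
  fixes u :: "real^'d \<Rightarrow> real"
  assumes u [measurable]: "u \<in> borel_measurable borel" and nz: "\<not> (AE y in lborel. u y = 0)" and p: "p > 0" and s: "s > 0"
  shows "\<exists>\<kappa>>0. \<forall>l\<ge>0. Lp_norm p (dilate u l) \<le> ennreal \<kappa> \<longrightarrow> l \<le> s"
proof -
  define J where "J = (\<integral>\<^sup>+x. ennreal (\<bar>u x\<bar> powr p) \<partial>lborel)"
  have "J \<noteq> 0"
  proof
    assume "J = 0"
    then have "AE x in lborel. ennreal (\<bar>u x\<bar> powr p) = 0" unfolding J_def by (subst (asm) nn_integral_0_iff_AE) auto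
    then have "AE x in lborel. u x = 0" by eventually_elim (simp add: ennreal_eq_0_iff)
    with nz show False by simp
  qed
  then have mJ: "min J 1 \<noteq> 0" by (simp add: min_def)
  \<comment> \<open>The integral \<open>J\<close> may be infinite; truncated at 1 it still gives a
    finite positive lower bound.\<close>
  define r where "r = enn2real (min J 1)"
  have mfin: "min J 1 < \<infinity>" by (simp add: min_less_iff_disj)
  then have rJ: "ennreal r = min J 1" unfolding r_def by (simp add: less_top)
  have "r \<noteq> 0" using rJ mJ by auto
  moreover have "r \<ge> 0" unfolding r_def by (rule enn2real_nonneg)
  ultimately have r: "r > 0" by simp
  \<comment> \<open>The p-th power of this bound is half of \<open>s ^ d * r\<close>, while scales
    beyond \<open>s\<close> give at least \<open>s ^ d * r\<close>.\<close>
  define \<kappa> where "\<kappa> = (s ^ CARD('d) * r / 2) powr (1 / p)"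
  have \<kappa>: "\<kappa> > 0" using s r by (simp add: \<kappa>_def)
  have "l \<le> s" if l: "l \<ge> 0" and le: "Lp_norm p (dilate u l) \<le> ennreal \<kappa>" for l
  proof (rule ccontr)
    assume "\<not> l \<le> s"
    then have ls: "l > s" by simp
    define I where "I = (\<integral>\<^sup>+x. ennreal (\<bar>dilate u l x\<bar> powr p) \<partial>lebesgue)"
    have I: "I = ennreal (l ^ CARD('d)) * J"
      unfolding I_def J_def using ls s by (simp add: nn_integral_completion nn_integral_dilate_powr)
    have fin: "I \<noteq> \<infinity>" and Ile: "ennreal (enn2real I powr (1 / p)) \<le> ennreal \<kappa>"
      using le unfolding Lp_norm_def I_def[symmetric] Let_def by (auto split: if_splits simp: top_unique)
    then have "enn2real I powr (1 / p) \<le> \<kappa>" using \<kappa> by simp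
    then have "(enn2real I powr (1 / p)) powr p \<le> \<kappa> powr p" using p by (intro powr_mono2) auto
    then have "enn2real I \<le> s ^ CARD('d) * r / 2" using p s r by (simp add: \<kappa>_def powr_powr)
    moreover have "s ^ CARD('d) * r \<le> enn2real I"
    proof -
      have "ennreal (s ^ CARD('d) * r) = ennreal (s ^ CARD('d)) * min J 1" using s r rJ by (simp add: ennreal_mult)
      also have "\<dots> \<le> ennreal (l ^ CARD('d)) * J" using ls s by (intro mult_mono ennreal_leI power_mono) auto
      also have "\<dots> = ennreal (enn2real I)" using fin by (simp add: I[symmetric] less_top)
      finally show ?thesis by simp
    qed
    moreover have "s ^ CARD('d) * r > 0" using s r by simp
    ultimately show False by linarith
  qed
  with \<kappa> show ?thesis by blast
qed

lemma powr_add_le: "\<bar>a + b\<bar> powr p \<le> 2 powr p * (\<bar>a\<bar> powr p + \<bar>b\<bar> powr p)" if "p > 0" for a b p :: real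
proof -
  have "\<bar>a + b\<bar> powr p \<le> (2 * max \<bar>a\<bar> \<bar>b\<bar>) powr p" using that by (intro powr_mono2) auto
  also have "\<dots> = 2 powr p * (max \<bar>a\<bar> \<bar>b\<bar>) powr p" by (simp add: powr_mult)
  also have "(max \<bar>a\<bar> \<bar>b\<bar>) powr p \<le> \<bar>a\<bar> powr p + \<bar>b\<bar> powr p" by (simp add: max_def)
  finally show ?thesis by (simp add: mult_left_mono)
qed

lemma Lp_norm_le_imp:
  assumes "Lp_norm p f \<le> ennreal \<kappa>" and p: "p > 0" and \<kappa>: "\<kappa> \<ge> 0"
  shows "(\<integral>\<^sup>+x. ennreal (\<bar>f x\<bar> powr p) \<partial>lebesgue) \<le> ennreal (\<kappa> powr p)"
proof -
  define I where "I = (\<integral>\<^sup>+x. ennreal (\<bar>f x\<bar> powr p) \<partial>lebesgue)"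
  have fin: "I \<noteq> \<infinity>" and Ile: "ennreal (enn2real I powr (1 / p)) \<le> ennreal \<kappa>"
    using assms unfolding Lp_norm_def I_def[symmetric] Let_def by (auto split: if_splits simp: top_unique)
  then have "enn2real I powr (1 / p) \<le> \<kappa>" using \<kappa> by simp
  then have "(enn2real I powr (1 / p)) powr p \<le> \<kappa> powr p" using p by (intro powr_mono2) auto
  then have "enn2real I \<le> \<kappa> powr p" using p by (simp add: powr_powr)
  then show ?thesis unfolding I_def[symmetric] using fin by (metis ennreal_enn2real ennreal_leI less_top infinity_ennreal_def)
qed

text \<open>The inner product is real, so indicators of rational boxes detect only the real parts of
  the box integrals; their multiples by \<open>\<i>\<close> detect the imaginary parts.\<close>

lemma l2_separable: "\<exists>D :: ('d::finite) l2 set. countable D \<and> closure D = UNIV"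
proof -
  let ?b = "\<lambda>(p, q). indicator (box (rat_vec p) (rat_vec q)) :: real^'d \<Rightarrow> complex"
  define S where "S = range (\<lambda>r. mk_l2 (?b r)) \<union> range (\<lambda>r. mk_l2 (\<lambda>x. \<i> * ?b r x))"
  have b2: "?b r \<in> L2" for r by (cases r) (simp add: indicator_box_L2)
  show ?thesis
  proof (rule total_imp_separable[of S])
    show "countable S" unfolding S_def by simp
    fix F assume orth: "\<And>s. s \<in> S \<Longrightarrow> F \<bullet> s = 0"
    obtain f where f: "f \<in> L2" and F: "F = mk_l2 f" by (rule mk_l2_exhaust[of F]) blast
    have "AE x in lebesgue. f x = 0"
    proof (rule AE_zero_if_rational_boxes[OF f])
      fix p q :: "rat^'d"
      let ?i = "indicator (box (rat_vec p) (rat_vec q)) :: real^'d \<Rightarrow> complex"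
      have i2: "?i \<in> L2" by (rule indicator_box_L2)
      have int: "integrable lebesgue (\<lambda>x. f x * ?i x)" by (rule integrable_mult_L2[OF f i2])
      have ri: "Re (f x * ?i x) = f x \<bullet> ?i x" "Im (f x * ?i x) = f x \<bullet> (\<i> * ?i x)" for x
        by (cases "x \<in> box (rat_vec p) (rat_vec q)"; simp add: inner_complex_def)+
      have "Re (\<integral>x. f x * ?i x \<partial>lebesgue) = (\<integral>x. f x \<bullet> ?i x \<partial>lebesgue)"
        unfolding integral_Re[OF int, symmetric] ri ..
      also have "\<dots> = F \<bullet> mk_l2 (?b (p, q))" using f i2 by (simp add: F inner_mk_l2)
      also have "\<dots> = 0" by (rule orth) (unfold S_def, blast)
      finally have re: "Re (\<integral>x. f x * ?i x \<partial>lebesgue) = 0" .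
      have "Im (\<integral>x. f x * ?i x \<partial>lebesgue) = (\<integral>x. f x \<bullet> (\<i> * ?i x) \<partial>lebesgue)"
        unfolding integral_Im[OF int, symmetric] ri ..
      also have "\<dots> = F \<bullet> mk_l2 (\<lambda>x. \<i> * ?b (p, q) x)" using f i2 by (simp add: F inner_mk_l2)
      also have "\<dots> = 0" by (rule orth) (unfold S_def, blast)
      finally show "(\<integral>x. f x * ?i x \<partial>lebesgue) = 0" using re by (intro complex_eqI) auto
    qed
    then show "F = 0" using f by (simp add: F mk_l2_zero[symmetric] mk_l2_eq_iff)
  qed
qed

text \<open>The hypotheses after passing to Borel versions: they hold at every point,
  \<open>b\<close> bounds each profile separately, and small norms have become small scales. One set
  of constants serves the periodic potential, the breather potential and their sum, for all
  \<omega>.\<close>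

locale random_breather = prob_space M for M :: "'w measure" +
  fixes C p K c \<eta> bV :: real
    and u :: "int^'d \<Rightarrow> real^'d \<Rightarrow> real"
    and lam :: "int^'d \<Rightarrow> 'w \<Rightarrow> real"
    and Vp :: "real^'d \<Rightarrow> real" and b :: "int^'d \<Rightarrow> real"
  assumes C: "C > 0"
    and u: "\<And>k. u k \<in> borel_measurable borel"
    and u0: "\<And>k y. 0 \<le> u k y" and ub: "\<And>k y. u k y \<le> b k" and supp: "\<And>k y. norm y > C \<Longrightarrow> u k y = 0"
    and lam: "\<And>k \<omega>. \<omega> \<in> space M \<Longrightarrow> lam k \<omega> \<in> {0..C}"
    and indep: "indep_vars (\<lambda>_. borel) lam UNIV"
    and fsV: "\<And>\<omega>. \<omega> \<in> space M \<Longrightarrow> form_small (\<lambda>x. Vp x + breather u lam \<omega> x) p K c \<eta> bV"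
    and fsW: "\<And>\<omega>. \<omega> \<in> space M \<Longrightarrow> form_small (breather u lam \<omega>) p K c \<eta> bV"
    and fsP: "form_small Vp p K c \<eta> bV"
    and small: "\<And>s k. s > 0 \<Longrightarrow> prob {\<omega> \<in> space M. lam k \<omega> \<le> s} > 0"
begin

section \<open>Measurability of the event and smallness of the breather energy\<close>

lemma lam_measurable [measurable]: "lam k \<in> borel_measurable M"
  using indep by (simp add: indep_vars_def)

lemma b_nonneg: "0 \<le> b k"
  using u0 ub order_trans by blast

lemma c_pos: "c > 0"
  using fsP by (simp add: form_small_def)

definition energy :: "'w \<Rightarrow> 'd l2 \<Rightarrow> real" where
  "energy \<omega> A = (\<integral>x. breather u lam \<omega> x * (norm (resolvent c (brep A) x))\<^sup>2 \<partial>lebesgue)"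

lemma brep_resolvent_L2: "resolvent c (brep (A :: 'd l2)) \<in> L2"
  by (rule resolvent_L2[OF c_pos brep(2) brep(1)])

lemma brep_resolvent_measurable [measurable]: "resolvent c (brep (A :: 'd l2)) \<in> borel_measurable borel"
proof -
  interpret averaging "heat_measure c" "shift :: _ \<Rightarrow> real^'d" by (rule averaging_heat[OF c_pos])
  show ?thesis by (rule avg_measurable[OF brep(2)])
qed

lemma potential_form_integrable:
  fixes V :: "real^'d \<Rightarrow> real"
  assumes "form_small V p K c \<eta> bV"
  shows "integrable lebesgue (\<lambda>x. V x * (norm (resolvent c (brep A) x))\<^sup>2)"
proof -
  interpret form_small V p K c \<eta> bV by fact
  have "integrable lebesgue (\<lambda>x. resolvent c (brep A) x \<bullet> (complex_of_real (V x) * resolvent c (brep A) x))"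
    by (rule integrable_inner_L2[OF brep_resolvent_L2 vop_L2[OF order_refl]])
  then show ?thesis by (simp add: scaleR_conv_of_real[symmetric] power2_norm_eq_inner)
qed

lemma quad_eq:
  fixes V :: "real^'d \<Rightarrow> real"
  assumes "form_small V p K c \<eta> bV"
  shows "form_small.quad V c A = gop c A \<bullet> (A - c *\<^sub>R gop c A) + (\<integral>x. V x * (norm (resolvent c (brep A) x))\<^sup>2 \<partial>lebesgue)"
proof -
  interpret form_small V p K c \<eta> bV by fact
  show ?thesis by (simp add: quad_def inner_add_right gop_inner_vop power2_norm_eq_inner)
qed

text \<open>Both operators are parametrised by the resolvent with the same \<open>c\<close>, so at a
  given \<open>A\<close> they share the trial function and the kinetic part.\<close>

lemma quad_split:
  assumes \<omega>: "\<omega> \<in> space M"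
  shows "form_small.quad (\<lambda>x. Vp x + breather u lam \<omega> x) c A = form_small.quad Vp c A + energy \<omega> A"
  unfolding quad_eq[OF fsV[OF \<omega>]] quad_eq[OF fsP] energy_def
  using potential_form_integrable[OF fsP, of A] potential_form_integrable[OF fsW[OF \<omega>], of A]
  by (simp add: distrib_right)

lemma energy_measurable: "(\<lambda>\<omega>. energy \<omega> A) \<in> borel_measurable M"
proof -
  have "(\<lambda>(\<omega>, x). breather u lam \<omega> x) \<in> borel_measurable (M \<Otimes>\<^sub>M lborel)"
    by (rule breather_measurable[OF u supp C lam lam_measurable])
  then have [measurable]: "(\<lambda>z. breather u lam (fst z) (snd z)) \<in> borel_measurable (M \<Otimes>\<^sub>M lborel)"
    by (simp add: case_prod_beta)
  have "(\<lambda>\<omega>. \<integral>x. breather u lam \<omega> x * (norm (resolvent c (brep A) x))\<^sup>2 \<partial>lborel) \<in> borel_measurable M"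
    by (intro sigma_finite_measure.borel_measurable_lebesgue_integral[OF sigma_finite_lborel])
      (simp add: case_prod_beta)
  moreover have "energy \<omega> A = (\<integral>x. breather u lam \<omega> x * (norm (resolvent c (brep A) x))\<^sup>2 \<partial>lborel)"
    if \<omega>: "\<omega> \<in> space M" for \<omega>
  proof -
    have [measurable]: "breather u lam \<omega> \<in> borel_measurable borel"
      using fsW[OF \<omega>] by (simp add: form_small_def)
    show ?thesis unfolding energy_def by (subst integral_completion) auto
  qed
  ultimately show ?thesis by (subst measurable_cong) auto
qed

text \<open>An infimum over uncountably many vectors is not visibly measurable. The bound by
  \<open>t\<close> is the countable intersection of strict bounds by
  \<open>t + 1 / real (Suc n)\<close>, each witnessed within a countable dense set, and for one
  vector the energy is measurable.\<close>

lemma event_measurable: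
  "{\<omega> \<in> space M. rayleigh_inf (\<lambda>x. Vp x + breather u lam \<omega> x) \<le> t} \<in> events"
proof -
  obtain D :: "'d l2 set" where D: "countable D" "closure D = UNIV" using l2_separable by blast
  let ?E = "\<lambda>n A. {\<omega> \<in> space M. form_small.quad Vp c A + energy \<omega> A < (t + 1 / real (Suc n)) * (norm (gop c A))\<^sup>2}"
  have "{\<omega> \<in> space M. rayleigh_inf (\<lambda>x. Vp x + breather u lam \<omega> x) \<le> t}
    = (\<Inter>n::nat. (\<Union>A\<in>{A \<in> D. gop c A \<noteq> 0}. ?E n A))"
  proof (intro set_eqI iffI)
    fix \<omega> assume "\<omega> \<in> {\<omega> \<in> space M. rayleigh_inf (\<lambda>x. Vp x + breather u lam \<omega> x) \<le> t}"
    then have \<omega>: "\<omega> \<in> space M" and le: "rayleigh_inf (\<lambda>x. Vp x + breather u lam \<omega> x) \<le> t" by auto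
    have "\<exists>A\<in>D. gop c A \<noteq> 0 \<and> form_small.quad (\<lambda>x. Vp x + breather u lam \<omega> x) c A < (t + 1 / real (Suc n)) * (norm (gop c A))\<^sup>2" for n :: nat
    proof -
      have "rayleigh_inf (\<lambda>x. Vp x + breather u lam \<omega> x) < t + 1 / real (Suc n)"
        using le by (rule le_less_trans) simp
      then show ?thesis using form_small.rayleigh_inf_less_iff[OF fsV[OF \<omega>] D(2)] by blast
    qed
    then show "\<omega> \<in> (\<Inter>n::nat. (\<Union>A\<in>{A \<in> D. gop c A \<noteq> 0}. ?E n A))"
      using \<omega> unfolding quad_split[OF \<omega>] by blast
  next
    fix \<omega> assume *: "\<omega> \<in> (\<Inter>n::nat. (\<Union>A\<in>{A \<in> D. gop c A \<noteq> 0}. ?E n A))"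
    then have \<omega>: "\<omega> \<in> space M" by blast
    have "rayleigh_inf (\<lambda>x. Vp x + breather u lam \<omega> x) \<le> t + 1 / real (Suc n)" for n :: nat
    proof -
      have "\<exists>A\<in>D. gop c A \<noteq> 0 \<and> form_small.quad (\<lambda>x. Vp x + breather u lam \<omega> x) c A < (t + 1 / real (Suc n)) * (norm (gop c A))\<^sup>2"
        unfolding quad_split[OF \<omega>] using * by blast
      then show ?thesis using form_small.rayleigh_inf_less_iff[OF fsV[OF \<omega>] D(2)] by (blast intro: less_imp_le)
    qed
    moreover have "(\<lambda>n. t + 1 / real (Suc n)) \<longlonglongrightarrow> t + 0"
      by (intro tendsto_intros LIMSEQ_Suc[OF lim_1_over_n])
    ultimately have "rayleigh_inf (\<lambda>x. Vp x + breather u lam \<omega> x) \<le> t + 0"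
      by (intro LIMSEQ_le_const[where X = "\<lambda>n. t + 1 / real (Suc n)"]) auto
    with \<omega> show "\<omega> \<in> {\<omega> \<in> space M. rayleigh_inf (\<lambda>x. Vp x + breather u lam \<omega> x) \<le> t}" by simp
  qed
  also have "\<dots> \<in> events"
  proof -
    have cD: "countable {A \<in> D. gop c A \<noteq> 0}" using D(1) by (rule countable_subset[rotated]) auto
    have [measurable]: "(\<lambda>\<omega>. energy \<omega> A) \<in> borel_measurable M" for A by (rule energy_measurable)
    have "?E n A \<in> events" for n A by measurable
    then have "(\<Union>A\<in>{A \<in> D. gop c A \<noteq> 0}. ?E n A) \<in> events" for n
      using cD by (intro sets.countable_UN') auto
    then show ?thesis by (intro sets.countable_INT) auto
  qed
  finally show ?thesis .
qed

text \<open>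
  Far away the potential is controlled through \<open>W \<le> \<delta> W\<^sup>2 + 1/\<delta>\<close>; in a ball only finitely many
  sites contribute, each on a set shrinking to a point.
\<close>

lemma energy_small:
  assumes \<tau>: "\<tau> > 0"
  shows "\<exists>s>0. \<exists>n. \<forall>\<omega>\<in>space M. (\<forall>k\<in>lattice_cube n. lam k \<omega> \<le> s) \<longrightarrow> energy \<omega> A \<le> \<tau>"
proof -
  define g where "g x = ennreal ((norm (resolvent c (brep A) x))\<^sup>2)" for x :: "real^'d"
  have gm [measurable]: "g \<in> borel_measurable borel" unfolding g_def by measurable
  have gfin: "(\<integral>\<^sup>+x. g x \<partial>lborel) < \<infinity>"
    using brep_resolvent_L2[of A] by (simp add: L2_iff_nn nn_integral_completion g_def)
  \<comment> \<open>Makes the quadratic term at most \<tau>/4, as the square of the potential has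
    energy at most a quarter of the squared norm of \<open>A\<close>; the summand 1 avoids division
    by zero.\<close>
  define \<delta> where "\<delta> = \<tau> / ((norm A)\<^sup>2 + 1)"
  have \<delta>: "\<delta> > 0" using \<tau> by (simp add: \<delta>_def add_nonneg_pos)
  have \<delta>A: "\<delta> * (norm A)\<^sup>2 \<le> \<tau>" using \<tau> by (simp add: \<delta>_def divide_le_eq add_nonneg_pos)
  \<comment> \<open>The constant \<open>1 / \<delta>\<close> multiplies the mass of the trial
    function outside this ball; the extra factor \<delta> here cancels it and leaves
    \<tau>/3.\<close>
  obtain N where N: "(\<integral>\<^sup>+x. g x * indicator {x. norm x > real N} x \<partial>lborel) < ennreal (\<delta> * \<tau> / 3)"
  proof -
    have "\<exists>N. \<forall>n\<ge>N. (\<integral>\<^sup>+x. g x * indicator {x. norm x > real n} x \<partial>lborel) < ennreal (\<delta> * \<tau> / 3)"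
    proof (rule nn_integral_decseq_small[OF gm gfin])
      show "{x :: real^'d. norm x > real n} \<in> sets borel" for n by measurable
      show "decseq (\<lambda>n. {x :: real^'d. norm x > real n})" by (auto simp: decseq_def)
      have "(\<Inter>n. {x :: real^'d. norm x > real n}) = {}"
      proof (intro equals0I)
        fix x :: "real^'d" assume x: "x \<in> (\<Inter>n. {x. norm x > real n})"
        obtain k :: nat where "norm x < real k" using reals_Archimedean2 by blast
        with x show False by (auto dest: spec[of _ k])
      qed
      then show "emeasure lborel (\<Inter>n. {x :: real^'d. norm x > real n}) = 0" by simp
      show "0 < ennreal (\<delta> * \<tau> / 3)" using \<delta> \<tau> by simp
    qed
    then show ?thesis using that by blast
  qed
  \<comment> \<open>Profiles reach at most \<open>C * C\<close> from their site, so this cube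
    contains all sites that matter inside the ball of radius N.\<close>
  obtain n where n: "real N + C * C \<le> real n" using real_arch_simple by blast
  let ?\<Lambda> = "lattice_cube n :: (int^'d) set"
  \<comment> \<open>Sums against the bounds \<open>b\<close> over the cube to at most \<tau>/3; the
    two added ones keep the denominators positive.\<close>
  define e where "e k = \<tau> / (3 * (real (card ?\<Lambda>) + 1) * (b k + 1))" for k
  have e: "e k > 0" for k using \<tau> b_nonneg[of k] by (simp add: e_def add_nonneg_pos)
  have "\<forall>k. \<exists>m. (\<integral>\<^sup>+x. g x * indicator (cball (lattice_pt k) (C / real (Suc m))) x \<partial>lborel) < ennreal (e k)"
  proof
    fix k :: "int^'d"
    have "\<exists>N. \<forall>m\<ge>N. (\<integral>\<^sup>+x. g x * indicator (cball (lattice_pt k) (C / real (Suc m))) x \<partial>lborel) < ennreal (e k)"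
    proof (rule nn_integral_decseq_small[OF gm gfin])
      show "cball (lattice_pt k) (C / real (Suc m)) \<in> sets borel" for m by simp
      show "decseq (\<lambda>m. cball (lattice_pt k) (C / real (Suc m)))"
        using C by (intro decseq_SucI subset_cball divide_left_mono) auto
      have "(\<Inter>m. cball (lattice_pt k) (C / real (Suc m))) \<subseteq> {lattice_pt k}"
      proof
        fix x assume x: "x \<in> (\<Inter>m. cball (lattice_pt k) (C / real (Suc m)))"
        have "(\<lambda>m. C * (1 / real (Suc m))) \<longlonglongrightarrow> C * 0" by (intro tendsto_intros LIMSEQ_Suc[OF lim_1_over_n])
        moreover have "dist (lattice_pt k) x \<le> C * (1 / real (Suc m))" for m using x by simp
        ultimately have "dist (lattice_pt k) x \<le> C * 0" by (intro LIMSEQ_le_const[where X = "\<lambda>m. C * (1 / real (Suc m))"]) auto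
        then show "x \<in> {lattice_pt k}" by simp
      qed
      then have "emeasure lborel (\<Inter>m. cball (lattice_pt k) (C / real (Suc m))) \<le> emeasure lborel {lattice_pt k}"
        by (intro emeasure_mono) auto
      then show "emeasure lborel (\<Inter>m. cball (lattice_pt k) (C / real (Suc m))) = 0" by simp
      show "0 < ennreal (e k)" using e by simp
    qed
    then show "\<exists>m. (\<integral>\<^sup>+x. g x * indicator (cball (lattice_pt k) (C / real (Suc m))) x \<partial>lborel) < ennreal (e k)" by blast
  qed
  from choice[OF this] obtain m where m: "\<And>k. (\<integral>\<^sup>+x. g x * indicator (cball (lattice_pt k) (C / real (Suc (m k)))) x \<partial>lborel) < ennreal (e k)"
    by blast
  \<comment> \<open>Scales up to \<open>s\<close> confine the profile at each site of the cube to
    radius at most \<open>C / real (Suc (m k))\<close>, the ball on which the trial function has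
    mass below \<open>e k\<close>.\<close>
  define s where "s = Min (insert 1 ((\<lambda>k. 1 / real (Suc (m k))) ` ?\<Lambda>))"
  have s: "s > 0" unfolding s_def using finite_lattice_cube[of n] by (subst Min_gr_iff) auto
  have sm: "s \<le> 1 / real (Suc (m k))" if "k \<in> ?\<Lambda>" for k
    unfolding s_def using that finite_lattice_cube[of n] by (intro Min_le) auto
  have "energy \<omega> A \<le> \<tau>" if \<omega>: "\<omega> \<in> space M" and sm2: "\<forall>k\<in>?\<Lambda>. lam k \<omega> \<le> s" for \<omega>
  proof -
    interpret W: form_small "breather u lam \<omega>" p K c \<eta> bV by (rule fsW[OF \<omega>])
    let ?W = "breather u lam \<omega>" and ?f = "resolvent c (brep A)"
    note [measurable] = W.V
    have W0: "0 \<le> ?W x" for x by (rule breather_nonneg[OF u0])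
    let ?S = "\<lambda>k. cball (lattice_pt k) (C / real (Suc (m k)))"
    have pt: "ennreal (?W x) \<le> ennreal (\<delta> * (?W x)\<^sup>2) + ennreal (1 / \<delta>) * indicator {x. norm x > real N} x
        + (\<Sum>k\<in>?\<Lambda>. ennreal (b k) * indicator (?S k) x)" for x
    proof (cases "norm x > real N")
      case True
      have "?W x \<le> \<delta> * (?W x)\<^sup>2 + 1 / \<delta>"
      proof (cases "?W x \<le> 1 / \<delta>")
        case True
        then show ?thesis using \<delta> by (simp add: add_increasing)
      next
        case False
        then have "1 \<le> \<delta> * ?W x" using \<delta> by (simp add: field_simps)
        from mult_right_mono[OF this W0[of x]] have "?W x \<le> \<delta> * (?W x)\<^sup>2" by (simp add: power2_eq_square mult.assoc)
        then show ?thesis using \<delta> by (simp add: add_increasing2)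
      qed
      then have "ennreal (?W x) \<le> ennreal (\<delta> * (?W x)\<^sup>2) + ennreal (1 / \<delta>)"
        using \<delta> by (simp add: ennreal_plus[symmetric] ennreal_leI del: ennreal_plus)
      then show ?thesis using True by (simp add: add_increasing2)
    next
      case False
      then have "?W x = (\<Sum>k\<in>?\<Lambda>. dilate (u k) (lam k \<omega>) (x - lattice_pt k))"
        using n lam[OF \<omega>] by (intro breather_eq_sum[where C = C] supp C) auto
      also have "\<dots> \<le> (\<Sum>k\<in>?\<Lambda>. b k * indicator (?S k) x)"
      proof (rule sum_mono)
        fix k assume k: "k \<in> ?\<Lambda>"
        show "dilate (u k) (lam k \<omega>) (x - lattice_pt k) \<le> b k * indicator (?S k) x"
        proof (cases "x \<in> ?S k")
          case True
          then show ?thesis using ub[of k] b_nonneg[of k] by (simp add: dilate_def)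
        next
          case False
          then have "norm (x - lattice_pt k) > C * (1 / real (Suc (m k)))" by (simp add: dist_norm norm_minus_commute)
          moreover have "C * lam k \<omega> \<le> C * (1 / real (Suc (m k)))"
            using sm[OF k] sm2 k C by (intro mult_left_mono) (auto intro: order_trans)
          ultimately have "norm (x - lattice_pt k) > C * lam k \<omega>" by linarith
          then have "dilate (u k) (lam k \<omega>) (x - lattice_pt k) = 0"
            using lam[OF \<omega>, of k] by (intro dilate_outside[where C = C] supp) auto
          then show ?thesis using False by simp
        qed
      qed
      finally have "ennreal (?W x) \<le> ennreal (\<Sum>k\<in>?\<Lambda>. b k * indicator (?S k) x)" by (rule ennreal_leI)
      also have "\<dots> = (\<Sum>k\<in>?\<Lambda>. ennreal (b k * indicator (?S k) x))"
        using b_nonneg by (intro sum_ennreal[symmetric]) simp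
      also have "\<dots> = (\<Sum>k\<in>?\<Lambda>. ennreal (b k) * indicator (?S k) x)"
        by (intro sum.cong refl) (simp add: indicator_def)
      finally show ?thesis by (simp add: add_increasing)
    qed
    \<comment> \<open>No smallness of scales enters: the potential times the resolvent has norm at
      most 1/2 for every realisation. This controls the sites outside the cube, whose scales and
      profile bounds are arbitrary.\<close>
    have sq: "(\<integral>\<^sup>+x. ennreal ((?W x)\<^sup>2) * g x \<partial>lborel) \<le> ennreal ((norm A)\<^sup>2 / 4)"
    proof -
      have "(\<integral>\<^sup>+x. ennreal ((?W x)\<^sup>2) * g x \<partial>lborel) = (\<integral>\<^sup>+x. ennreal ((norm (complex_of_real (?W x) * ?f x))\<^sup>2) \<partial>lebesgue)"
        by (simp add: nn_integral_completion g_def norm_mult power_mult_distrib ennreal_mult)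
      also have "\<dots> = ennreal ((norm (vop ?W c A))\<^sup>2)"
        unfolding vop_def by (rule nn_norm_mk_l2[OF W.vop_L2[OF order_refl], symmetric])
      also have "\<dots> \<le> ennreal ((1 / 2 * norm A)\<^sup>2)"
        by (intro ennreal_leI power_mono W.norm_vop_le) auto
      also have "(1 / 2 * norm A)\<^sup>2 = (norm A)\<^sup>2 / 4" by (simp add: power2_eq_square)
      finally show ?thesis .
    qed
    have "ennreal (energy \<omega> A) = (\<integral>\<^sup>+x. ennreal (?W x * (norm (?f x))\<^sup>2) \<partial>lebesgue)"
      unfolding energy_def using W0
      by (intro nn_integral_eq_integral[symmetric] potential_form_integrable[OF fsW[OF \<omega>]]) auto
    also have "\<dots> = (\<integral>\<^sup>+x. ennreal (?W x) * g x \<partial>lborel)"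
      by (simp add: nn_integral_completion g_def ennreal_mult W0)
    also have "\<dots> \<le> (\<integral>\<^sup>+x. ennreal \<delta> * (ennreal ((?W x)\<^sup>2) * g x) + ennreal (1 / \<delta>) * (g x * indicator {x. norm x > real N} x)
        + (\<Sum>k\<in>?\<Lambda>. ennreal (b k) * (g x * indicator (?S k) x)) \<partial>lborel)"
    proof (rule nn_integral_mono)
      fix x
      have "ennreal (?W x) * g x \<le> (ennreal (\<delta> * (?W x)\<^sup>2) + ennreal (1 / \<delta>) * indicator {x. norm x > real N} x
        + (\<Sum>k\<in>?\<Lambda>. ennreal (b k) * indicator (?S k) x)) * g x" by (intro mult_right_mono pt) simp
      also have "\<dots> = ennreal \<delta> * (ennreal ((?W x)\<^sup>2) * g x) + ennreal (1 / \<delta>) * (g x * indicator {x. norm x > real N} x)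
        + (\<Sum>k\<in>?\<Lambda>. ennreal (b k) * (g x * indicator (?S k) x))"
        using \<delta> by (simp add: distrib_left distrib_right sum_distrib_left sum_distrib_right ennreal_mult ac_simps)
      finally show "ennreal (?W x) * g x \<le> \<dots>" .
    qed
    also have "\<dots> = ennreal \<delta> * (\<integral>\<^sup>+x. ennreal ((?W x)\<^sup>2) * g x \<partial>lborel)
      + ennreal (1 / \<delta>) * (\<integral>\<^sup>+x. g x * indicator {x. norm x > real N} x \<partial>lborel)
      + (\<Sum>k\<in>?\<Lambda>. ennreal (b k) * (\<integral>\<^sup>+x. g x * indicator (?S k) x \<partial>lborel))"
    proof -
      have [measurable]: "{x :: real^'d. norm x > real N} \<in> sets borel" by measurable
      have Sm [measurable]: "?S k \<in> sets borel" for k by simp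
      have m1 [measurable]: "(\<lambda>x. ennreal \<delta> * (ennreal ((?W x)\<^sup>2) * g x)) \<in> borel_measurable lborel"
        "(\<lambda>x. ennreal (1 / \<delta>) * (g x * indicator {x. norm x > real N} x)) \<in> borel_measurable lborel" by measurable
      have m2 [measurable]: "(\<lambda>x. ennreal (b k) * (g x * indicator (?S k) x)) \<in> borel_measurable lborel" for k by measurable
      have t1: "(\<integral>\<^sup>+x. ennreal \<delta> * (ennreal ((?W x)\<^sup>2) * g x) \<partial>lborel) = ennreal \<delta> * (\<integral>\<^sup>+x. ennreal ((?W x)\<^sup>2) * g x \<partial>lborel)"
        by (intro nn_integral_cmult) measurable
      have t2: "(\<integral>\<^sup>+x. ennreal (1 / \<delta>) * (g x * indicator {x. norm x > real N} x) \<partial>lborel)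
        = ennreal (1 / \<delta>) * (\<integral>\<^sup>+x. g x * indicator {x. norm x > real N} x \<partial>lborel)"
        by (intro nn_integral_cmult) measurable
      have "(\<integral>\<^sup>+x. (\<Sum>k\<in>?\<Lambda>. ennreal (b k) * (g x * indicator (?S k) x)) \<partial>lborel)
        = (\<Sum>k\<in>?\<Lambda>. \<integral>\<^sup>+x. ennreal (b k) * (g x * indicator (?S k) x) \<partial>lborel)"
        by (rule nn_integral_sum) (rule m2)
      also have "\<dots> = (\<Sum>k\<in>?\<Lambda>. ennreal (b k) * (\<integral>\<^sup>+x. g x * indicator (?S k) x \<partial>lborel))"
        by (intro sum.cong refl nn_integral_cmult) measurable
      finally have t3: "(\<integral>\<^sup>+x. (\<Sum>k\<in>?\<Lambda>. ennreal (b k) * (g x * indicator (?S k) x)) \<partial>lborel)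
        = (\<Sum>k\<in>?\<Lambda>. ennreal (b k) * (\<integral>\<^sup>+x. g x * indicator (?S k) x \<partial>lborel))" .
      show ?thesis
        by (subst nn_integral_add, intro borel_measurable_add m1, intro borel_measurable_sum m2,
          subst nn_integral_add, rule m1, rule m1, simp only: t1 t2 t3)
    qed
    also have "\<dots> \<le> ennreal \<delta> * ennreal ((norm A)\<^sup>2 / 4) + ennreal (1 / \<delta>) * ennreal (\<delta> * \<tau> / 3)
      + (\<Sum>k\<in>?\<Lambda>. ennreal (b k) * ennreal (e k))"
      by (intro add_mono mult_left_mono sum_mono sq less_imp_le[OF N] less_imp_le[OF m]) auto
    also have "\<dots> = ennreal (\<delta> * ((norm A)\<^sup>2 / 4) + 1 / \<delta> * (\<delta> * \<tau> / 3) + (\<Sum>k\<in>?\<Lambda>. b k * e k))"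
    proof -
      have "(\<Sum>k\<in>?\<Lambda>. ennreal (b k) * ennreal (e k)) = ennreal (\<Sum>k\<in>?\<Lambda>. b k * e k)"
        using b_nonneg e by (subst sum_ennreal[symmetric]) (auto simp: ennreal_mult less_imp_le)
      moreover have "0 \<le> (\<Sum>k\<in>?\<Lambda>. b k * e k)" using b_nonneg e by (intro sum_nonneg) (simp add: less_imp_le)
      ultimately show ?thesis
        using \<delta> \<tau> by (simp only: ennreal_mult[symmetric] ennreal_plus[symmetric] divide_nonneg_nonneg mult_nonneg_nonneg
          less_imp_le zero_le_power2 add_nonneg_nonneg zero_le_numeral zero_le_one)
    qed
    also have "\<dots> \<le> ennreal \<tau>"
    proof (rule ennreal_leI)
      have "(\<Sum>k\<in>?\<Lambda>. b k * e k) \<le> (\<Sum>k\<in>?\<Lambda>. \<tau> / (3 * (real (card ?\<Lambda>) + 1)))"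
      proof (rule sum_mono)
        fix k
        have "b k / (b k + 1) \<le> 1" using b_nonneg[of k] by simp
        then have "\<tau> / (3 * (real (card ?\<Lambda>) + 1)) * (b k / (b k + 1)) \<le> \<tau> / (3 * (real (card ?\<Lambda>) + 1)) * 1"
          using \<tau> by (intro mult_left_mono) auto
        then show "b k * e k \<le> \<tau> / (3 * (real (card ?\<Lambda>) + 1))" by (simp add: e_def mult.commute)
      qed
      also have "\<dots> = \<tau> / 3 * (real (card ?\<Lambda>) / (real (card ?\<Lambda>) + 1))" by simp
      also have "\<dots> \<le> \<tau> / 3 * 1" using \<tau> by (intro mult_left_mono) auto
      finally have "(\<Sum>k\<in>?\<Lambda>. b k * e k) \<le> \<tau> / 3" by simp
      moreover have "\<delta> * ((norm A)\<^sup>2 / 4) \<le> \<tau> / 4" using \<delta>A by simp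
      moreover have "1 / \<delta> * (\<delta> * \<tau> / 3) = \<tau> / 3" using \<delta> by simp
      ultimately have "\<delta> * ((norm A)\<^sup>2 / 4) + 1 / \<delta> * (\<delta> * \<tau> / 3) + (\<Sum>k\<in>?\<Lambda>. b k * e k) \<le> \<tau> / 4 + \<tau> / 3 + \<tau> / 3"
        by (intro add_mono) simp_all
      also have "\<dots> \<le> \<tau>" using \<tau> by simp
      finally show "\<delta> * ((norm A)\<^sup>2 / 4) + 1 / \<delta> * (\<delta> * \<tau> / 3) + (\<Sum>k\<in>?\<Lambda>. b k * e k) \<le> \<tau>" .
    qed
    finally show ?thesis using \<tau> by simp
  qed
  with s show ?thesis by blast
qed

lemma small_scales_positive:
  assumes s: "s > 0"
  shows "prob {\<omega> \<in> space M. \<forall>k\<in>lattice_cube n. lam k \<omega> \<le> s} > 0"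
proof -
  have ne: "lattice_cube n \<noteq> ({} :: (int^'d) set)"
    by (intro ex_in_conv[THEN iffD1] exI[of _ 0]) (simp add: lattice_cube_def)
  have "prob (\<Inter>k\<in>lattice_cube n. lam k -` {..s} \<inter> space M) = (\<Prod>k\<in>lattice_cube n. prob (lam k -` {..s} \<inter> space M))"
    by (rule indep_varsD[OF indep ne finite_lattice_cube]) auto
  also have "\<dots> > 0"
  proof (rule prod_pos)
    fix k
    have "lam k -` {..s} \<inter> space M = {\<omega> \<in> space M. lam k \<omega> \<le> s}" by auto
    then show "prob (lam k -` {..s} \<inter> space M) > 0" using small[OF s] by simp
  qed
  also have "(\<Inter>k\<in>lattice_cube n. lam k -` {..s} \<inter> space M) = {\<omega> \<in> space M. \<forall>k\<in>lattice_cube n. lam k \<omega> \<le> s}"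
    using ne by auto
  finally show ?thesis .
qed

theorem bottom_event_positive:
  assumes \<epsilon>: "\<epsilon> > 0"
  shows "prob {\<omega> \<in> space M. rayleigh_inf (\<lambda>x. Vp x + breather u lam \<omega> x) \<le> rayleigh_inf Vp + \<epsilon>} > 0"
proof -
  interpret P: form_small Vp p K c \<eta> bV by (rule fsP)
  have "rayleigh_inf Vp < rayleigh_inf Vp + \<epsilon> / 2" using \<epsilon> by simp
  then obtain A where A: "gop c A \<noteq> 0" "P.quad A < (rayleigh_inf Vp + \<epsilon> / 2) * (norm (gop c A))\<^sup>2"
    using P.rayleigh_inf_less_iff[OF closure_UNIV] by blast
  \<comment> \<open>The trial function already spends half of \<epsilon> on the periodic operator;
    the other half is left for the energy in the breather potential.\<close>
  define \<tau> where "\<tau> = \<epsilon> / 2 * (norm (gop c A))\<^sup>2"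
  have "\<tau> > 0" using \<epsilon> A(1) by (simp add: \<tau>_def)
  then obtain s n where s: "s > 0"
    and sn: "\<And>\<omega>. \<omega> \<in> space M \<Longrightarrow> (\<forall>k\<in>lattice_cube n. lam k \<omega> \<le> s) \<Longrightarrow> energy \<omega> A \<le> \<tau>"
    using energy_small[of \<tau> A] by blast
  have "0 < prob {\<omega> \<in> space M. \<forall>k\<in>lattice_cube n. lam k \<omega> \<le> s}" by (rule small_scales_positive[OF s])
  also have "\<dots> \<le> prob {\<omega> \<in> space M. rayleigh_inf (\<lambda>x. Vp x + breather u lam \<omega> x) \<le> rayleigh_inf Vp + \<epsilon>}"
  proof (rule finite_measure_mono[OF _ event_measurable])
    show "{\<omega> \<in> space M. \<forall>k\<in>lattice_cube n. lam k \<omega> \<le> s}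
      \<subseteq> {\<omega> \<in> space M. rayleigh_inf (\<lambda>x. Vp x + breather u lam \<omega> x) \<le> rayleigh_inf Vp + \<epsilon>}"
    proof (intro subsetI CollectI conjI)
      fix \<omega> assume "\<omega> \<in> {\<omega> \<in> space M. \<forall>k\<in>lattice_cube n. lam k \<omega> \<le> s}"
      then have \<omega>: "\<omega> \<in> space M" and "\<forall>k\<in>lattice_cube n. lam k \<omega> \<le> s" by auto
      then have "energy \<omega> A \<le> \<tau>" by (rule sn)
      then have "form_small.quad (\<lambda>x. Vp x + breather u lam \<omega> x) c A < (rayleigh_inf Vp + \<epsilon>) * (norm (gop c A))\<^sup>2"
        using A(2) unfolding quad_split[OF \<omega>] \<tau>_def by (simp add: algebra_simps)
      then have "rayleigh_inf (\<lambda>x. Vp x + breather u lam \<omega> x) < rayleigh_inf Vp + \<epsilon>"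
        using A(1) form_small.rayleigh_inf_less_iff[OF fsV[OF \<omega>] closure_UNIV] by blast
      then show "rayleigh_inf (\<lambda>x. Vp x + breather u lam \<omega> x) \<le> rayleigh_inf Vp + \<epsilon>" by simp
      show "\<omega> \<in> space M" by (rule \<omega>)
    qed
  qed
  finally show ?thesis .
qed

end

section \<open>Reduction of the statement to Borel versions with common constants\<close>

lemma cell_bound_add:
  fixes v w :: "real^'d \<Rightarrow> real"
  assumes [measurable]: "v \<in> borel_measurable borel" "w \<in> borel_measurable borel"
    and v: "\<And>x. \<bar>v x\<bar> \<le> r" and p: "p > 0" and \<kappa>: "\<kappa> \<ge> 0" and w: "cell_bound p \<kappa> w"
  shows "cell_bound p (2 powr p * (r powr p + \<kappa>)) (\<lambda>x. v x + w x)"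
  unfolding cell_bound_def
proof
  fix x :: "real^'d"
  let ?I = "indicator ((+) x ` open_cell) :: real^'d \<Rightarrow> ennreal"
  have [measurable]: "(+) x ` open_cell \<in> sets borel" by (simp add: translated_cell_eq)
  have r: "r \<ge> 0" using order_trans[OF abs_ge_zero v] .
  have "(\<integral>\<^sup>+y. ennreal (\<bar>v y + w y\<bar> powr p) * ?I y \<partial>lborel)
    \<le> (\<integral>\<^sup>+y. ennreal (2 powr p) * (ennreal (r powr p) * ?I y + ennreal (\<bar>w y\<bar> powr p) * ?I y) \<partial>lborel)"
  proof (rule nn_integral_mono)
    fix y
    have "\<bar>v y + w y\<bar> powr p \<le> 2 powr p * (\<bar>v y\<bar> powr p + \<bar>w y\<bar> powr p)" by (rule powr_add_le[OF p])
    also have "\<dots> \<le> 2 powr p * (r powr p + \<bar>w y\<bar> powr p)"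
      using v[of y] p by (intro mult_left_mono add_right_mono powr_mono2) auto
    finally have "ennreal (\<bar>v y + w y\<bar> powr p) \<le> ennreal (2 powr p * (r powr p + \<bar>w y\<bar> powr p))" by (rule ennreal_leI)
    also have "\<dots> = ennreal (2 powr p) * (ennreal (r powr p) + ennreal (\<bar>w y\<bar> powr p))" by (simp add: ennreal_mult)
    finally show "ennreal (\<bar>v y + w y\<bar> powr p) * ?I y \<le> ennreal (2 powr p) * (ennreal (r powr p) * ?I y + ennreal (\<bar>w y\<bar> powr p) * ?I y)"
      by (auto simp: indicator_def)
  qed
  also have "\<dots> = ennreal (2 powr p) * (ennreal (r powr p) * emeasure lborel ((+) x ` open_cell)
      + (\<integral>\<^sup>+y. ennreal (\<bar>w y\<bar> powr p) * ?I y \<partial>lborel))"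
    by (simp add: nn_integral_cmult nn_integral_add nn_integral_cmult_indicator)
  also have "\<dots> \<le> ennreal (2 powr p) * (ennreal (r powr p) * 1 + ennreal \<kappa>)"
    using w unfolding cell_bound_def by (intro mult_left_mono add_mono) (simp_all add: emeasure_translated_cell)
  also have "\<dots> = ennreal (2 powr p * (r powr p + \<kappa>))" using \<kappa> by (simp add: ennreal_mult)
  finally show "(\<integral>\<^sup>+y. ennreal (\<bar>v y + w y\<bar> powr p) * ?I y \<partial>lborel) \<le> ennreal (2 powr p * (r powr p + \<kappa>))" .
qed

lemma Lp_norm_cong_AE:
  assumes "AE x in lborel. f x = g x"
  shows "Lp_norm p f = Lp_norm p g"
proof -
  have "(\<integral>\<^sup>+x. ennreal (\<bar>f x\<bar> powr p) \<partial>lebesgue) = (\<integral>\<^sup>+x. ennreal (\<bar>g x\<bar> powr p) \<partial>lebesgue)"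
    by (rule nn_integral_cong_AE) (use AE_completion[OF assms] in auto)
  then show ?thesis by (simp add: Lp_norm_def)
qed


theorem lemma1p1:
  fixes M :: "'w measure"
    and C p \<mu> :: real
    and u :: "int^'d \<Rightarrow> real^'d \<Rightarrow> real"
    and lam :: "int^'d \<Rightarrow> 'w \<Rightarrow> real"
    and Vper :: "real^'d \<Rightarrow> real"
  assumes prob_space: "prob_space M"
    and p: "p > max 2 (real CARD('d) / 2)"
    and C: "C > 0"
    and u_Linf: "\<And>k. u k \<in> Linf"
    and u_nonneg: "\<And>k. AE y in lebesgue. 0 \<le> u k y"
    and u_nonvanishing: "\<And>k. \<not> (AE y in lebesgue. u k y = 0)"
    and u_support: "\<And>k. AE y in lebesgue. norm y > C \<longrightarrow> u k y = 0"
    and lam_range: "\<And>k \<omega>. \<omega> \<in> space M \<Longrightarrow> lam k \<omega> \<in> {0..C}"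
    and lam_indep: "prob_space.indep_vars M (\<lambda>_. borel) lam UNIV"
    and Vper_Linf: "Vper \<in> Linf"
    and Vper_periodic: "\<And>k. AE x in lebesgue. Vper (x + lattice_pt k) = Vper x"
    and breather_bound:
      "(SUP \<omega>\<in>space M. SUP x. Lp_norm p (\<lambda>y. breather u lam \<omega> y * indicator ((+) x ` open_cell) y))
        < \<infinity>"
    and \<mu>: "\<mu> > 0"
    and breather_nondegenerate:
      "(INF k. measure M {\<omega> \<in> space M.
          measure lebesgue {x \<in> closed_cell. dilate (u k) (lam k \<omega>) x \<ge> \<mu>} \<ge> \<mu>}) \<ge> \<mu>"
    and small_profiles:
      "\<And>\<kappa> k. \<kappa> > 0 \<Longrightarrow>
        measure M {\<omega> \<in> space M. Lp_norm p (dilate (u k) (lam k \<omega>)) \<le> ennreal \<kappa>} > 0"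
  shows "\<forall>\<epsilon>>0. measure M {\<omega> \<in> space M.
          inf_spectrum (schroedinger (\<lambda>x. Vper x + breather u lam \<omega> x))
            \<le> inf_spectrum (schroedinger Vper) + ereal \<epsilon>} > 0"
proof -
  interpret prob_space M by (rule prob_space)
  have p2: "p > 2" and pd: "p > real CARD('d) / 2" using p by auto
  have "\<exists>v b. v \<in> borel_measurable borel \<and> 0 \<le> b \<and> (\<forall>x. \<bar>v x\<bar> \<le> b) \<and> (AE x in lborel. u k x = v x)" for k
    by (rule Linf_borel_version[OF u_Linf])
  then obtain v b where v: "\<And>k. v k \<in> borel_measurable borel" and b0: "\<And>k. 0 \<le> b k"
    and vb: "\<And>k x. \<bar>v k x\<bar> \<le> b k" and uv: "\<And>k. AE x in lborel. u k x = v k x" by metis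
  \<comment> \<open>Positive part and cut-off to the closed ball make the sign and support
    conditions hold at every point; the hypotheses on \<open>u\<close> say that this alters it only
    on a null set.\<close>
  define w where "w k y = indicator (cball 0 C) y * max 0 (v k y)" for k y
  have wm: "w k \<in> borel_measurable borel" for k unfolding w_def[abs_def]
    by (intro borel_measurable_times borel_measurable_max borel_measurable_const borel_measurable_indicator v) simp
  have w0: "0 \<le> w k y" for k y by (simp add: w_def)
  have wb: "w k y \<le> b k" for k y using vb[of k y] b0[of k] by (auto simp: w_def indicator_def)
  have wsupp: "w k y = 0" if "norm y > C" for k y using that by (simp add: w_def)
  have uw: "AE y in lborel. u k y = w k y" for k
    using uv[of k] u_nonneg[of k] u_support[of k] unfolding AE_completion_iff
    by eventually_elim (auto simp: w_def indicator_def not_le)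
  have wnz: "\<not> (AE y in lborel. w k y = 0)" for k
  proof
    assume "AE y in lborel. w k y = 0"
    with uw[of k] have "AE y in lborel. u k y = 0" by eventually_elim simp
    with u_nonvanishing[of k] show False by (simp add: AE_completion_iff)
  qed
  have breather_uw: "AE x in lborel. breather u lam \<omega> x = breather w lam \<omega> x" for \<omega>
    by (rule breather_cong_AE) (rule uw)
  obtain Vp r where Vp [measurable]: "Vp \<in> borel_measurable borel" and r0: "0 \<le> r" and Vpb: "\<And>x. \<bar>Vp x\<bar> \<le> r"
    and VVp: "AE x in lborel. Vper x = Vp x"
    using Linf_borel_version[OF Vper_Linf] by blast
  have lam_m: "lam k \<in> borel_measurable M" for k using lam_indep by (simp add: indep_vars_def)
  have Wm: "breather w lam \<omega> \<in> borel_measurable borel" if \<omega>: "\<omega> \<in> space M" for \<omega>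
  proof -
    have "(\<lambda>(\<omega>, x). breather w lam \<omega> x) \<in> borel_measurable (M \<Otimes>\<^sub>M lborel)"
      by (rule breather_measurable[OF wm wsupp C lam_range lam_m])
    from measurable_compose[OF measurable_Pair1'[OF \<omega>] this] show ?thesis by simp
  qed
  have W0: "0 \<le> breather w lam \<omega> x" for \<omega> x by (rule breather_nonneg[OF w0])
  obtain \<kappa> where \<kappa>0: "0 \<le> \<kappa>" and \<kappa>: "\<And>\<omega>. \<omega> \<in> space M \<Longrightarrow> cell_bound p \<kappa> (breather w lam \<omega>)"
  proof -
    define S where "S = (SUP \<omega>\<in>space M. SUP x. Lp_norm p (\<lambda>y. breather u lam \<omega> y * indicator ((+) x ` open_cell) y))"
    have S: "S = ennreal (enn2real S)" using breather_bound by (simp add: S_def)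
    have "cell_bound p (enn2real S powr p) (breather w lam \<omega>)" if \<omega>: "\<omega> \<in> space M" for \<omega>
      unfolding cell_bound_def
    proof
      fix x :: "real^'d"
      have "Lp_norm p (\<lambda>y. breather u lam \<omega> y * indicator ((+) x ` open_cell) y) \<le> S"
        unfolding S_def by (rule SUP_upper2[OF \<omega>], rule SUP_upper2[OF UNIV_I[of x]], rule order_refl)
      then have "Lp_norm p (\<lambda>y. breather u lam \<omega> y * indicator ((+) x ` open_cell) y) \<le> ennreal (enn2real S)"
        using S by simp
      from Lp_norm_le_imp[OF this] p2
      have "(\<integral>\<^sup>+y. ennreal (\<bar>breather u lam \<omega> y * indicator ((+) x ` open_cell) y\<bar> powr p) \<partial>lebesgue) \<le> ennreal (enn2real S powr p)"
        by simp
      also have "(\<integral>\<^sup>+y. ennreal (\<bar>breather u lam \<omega> y * indicator ((+) x ` open_cell) y\<bar> powr p) \<partial>lebesgue)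
        = (\<integral>\<^sup>+y. ennreal (\<bar>breather w lam \<omega> y\<bar> powr p) * indicator ((+) x ` open_cell) y \<partial>lborel)"
        unfolding nn_integral_completion
      proof (rule nn_integral_cong_AE)
        show "AE y in lborel. ennreal (\<bar>breather u lam \<omega> y * indicator ((+) x ` open_cell) y\<bar> powr p)
          = ennreal (\<bar>breather w lam \<omega> y\<bar> powr p) * indicator ((+) x ` open_cell) y"
          using breather_uw[of \<omega>] by eventually_elim (auto simp: indicator_def)
      qed
      finally show "(\<integral>\<^sup>+y. ennreal (\<bar>breather w lam \<omega> y\<bar> powr p) * indicator ((+) x ` open_cell) y \<partial>lborel)
        \<le> ennreal (enn2real S powr p)" .
    qed
    then show ?thesis using that[of "enn2real S powr p"] by simp
  qed
  define K where "K = 2 powr p * (r powr p + \<kappa>)"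
  have K: "K \<ge> 0" using \<kappa>0 by (simp add: K_def)
  \<comment> \<open>Makes \<open>cell_const\<close> times \<open>\<eta>\<^sup>2\<close> equal to
    1/4, the square of the norm bound 1/2 for the potential times the resolvent.\<close>
  define \<eta> where "\<eta> = 1 / (2 * sqrt (cell_const TYPE('d) K))"
  have cc: "cell_const TYPE('d) K > 0" using K by (simp add: cell_const_def add_pos_nonneg)
  have \<eta>: "\<eta> > 0" using cc by (simp add: \<eta>_def)
  have \<eta>2: "cell_const TYPE('d) K * \<eta>\<^sup>2 \<le> 1 / 4" using cc by (simp add: \<eta>_def power_divide power_mult_distrib)
  \<comment> \<open>The exponent d/p is below 2 because p > d/2, as
    \<open>time_integral_small\<close> demands.\<close>
  obtain c where c: "c > 0" and I: "\<And>c'. c' \<ge> c \<Longrightarrow>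
      (\<integral>\<^sup>+s. ennreal (rayleigh c' s) * ennreal (theta (real CARD('d) / p) (real CARD('d) / 4) s) \<partial>lborel) \<le> ennreal \<eta>"
    using time_integral_small[of "real CARD('d) / p" "real CARD('d) / 4" \<eta>] p2 pd \<eta> by (auto simp: field_simps)
  \<comment> \<open>Stated for a bounded part plus a nonnegative part so that setting one of them to
    zero yields the periodic and the breather potential with the constants of the sum.\<close>
  have fs: "form_small (\<lambda>x. a x + W x) p K c \<eta> r"
    if [measurable]: "a \<in> borel_measurable borel" "W \<in> borel_measurable borel"
      and a: "\<And>x. \<bar>a x\<bar> \<le> r" and W: "\<And>x. 0 \<le> W x" "cell_bound p \<kappa> W" for a W :: "real^'d \<Rightarrow> real"
  proof
    show "cell_bound p K (\<lambda>x. a x + W x)"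
      unfolding K_def by (rule cell_bound_add) (use that p2 \<kappa>0 in auto)
    show "AE x in lebesgue. - r \<le> a x + W x"
    proof (intro AE_I2)
      fix x show "- r \<le> a x + W x" using a[of x] W(1)[of x] by linarith
    qed
  qed (use p2 K c \<eta> I \<eta>2 in auto)
  have cell0: "cell_bound p \<kappa> (\<lambda>x :: real^'d. 0)" by (simp add: cell_bound_def)
  interpret random_breather M C p K c \<eta> r w lam Vp b
  proof (intro random_breather.intro random_breather_axioms.intro)
    show "form_small (\<lambda>x. Vp x + breather w lam \<omega> x) p K c \<eta> r" if "\<omega> \<in> space M" for \<omega>
      by (rule fs) (use Wm[OF that] Vpb W0 \<kappa>[OF that] in auto)
    show "form_small (breather w lam \<omega>) p K c \<eta> r" if "\<omega> \<in> space M" for \<omega>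
      using fs[of "\<lambda>x. 0" "breather w lam \<omega>"] Wm[OF that] r0 W0 \<kappa>[OF that] by simp
    show "form_small Vp p K c \<eta> r"
      using fs[of Vp "\<lambda>x. 0"] Vpb cell0 by simp
    show "prob {\<omega> \<in> space M. lam k \<omega> \<le> s} > 0" if s: "s > 0" for s k
    proof -
      \<comment> \<open>Translates the hypothesis from norms to scales: when the norm of the dilated
        profile is at most this \<open>\<kappa>'\<close>, the scale is at most
        \<open>s\<close>.\<close>
      obtain \<kappa>' where \<kappa>': "\<kappa>' > 0" "\<forall>l\<ge>0. Lp_norm p (dilate (w k) l) \<le> ennreal \<kappa>' \<longrightarrow> l \<le> s"
        using small_dilate_norm_imp_small_scale[OF wm wnz _ s, of p k] p2 by auto
      have eq: "Lp_norm p (dilate (u k) l) = Lp_norm p (dilate (w k) l)" for l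
        by (rule Lp_norm_cong_AE) (use AE_dilate_cong[OF uw[of k], of l 0] in simp)
      have "0 < prob {\<omega> \<in> space M. Lp_norm p (dilate (u k) (lam k \<omega>)) \<le> ennreal \<kappa>'}"
        by (rule small_profiles[OF \<kappa>'(1)])
      also have "\<dots> \<le> prob {\<omega> \<in> space M. lam k \<omega> \<le> s}"
      proof (rule finite_measure_mono)
        show "{\<omega> \<in> space M. Lp_norm p (dilate (u k) (lam k \<omega>)) \<le> ennreal \<kappa>'} \<subseteq> {\<omega> \<in> space M. lam k \<omega> \<le> s}"
          unfolding eq using \<kappa>'(2) lam_range by auto
        show "{\<omega> \<in> space M. lam k \<omega> \<le> s} \<in> events" using lam_m[of k] by measurable
      qed
      finally show ?thesis .
    qed
  qed (use C wm w0 wb wsupp lam_range lam_indep prob_space_axioms in auto)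
  have per: "inf_spectrum (schroedinger Vper) = ereal (rayleigh_inf Vp)"
    using form_small.inf_spectrum_eq[OF fsP] schroedinger_cong_AE[OF VVp] by simp
  have ran: "inf_spectrum (schroedinger (\<lambda>x. Vper x + breather u lam \<omega> x)) = ereal (rayleigh_inf (\<lambda>x. Vp x + breather w lam \<omega> x))"
    if \<omega>: "\<omega> \<in> space M" for \<omega>
  proof -
    have "AE x in lborel. Vper x + breather u lam \<omega> x = Vp x + breather w lam \<omega> x"
      using VVp breather_uw[of \<omega>] by eventually_elim simp
    from schroedinger_cong_AE[OF this] form_small.inf_spectrum_eq[OF fsV[OF \<omega>]] show ?thesis by simp
  qed
  show ?thesis
  proof (intro allI impI)
    fix \<epsilon> :: real assume "\<epsilon> > 0"
    have "{\<omega> \<in> space M. inf_spectrum (schroedinger (\<lambda>x. Vper x + breather u lam \<omega> x)) \<le> inf_spectrum (schroedinger Vper) + ereal \<epsilon>}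
      = {\<omega> \<in> space M. rayleigh_inf (\<lambda>x. Vp x + breather w lam \<omega> x) \<le> rayleigh_inf Vp + \<epsilon>}"
      by (intro Collect_cong conj_cong refl) (simp add: ran per)
    then show "measure M {\<omega> \<in> space M. inf_spectrum (schroedinger (\<lambda>x. Vper x + breather u lam \<omega> x))
        \<le> inf_spectrum (schroedinger Vper) + ereal \<epsilon>} > 0"
      using bottom_event_positive[OF \<open>\<epsilon> > 0\<close>] by simp
  qed
qed

end
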